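(* Let $p\ge 2q\ge 1$ be integers (with $q\geq 1$). Then the orbit convolution $*_{p,q}$ on $M_b(\Pi_q\times\mathbb{R})$ associated with the action of $U_p$ on the Heisenberg group $H_{p,q}$ is given on point measures by $$(\delta_{(r,a)}*_{p,q}\delta_{(s,b)})(f)=\kappa_{p,q}\int_{B_q} f\Bigl(\sqrt{r^2+s^2+rws+(rws)^*},\;a+b-\operatorname{Im}\operatorname{tr}(rws)\Bigr)\,\Delta(I_q-w^*w)^{p-2q}\,dw$$ for $f\in C_b(\Pi_q\times\mathbb{R})$, $r,s\in\Pi_q$, $a,b\in\mathbb{R}$.
   Context: $M_{p,q}$ is the space of complex $p\times q$ matrices. The Heisenberg group is $H_{p,q}:=M_{p,q}\times\mathbb{R}$ with product $(x,a)\cdot(y,b)=(x+y,a+b-\operatorname{Im}\operatorname{tr}(x^*y))$. The unitary group $U_p$ acts on it by automorphisms $u(x,a):=(ux,a)$. $G_{p,q}:=U_p\ltimes H_{p,q}$ is the semidirect product, with $U_p$ regarded as a compact subgroup. $\Pi_q$ is the cone of Hermitian positive semidefinite complex $q\times q$ matrices. The double coset space $G_{p,q}//U_p$ is identified with the space of $U_p$-orbits in $H_{p,q}$, and this with $\Pi_q\times\mathbb{R}$ via $U_p(x,a)\simeq(|x|,a)$, $|x|:=\sqrt{x^*x}$. Let $P:G_{p,q}\to G_{p,q}//U_p\simeq\Pi_q\times\mathbb{R}$ be the canonical projection. Taking images of measures under $P$ gives an isometric isomorphism from the Banach space of $U_p$-biinvariant bounded Borel measures on $G_{p,q}$ onto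 the space $M_b(\Pi_q\times\mathbb{R})$ of bounded Borel measures; $*_{p,q}$ denotes the convolution on $M_b(\Pi_q\times\mathbb{R})$ obtained by transferring the usual convolution of $U_p$-biinvariant measures via this isomorphism. Further notation: $\mu(f)=\int f\,d\mu$; $\sqrt{\cdot}$ is the positive semidefinite square root; $\Delta$ is the determinant of a $q\times q$ matrix; $I_q$ the identity matrix; $B_q:=\{w\in M_{q,q}:I_q-w^*w\text{ is positive definite}\}$; $dw$ is Lebesgue measure on $M_{q,q}$; $\kappa_{p,q}:=\bigl(\int_{B_q}\Delta(I_q-w^*w)^{p-2q}dw\bigr)^{-1}>0$. *)

theory Defs
  imports "HOL-Analysis.Analysis"
begin

section \<open>Complex matrices\<close>

text \<open>The space of complex p x q matrices is the type \<^typ>\<open>complex^'q^'p\<close>, so p and q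
  are \<open>CARD('p)\<close> and \<open>CARD('q)\<close>.\<close>

definition ctranspose :: "complex^'n^'m \<Rightarrow> complex^'m^'n" where
  "ctranspose A = (\<chi> i j. cnj (A $ j $ i))"

definition hermitian :: "complex^'n^'n \<Rightarrow> bool" where
  "hermitian A \<longleftrightarrow> ctranspose A = A"

text \<open>The value \<open>v\<^sup>* A v\<close>; it is real when \<open>A\<close> is Hermitian.\<close>

definition quad_form :: "complex^'n^'n \<Rightarrow> complex^'n \<Rightarrow> complex" where
  "quad_form A v = (\<Sum>i\<in>UNIV. cnj (v $ i) * (A *v v) $ i)"

definition pos_semidef :: "complex^'n^'n \<Rightarrow> bool" where
  "pos_semidef A \<longleftrightarrow> hermitian A \<and> (\<forall>v. 0 \<le> Re (quad_form A v))"

definition pos_def :: "complex^'n^'n \<Rightarrow> bool" where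
  "pos_def A \<longleftrightarrow> hermitian A \<and> (\<forall>v. v \<noteq> 0 \<longrightarrow> 0 < Re (quad_form A v))"

definition psd_cone :: "(complex^'n^'n) set" where
  "psd_cone = {A. pos_semidef A}"

definition psd_sqrt :: "complex^'n^'n \<Rightarrow> complex^'n^'n" where
  "psd_sqrt A = (THE B. pos_semidef B \<and> B ** B = A)"

definition mat_abs :: "complex^'n^'m \<Rightarrow> complex^'n^'n" where
  "mat_abs x = psd_sqrt (ctranspose x ** x)"

definition unitary_matrices :: "(complex^'n^'n) set" where
  "unitary_matrices = {u. ctranspose u ** u = mat 1 \<and> u ** ctranspose u = mat 1}"


section \<open>The Heisenberg group and its semidirect product with the unitary group\<close>

type_synonym ('p, 'q) heis = "(complex^'q^'p) \<times> real"

definition heis_mult :: "('p::finite, 'q::finite) heis \<Rightarrow> ('p, 'q) heis \<Rightarrow> ('p, 'q) heis" where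
  "heis_mult g h =
     (fst g + fst h, snd g + snd h - Im (trace (ctranspose (fst g) ** fst h)))"

definition heis_act :: "complex^'p^'p \<Rightarrow> ('p::finite, 'q::finite) heis \<Rightarrow> ('p, 'q) heis" where
  "heis_act u h = (u ** fst h, snd h)"

type_synonym ('p, 'q) semi = "(complex^'p^'p) \<times> ('p, 'q) heis"

definition semi_carrier :: "('p::finite, 'q::finite) semi set" where
  "semi_carrier = unitary_matrices \<times> UNIV"

definition semi_mult :: "('p::finite, 'q::finite) semi \<Rightarrow> ('p, 'q) semi \<Rightarrow> ('p, 'q) semi" where
  "semi_mult g h = (fst g ** fst h, heis_mult (snd g) (heis_act (fst g) (snd h)))"

definition unitary_subgroup :: "('p::finite, 'q::finite) semi set" where
  "unitary_subgroup = unitary_matrices \<times> {(0, 0)}"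

text \<open>The canonical projection onto the double coset space.  The double coset of
  \<open>(u, x, a)\<close> contains \<open>(1, x, a)\<close>, hence corresponds to the orbit of \<open>(x, a)\<close> under
  the unitary group, and that orbit is identified with \<open>(|x|, a)\<close>.\<close>

definition orbit_proj :: "('p::finite, 'q::finite) semi \<Rightarrow> (complex^'q^'q) \<times> real" where
  "orbit_proj g = (mat_abs (fst (snd g)), snd (snd g))"


section \<open>Bounded (complex) measures\<close>

text \<open>A bounded complex measure on a measurable space \<open>M\<close> (only \<open>space M\<close> and \<open>sets M\<close>
  matter) is a countably additive complex function on \<open>sets M\<close>; it is normalised to vanish
  on all other sets, so that equality of measures is equality of functions.  Boundedness
  of the total variation is automatic, and so is regularity on the spaces used below.\<close>

definition bounded_measures :: "'a measure \<Rightarrow> ('a set \<Rightarrow> complex) set" where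
  "bounded_measures M = {\<mu>.
     (\<forall>A. A \<notin> sets M \<longrightarrow> \<mu> A = 0) \<and>
     (\<forall>A :: nat \<Rightarrow> 'a set. range A \<subseteq> sets M \<longrightarrow> disjoint_family A \<longrightarrow>
        (\<lambda>i. \<mu> (A i)) sums \<mu> (\<Union>i. A i))}"

text \<open>The positive variation of a real measure; \<^const>\<open>ennreal\<close> sends negative values to 0,
  which does not affect the supremum because \<open>A = {}\<close> is admitted.\<close>

definition pos_variation :: "'a measure \<Rightarrow> ('a set \<Rightarrow> real) \<Rightarrow> 'a measure" where
  "pos_variation M \<nu> =
     measure_of (space M) (sets M) (\<lambda>E. SUP A\<in>{A \<in> sets M. A \<subseteq> E}. ennreal (\<nu> A))"

text \<open>The integral of \<open>f\<close> against a complex measure, through the Jordan decompositions of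
  its real and imaginary parts.\<close>

definition cintegral :: "'a measure \<Rightarrow> ('a set \<Rightarrow> complex) \<Rightarrow> ('a \<Rightarrow> complex) \<Rightarrow> complex" where
  "cintegral M \<mu> f =
     (LINT x|pos_variation M (\<lambda>A. Re (\<mu> A)). f x) -
     (LINT x|pos_variation M (\<lambda>A. - Re (\<mu> A)). f x) +
     \<i> * ((LINT x|pos_variation M (\<lambda>A. Im (\<mu> A)). f x) -
          (LINT x|pos_variation M (\<lambda>A. - Im (\<mu> A)). f x))"

definition point_measure_at :: "'a measure \<Rightarrow> 'a \<Rightarrow> 'a set \<Rightarrow> complex" where
  "point_measure_at M x = (\<lambda>A. if A \<in> sets M \<and> x \<in> A then 1 else 0)"

definition image_measure ::
  "'a measure \<Rightarrow> 'b measure \<Rightarrow> ('a \<Rightarrow> 'b) \<Rightarrow> ('a set \<Rightarrow> complex) \<Rightarrow> 'b set \<Rightarrow> complex" where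
  "image_measure M N T \<mu> = (\<lambda>B. if B \<in> sets N then \<mu> (T -` B \<inter> space M) else 0)"


section \<open>The orbit convolution\<close>

definition semi_space :: "('p::finite, 'q::finite) semi measure" where
  "semi_space = restrict_space borel semi_carrier"

definition orbit_space :: "((complex^'q^'q) \<times> real) measure" where
  "orbit_space = restrict_space borel (psd_cone \<times> UNIV)"

definition semi_conv ::
  "(('p::finite, 'q::finite) semi set \<Rightarrow> complex) \<Rightarrow> (('p, 'q) semi set \<Rightarrow> complex) \<Rightarrow>
   ('p, 'q) semi set \<Rightarrow> complex" where
  "semi_conv \<mu> \<nu> = (\<lambda>E. if E \<in> sets semi_space
     then cintegral semi_space \<mu> (\<lambda>g. cintegral semi_space \<nu> (\<lambda>h. indicator E (semi_mult g h)))
     else 0)"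

definition biinvariant_measures :: "(('p::finite, 'q::finite) semi set \<Rightarrow> complex) set" where
  "biinvariant_measures = {\<mu> \<in> bounded_measures semi_space.
     \<forall>k\<in>unitary_subgroup. \<forall>E\<in>sets semi_space.
       \<mu> ((\<lambda>g. semi_mult k g) ` E) = \<mu> E \<and> \<mu> ((\<lambda>g. semi_mult g k) ` E) = \<mu> E}"

definition proj_measure ::
  "(('p::finite, 'q::finite) semi set \<Rightarrow> complex) \<Rightarrow> ((complex^'q^'q) \<times> real) set \<Rightarrow> complex" where
  "proj_measure = image_measure semi_space orbit_space orbit_proj"

text \<open>The inverse of the isomorphism \<^const>\<open>proj_measure\<close> from biinvariant bounded measures
  onto bounded measures on the orbit space.\<close>

definition lift_measure ::
  "(((complex^'q^'q) \<times> real) set \<Rightarrow> complex) \<Rightarrow> ('p::finite, 'q::finite) semi set \<Rightarrow> complex" where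
  "lift_measure = the_inv_into biinvariant_measures proj_measure"

text \<open>The type argument records p, which is not visible in the type of the measures.\<close>

definition orbit_conv ::
  "'p::finite itself \<Rightarrow> (((complex^'q::finite^'q) \<times> real) set \<Rightarrow> complex) \<Rightarrow>
   (((complex^'q^'q) \<times> real) set \<Rightarrow> complex) \<Rightarrow> ((complex^'q^'q) \<times> real) set \<Rightarrow> complex" where
  "orbit_conv _ \<mu> \<nu> =
     proj_measure (semi_conv (lift_measure \<mu> :: ('p, 'q) semi set \<Rightarrow> complex) (lift_measure \<nu>))"


section \<open>The matrix ball and the normalising constant\<close>

definition matrix_ball :: "(complex^'q^'q) set" where
  "matrix_ball = {w. pos_def (mat 1 - ctranspose w ** w)}"

text \<open>The determinant takes values in \<^typ>\<open>complex\<close>; on the ball it is real and positive,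
  so this constant is a positive real number.\<close>

definition kappa :: "'p::finite itself \<Rightarrow> 'q::finite itself \<Rightarrow> complex" where
  "kappa _ _ = inverse (LINT w:(matrix_ball :: (complex^'q^'q) set)|lborel.
     det (mat 1 - ctranspose w ** w) ^ (CARD('p) - 2 * CARD('q)))"

end

theory Submission
  imports Defs
begin

text \<open>
  The convolution of two point masses on the orbit space is the law of the orbit of a product of two
  random group elements.  Let \<open>E\<close> be an isometric embedding of the \<open>q\<close>-dimensional into the
  \<open>p\<close>-dimensional space, so that \<open>E r\<close> is a representative of the orbit of \<open>r\<close>.  The point mass at
  \<open>(r, a)\<close> lifts to the law of \<open>(k, u E r, a)\<close> with independent Haar distributed unitary matrices
  \<open>k\<close>, \<open>u\<close> (\<open>lift_measure_point\<close>).  The lift is unique: averaging over the unitary group on both sides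
  turns every test function into a function of the orbit (\<open>biinvariant_integral\<close>), so a biinvariant
  measure is determined by its image; for complex measures this is applied to the parts of the Jordan
  decomposition.  In the product of two such random elements all unitary factors but one cancel, and
  the point masses at \<open>(r, a)\<close> and \<open>(s, b)\<close> convolve to the law of
  \<open>(|E r + u E s|, a + b - Im tr ((E r)\<^sup>* u E s))\<close> (\<open>orbit_conv_law\<close>).  This depends on \<open>u\<close> only through
  the truncation \<open>w = E\<^sup>* u E\<close>, because \<open>|E r + u E s|\<^sup>2 = r\<^sup>2 + s\<^sup>2 + r w s + (r w s)\<^sup>*\<close>.

  It remains to see that \<open>w\<close> has a density proportional to \<open>det (1 - w\<^sup>* w)\<^sup>p\<^sup>-\<^sup>2\<^sup>q\<close> on the ball
  (\<open>truncation_law\<close>).  The isometry \<open>u E\<close> has the law of the polar part of a Lebesgue distributed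
  \<open>p \<times> q\<close> matrix \<open>X\<close>, independently of \<open>X\<^sup>* X\<close> (\<open>polar_integration\<close>).  Split \<open>X\<close> into its component \<open>A\<close>
  in the range of \<open>E\<close> and an orthogonal component with Gram matrix \<open>S\<close>.  Then \<open>H = X\<^sup>* X = A\<^sup>* A + S\<close>
  and \<open>w = A H\<^sup>-\<^sup>1\<^sup>/\<^sup>2\<close>.  The law of \<open>S\<close> is multiplied by \<open>det k\<^sup>2\<^sup>(\<^sup>p\<^sup>-\<^sup>q\<^sup>)\<close> under \<open>S \<mapsto> k S k\<close>, Lebesgue measure
  on the Hermitian matrices by \<open>det k\<^sup>2\<^sup>q\<close>.  Since a measure on the positive definite cone that is
  invariant under these maps and under unitary conjugation is unique up to a factor
  (\<open>invariant_measure_unique\<close>), the law of \<open>S\<close> is a multiple of \<open>det S\<^sup>p\<^sup>-\<^sup>2\<^sup>q dS\<close> (\<open>off_gram_law\<close>).  This is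
  where \<open>p \<ge> 2 q\<close> enters: \<open>S\<close> is almost surely invertible only if the orthogonal complement of the
  range of \<open>E\<close> has dimension at least \<open>q\<close>.  Substituting \<open>S = H - A\<^sup>* A\<close> and then \<open>A = w H\<^sup>1\<^sup>/\<^sup>2\<close> separates \<open>w\<close>
  from \<open>H\<close> and leaves the density \<open>det (1 - w\<^sup>* w)\<^sup>p\<^sup>-\<^sup>2\<^sup>q\<close>; the constant follows from the total mass 1.
\<close>

section \<open>Complex matrices and Hermitian forms\<close>

notation ctranspose ("_\<^sup>\<dagger>" [1000] 999)

lemma ctranspose_nth [simp]: "A\<^sup>\<dagger> $ i $ j = cnj (A $ j $ i)"
  by (simp add: ctranspose_def)

lemma ctranspose_ctranspose [simp]: "(A\<^sup>\<dagger>)\<^sup>\<dagger> = A"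
  by (simp add: vec_eq_iff)

lemma ctranspose_mult: "(A ** B)\<^sup>\<dagger> = B\<^sup>\<dagger> ** A\<^sup>\<dagger>"
  by (simp add: vec_eq_iff matrix_matrix_mult_def mult.commute)

lemma ctranspose_add: "(A + B)\<^sup>\<dagger> = A\<^sup>\<dagger> + B\<^sup>\<dagger>"
  and ctranspose_diff: "(A - B)\<^sup>\<dagger> = A\<^sup>\<dagger> - B\<^sup>\<dagger>"
  and ctranspose_scaleR: "(c *\<^sub>R A)\<^sup>\<dagger> = c *\<^sub>R A\<^sup>\<dagger>"
  by (simp_all add: vec_eq_iff)

lemma ctranspose_mat1 [simp]: "(mat 1)\<^sup>\<dagger> = mat 1"
  and ctranspose_zero [simp]: "0\<^sup>\<dagger> = 0"
  by (auto simp: vec_eq_iff mat_def)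

lemma det_ctranspose: "det (A\<^sup>\<dagger>) = cnj (det A)"
proof -
  have "det (A\<^sup>\<dagger>) = det (\<chi> i j. cnj (A $ i $ j))"
    by (subst det_transpose[symmetric]) (simp add: transpose_def)
  also have "\<dots> = cnj (det A)"
    by (simp add: det_def)
  finally show ?thesis .
qed

lemma linear_matrix_mult_left: "linear (\<lambda>X::complex^'q^'p. A ** X)"
  and linear_matrix_mult_right: "linear (\<lambda>A::complex^'p^'m. A ** (X :: complex^'q^'p))"
  and linear_ctranspose: "linear (\<lambda>X::complex^'q^'p. X\<^sup>\<dagger>)"
  and linear_trace: "linear (\<lambda>A::complex^'n^'n. trace A)"
  by (auto intro!: linearI simp: vec_eq_iff matrix_matrix_mult_def trace_def algebra_simps
      sum.distrib scaleR_sum_right)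

lemma bounded_bilinear_matrix_mult:
  "bounded_bilinear (\<lambda>(A::complex^'p^'m) (X :: complex^'q^'p). A ** X)"
  using linear_matrix_mult_left linear_matrix_mult_right
  by (auto simp: bilinear_conv_bounded_bilinear[symmetric] bilinear_def)

lemmas matrix_mult_diff_left = bounded_bilinear.diff_left[OF bounded_bilinear_matrix_mult]
  and matrix_mult_diff_right = bounded_bilinear.diff_right[OF bounded_bilinear_matrix_mult]
  and matrix_mult_add_left = bounded_bilinear.add_left[OF bounded_bilinear_matrix_mult]
  and matrix_mult_add_right = bounded_bilinear.add_right[OF bounded_bilinear_matrix_mult]
  and matrix_mult_scaleR_left = bounded_bilinear.scaleR_left[OF bounded_bilinear_matrix_mult]
  and matrix_mult_scaleR_right = bounded_bilinear.scaleR_right[OF bounded_bilinear_matrix_mult]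
  and matrix_mult_zero_left [simp] = bounded_bilinear.zero_left[OF bounded_bilinear_matrix_mult]
  and matrix_mult_zero_right [simp] = bounded_bilinear.zero_right[OF bounded_bilinear_matrix_mult]

lemmas matrix_ring_simps = matrix_mult_diff_left matrix_mult_diff_right matrix_mult_add_left
  matrix_mult_add_right matrix_mult_scaleR_left matrix_mult_scaleR_right

lemmas continuous_on_matrix_mult [continuous_intros] =
    bounded_bilinear.continuous_on[OF bounded_bilinear_matrix_mult]

lemmas continuous_on_ctranspose [continuous_intros] =
    bounded_linear.continuous_on[OF linear_ctranspose[unfolded linear_conv_bounded_linear]]

lemmas continuous_on_trace [continuous_intros] =
    bounded_linear.continuous_on[OF linear_trace[unfolded linear_conv_bounded_linear]]

lemma continuous_on_det [continuous_intros]: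
  fixes f :: "'a::topological_space \<Rightarrow> complex^'n^'n"
  assumes "continuous_on S f"
  shows "continuous_on S (\<lambda>x. det (f x))"
  unfolding det_def by (intro continuous_intros assms)

lemma borel_measurable_matrix_mult [measurable]:
  fixes f :: "'a \<Rightarrow> complex^'p^'m" and g :: "'a \<Rightarrow> complex^'q^'p"
  assumes "f \<in> borel_measurable M" "g \<in> borel_measurable M"
  shows "(\<lambda>x. f x ** g x) \<in> borel_measurable M"
  using assms by (rule borel_measurable_continuous_Pair) (intro continuous_intros)

lemma borel_measurable_ctranspose [measurable]:
  "f \<in> borel_measurable M \<Longrightarrow> (\<lambda>x. (f x :: complex^'q^'p)\<^sup>\<dagger>) \<in> borel_measurable M"
  by (rule borel_measurable_continuous_on) (intro continuous_intros)

lemma borel_measurable_trace [measurable]: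
  "f \<in> borel_measurable M \<Longrightarrow> (\<lambda>x. trace (f x :: complex^'q^'q)) \<in> borel_measurable M"
  by (rule borel_measurable_continuous_on) (intro continuous_intros)

lemma borel_measurable_det [measurable]:
  "f \<in> borel_measurable M \<Longrightarrow> (\<lambda>x. det (f x :: complex^'q^'q)) \<in> borel_measurable M"
  by (rule borel_measurable_continuous_on) (intro continuous_intros)

lemma inner_eq_trace: "inner (A :: complex^'q^'p) B = Re (trace (A\<^sup>\<dagger> ** B))"
proof -
  have "inner A B = (\<Sum>i\<in>UNIV. \<Sum>j\<in>UNIV. Re (cnj (A $ i $ j) * B $ i $ j))"
    by (simp add: inner_vec_def inner_complex_def)
  also have "\<dots> = Re (trace (A\<^sup>\<dagger> ** B))"
    by (subst sum.swap) (simp add: trace_def matrix_matrix_mult_def)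
  finally show ?thesis .
qed

lemma norm_eq_trace: "(norm (A :: complex^'q^'p))\<^sup>2 = Re (trace (A\<^sup>\<dagger> ** A))"
  by (simp add: power2_norm_eq_inner inner_eq_trace)

definition cinner :: "complex^'n \<Rightarrow> complex^'n \<Rightarrow> complex" where
  "cinner v w = (\<Sum>i\<in>UNIV. cnj (v $ i) * w $ i)"

lemma quad_form_cinner: "quad_form A v = cinner v (A *v v)"
  by (simp add: quad_form_def cinner_def)

lemma cinner_add_left: "cinner (u + v) w = cinner u w + cinner v w"
  and cinner_add_right: "cinner w (u + v) = cinner w u + cinner w v"
  and cinner_diff_right: "cinner w (u - v) = cinner w u - cinner w v"
  and cinner_diff_left: "cinner (u - v) w = cinner u w - cinner v w"
  and cinner_scale_left: "cinner (c *s v) w = cnj c * cinner v w"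
  and cinner_scale_right: "cinner w (c *s v) = c * cinner w v"
  by (simp_all add: cinner_def sum.distrib sum_subtractf sum_distrib_left algebra_simps)

lemma cinner_commute: "cinner v w = cnj (cinner w v)"
  by (simp add: cinner_def mult.commute)

lemma cinner_matrix: "cinner v (A *v w) = cinner (A\<^sup>\<dagger> *v v) w"
  unfolding cinner_def matrix_vector_mult_def
  by (simp add: sum_distrib_left sum_distrib_right mult_ac, subst sum.swap, rule refl)

lemma cinner_matrix': "cinner (A *v v) w = cinner v (A\<^sup>\<dagger> *v w)"
  by (simp add: cinner_matrix)

lemma cinner_self: "cinner v v = of_real ((norm v)\<^sup>2)"
  unfolding power2_norm_eq_inner cinner_def inner_vec_def of_real_sum
  by (intro sum.cong refl) (simp add: complex_eq_iff inner_complex_def)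

lemma matrix_vector_axis: "(A *v axis j 1) $ i = (A :: complex^'n^'m) $ i $ j"
  by (simp add: matrix_vector_mult_def axis_def if_distrib[of "\<lambda>x. _ * x"] cong: if_cong)

lemma cinner_axis_axis: "cinner (axis i 1) (A *v axis j 1) = A $ i $ j"
  unfolding cinner_def matrix_vector_axis
  by (simp add: axis_def if_distrib[of cnj] if_distrib[of "\<lambda>x. x * _"] cong: if_cong)

lemma matrix_vector_scale: "A *v (c *s v) = c *s (A *v (v :: complex^'n))"
  by (simp add: vec_eq_iff matrix_vector_mult_def sum_distrib_left mult_ac)

lemma cinner_ctranspose: "cinner v (A\<^sup>\<dagger> *v v) = cnj (cinner v (A *v v))"
  by (metis cinner_commute cinner_matrix')

text \<open>Polarisation with \<open>v + w\<close> and \<open>v + \<i> w\<close>.  It is special to complex scalars that no symmetry has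
  to be assumed, and this is why matrices with a real quadratic form are Hermitian.\<close>

lemma quad_form_zero_imp_zero:
  fixes A :: "complex^'n^'n"
  assumes "\<And>v. cinner v (A *v v) = 0"
  shows "A = 0"
proof -
  have "cinner v (A *v w) = 0" for v w
  proof -
    have 1: "cinner v (A *v w) + cinner w (A *v v) = 0"
      using assms[of "v + w"] assms[of v] assms[of w]
      by (simp add: cinner_add_left cinner_add_right matrix_vector_right_distrib add.commute)
    have 2: "\<i> * cinner v (A *v w) - \<i> * cinner w (A *v v) = 0"
      using assms[of "v + \<i> *s w"] assms[of v] assms[of w]
      by (simp add: cinner_add_left cinner_add_right matrix_vector_right_distrib
          cinner_scale_left cinner_scale_right matrix_vector_scale)
    have "2 * \<i> * cinner v (A *v w) = 0"
      using 1 2 by algebra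
    then show ?thesis by simp
  qed
  then have "A $ i $ j = 0" for i j
    using cinner_axis_axis[of i A j] by simp
  then show ?thesis by (simp add: vec_eq_iff)
qed

lemma pos_semidef_hermitian: "pos_semidef A \<Longrightarrow> A\<^sup>\<dagger> = A"
  by (simp add: pos_semidef_def hermitian_def)

lemma quad_form_nonneg_imp_pos_semidef:
  assumes "\<And>v. cinner v (A *v v) \<in> \<real>" "\<And>v. Re (cinner v (A *v v)) \<ge> 0"
  shows "pos_semidef A"
proof -
  have "cinner v ((A\<^sup>\<dagger> - A) *v v) = 0" for v
    using assms(1)[of v]
    by (simp add: matrix_vector_mult_diff_rdistrib cinner_diff_right cinner_ctranspose Reals_cnj_iff)
  then have "A\<^sup>\<dagger> - A = 0"
    by (rule quad_form_zero_imp_zero)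
  then show ?thesis
    using assms(2) by (simp add: pos_semidef_def hermitian_def quad_form_cinner)
qed

lemma pos_semidefD: "pos_semidef A \<Longrightarrow> Re (cinner v (A *v v)) \<ge> 0"
  by (simp add: pos_semidef_def quad_form_cinner)

lemma pos_semidefI: "A\<^sup>\<dagger> = A \<Longrightarrow> (\<And>v. Re (cinner v (A *v v)) \<ge> 0) \<Longrightarrow> pos_semidef A"
  by (simp add: pos_semidef_def quad_form_cinner hermitian_def)

lemma pos_semidef_add: "pos_semidef A \<Longrightarrow> pos_semidef B \<Longrightarrow> pos_semidef (A + B)"
  by (auto intro!: pos_semidefI
      simp: pos_semidef_hermitian ctranspose_add matrix_vector_mult_add_rdistrib cinner_add_right
      pos_semidefD)

lemma pos_semidef_mat1 [simp]: "pos_semidef (mat 1)"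
  by (rule pos_semidefI) (auto simp: cinner_self)

lemma pos_semidef_conj:
  assumes "pos_semidef A"
  shows "pos_semidef (X\<^sup>\<dagger> ** A ** X)"
proof (rule pos_semidefI)
  show "(X\<^sup>\<dagger> ** A ** X)\<^sup>\<dagger> = X\<^sup>\<dagger> ** A ** X"
    using assms by (simp add: ctranspose_mult pos_semidef_hermitian matrix_mul_assoc)
  show "Re (cinner v ((X\<^sup>\<dagger> ** A ** X) *v v)) \<ge> 0" for v
    using pos_semidefD[OF assms, of "X *v v"]
    by (simp add: cinner_matrix' matrix_vector_mul_assoc matrix_mul_assoc)
qed

lemma pos_semidef_gram: "pos_semidef (X\<^sup>\<dagger> ** X)"
  using pos_semidef_conj[of "mat 1" X] by simp

text \<open>Minimising the form along \<open>v + t A v\<close> shows that isotropic vectors of a positive form lie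
  in its kernel.\<close>

lemma pos_semidef_isotropic:
  fixes A :: "complex^'n^'n"
  assumes A: "pos_semidef A" and v: "Re (cinner v (A *v v)) = 0"
  shows "A *v v = 0"
proof (rule ccontr)
  define w where "w = A *v v"
  assume "A *v v \<noteq> 0"
  then have w: "norm w > 0" by (simp add: w_def)
  define K where "K = Re (cinner w (A *v w))"
  have "0 \<le> t\<^sup>2 * K - 2 * t * (norm w)\<^sup>2" for t :: real
  proof -
    have Aw: "cinner v (A *v w) = cinner w w"
      using A by (simp add: cinner_matrix pos_semidef_hermitian w_def)
    have "0 \<le> Re (cinner (v - of_real t *s w) (A *v (v - of_real t *s w)))"
      by (rule pos_semidefD[OF A])
    also have "\<dots> = t\<^sup>2 * K - 2 * t * (norm w)\<^sup>2"
      using v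
      by (simp add: matrix_vector_mult_diff_distrib matrix_vector_scale cinner_diff_left
          cinner_diff_right cinner_scale_left cinner_scale_right Aw w_def[symmetric] cinner_self
          K_def power2_eq_square algebra_simps)
    finally show ?thesis .
  qed
  note ineq = this
  have K0: "K \<ge> 0" unfolding K_def by (rule pos_semidefD[OF A])
  define t where "t = (norm w)\<^sup>2 / (K + 1)"
  have t: "t > 0" using w K0 by (simp add: t_def)
  have "2 * t * (norm w)\<^sup>2 \<le> t * t * K" using ineq[of t] by (simp add: power2_eq_square)
  then have "2 * (norm w)\<^sup>2 \<le> t * K" using t by (simp add: mult.assoc)
  also have "t * K \<le> t * (K + 1)" using t by simp
  also have "t * (K + 1) = (norm w)\<^sup>2" using K0 by (simp add: t_def)
  finally have "(norm w)\<^sup>2 \<le> 0" by simp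
  then show False using zero_less_power[OF w, of 2] by linarith
qed

lemma det_nonzero_iff_kernel:
  fixes A :: "complex^'n^'n"
  shows "det A \<noteq> 0 \<longleftrightarrow> (\<forall>v. A *v v = 0 \<longrightarrow> v = 0)"
  by (metis invertible_det_nz invertible_left_inverse matrix_left_invertible_ker)

lemma pos_def_imp_pos_semidef: "pos_def A \<Longrightarrow> pos_semidef A"
proof (rule pos_semidefI)
  assume A: "pos_def A"
  then show "A\<^sup>\<dagger> = A" by (simp add: pos_def_def hermitian_def)
  show "0 \<le> Re (cinner v (A *v v))" for v
    using A by (cases "v = 0") (auto simp: pos_def_def quad_form_cinner cinner_def less_imp_le)
qed

lemma pos_def_iff: "pos_def A \<longleftrightarrow> pos_semidef A \<and> det A \<noteq> 0"
proof
  assume A: "pos_def A"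
  have "v = 0" if "A *v v = 0" for v
  proof (rule ccontr)
    assume "v \<noteq> 0"
    then have "0 < Re (cinner v (A *v v))"
      using A by (simp add: pos_def_def quad_form_cinner)
    then show False by (simp add: that cinner_def)
  qed
  then show "pos_semidef A \<and> det A \<noteq> 0"
    using A by (simp add: pos_def_imp_pos_semidef det_nonzero_iff_kernel)
next
  assume A: "pos_semidef A \<and> det A \<noteq> 0"
  then have "0 < Re (cinner v (A *v v))" if "v \<noteq> 0" for v
    using pos_semidef_isotropic[of A v] pos_semidefD[of A v] that
    by (force simp: det_nonzero_iff_kernel)
  then show "pos_def A"
    using A by (simp add: pos_def_def pos_semidef_def quad_form_cinner)
qed

lemma pos_semidef_trace_zero:
  assumes A: "pos_semidef A" and tr: "Re (trace A) = 0"
  shows "A = 0"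
proof -
  have nn: "Re (A $ i $ i) \<ge> 0" for i
    using pos_semidefD[OF A, of "axis i 1"] by (simp add: cinner_axis_axis)
  have "Re (A $ i $ i) = 0" for i
    using tr nn by (simp add: trace_def sum_nonneg_eq_0_iff)
  then have "A *v axis i 1 = 0" for i
    by (intro pos_semidef_isotropic[OF A]) (simp add: cinner_axis_axis)
  then show ?thesis
    by (simp add: vec_eq_iff matrix_vector_axis)
qed

lemma closed_psd_cone: "closed (psd_cone :: (complex^'n^'n) set)"
proof -
  have "psd_cone = {A :: complex^'n^'n. A\<^sup>\<dagger> = A} \<inter> (\<Inter>v. {A. 0 \<le> Re (cinner v (A *v v))})"
    by (auto simp: psd_cone_def pos_semidef_def hermitian_def quad_form_cinner)
  also have "closed \<dots>"
    unfolding cinner_def matrix_vector_mult_def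
    by (intro closed_Int closed_INT ballI closed_Collect_eq closed_Collect_le continuous_intros)
  finally show ?thesis .
qed

section \<open>Unitary matrices, square roots and polar decomposition\<close>

lemma unitary_iff: "u \<in> unitary_matrices \<longleftrightarrow> u\<^sup>\<dagger> ** u = mat 1"
  by (auto simp: unitary_matrices_def matrix_left_right_inverse)

lemma unitaryD: "u \<in> unitary_matrices \<Longrightarrow> u\<^sup>\<dagger> ** u = mat 1" "u \<in> unitary_matrices \<Longrightarrow> u ** u\<^sup>\<dagger> = mat 1"
  by (auto simp: unitary_matrices_def)

lemma unitary_cancel:
  fixes X :: "complex^'q^'p" and Y :: "complex^'p^'q"
  assumes "u \<in> unitary_matrices"
  shows "u\<^sup>\<dagger> ** (u ** X) = X" "u ** (u\<^sup>\<dagger> ** X) = X" "Y ** u\<^sup>\<dagger> ** u = Y" "Y ** u ** u\<^sup>\<dagger> = Y"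
  using unitaryD[OF assms]
  by (simp_all add: matrix_mul_assoc) (simp_all add: matrix_mul_assoc[symmetric])

lemma unitary_mat1 [simp]: "mat 1 \<in> unitary_matrices"
  by (simp add: unitary_iff)

lemma unitary_ctranspose: "u \<in> unitary_matrices \<Longrightarrow> u\<^sup>\<dagger> \<in> unitary_matrices"
  by (auto simp: unitary_matrices_def)

lemma unitary_mult: "u \<in> unitary_matrices \<Longrightarrow> v \<in> unitary_matrices \<Longrightarrow> u ** v \<in> unitary_matrices"
  by (simp add: unitary_iff ctranspose_mult matrix_mul_assoc unitary_cancel(3) unitaryD)

lemma norm_unitary_left: "u \<in> unitary_matrices \<Longrightarrow> norm (u ** X) = norm (X :: complex^'q^'p)"
  by (rule power2_eq_imp_eq)
     (simp_all add: norm_eq_trace ctranspose_mult matrix_mul_assoc unitary_cancel(3))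

lemma norm_ctranspose: "norm (X\<^sup>\<dagger>) = norm (X :: complex^'q^'p)"
  by (rule power2_eq_imp_eq) (simp_all add: norm_eq_trace trace_mul_sym[of "X\<^sup>\<dagger>" X])

lemma norm_unitary_right: "u \<in> unitary_matrices \<Longrightarrow> norm (X ** u) = norm (X :: complex^'q^'p)"
  using norm_unitary_left[of "u\<^sup>\<dagger>" "X\<^sup>\<dagger>"]
  by (simp add: unitary_ctranspose ctranspose_mult[symmetric] norm_ctranspose)

lemma norm_unitary: "u \<in> unitary_matrices \<Longrightarrow> norm u = norm (mat 1 :: complex^'n^'n)" for u :: "complex^'n^'n"
  using norm_unitary_left[of u "mat 1"] by simp

lemma closed_unitary: "closed (unitary_matrices :: (complex^'n^'n) set)"
proof -
  have "unitary_matrices = {u :: complex^'n^'n. u\<^sup>\<dagger> ** u = mat 1}"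
    by (auto simp: unitary_iff)
  also have "closed \<dots>"
    by (intro closed_Collect_eq continuous_intros)
  finally show ?thesis .
qed

lemma compact_unitary: "compact (unitary_matrices :: (complex^'n^'n) set)"
proof -
  have "bounded (unitary_matrices :: (complex^'n^'n) set)"
    unfolding bounded_iff by (metis norm_unitary order_refl)
  then show ?thesis by (simp add: compact_eq_bounded_closed closed_unitary)
qed

lemma unitary_measurable [measurable]: "unitary_matrices \<in> sets borel"
  by (intro borel_closed closed_unitary)

lemma psd_cone_measurable [measurable]: "psd_cone \<in> sets borel"
  by (intro borel_closed closed_psd_cone)

lemma det_unitary: "u \<in> unitary_matrices \<Longrightarrow> cmod (det u) = 1"
proof -
  assume "u \<in> unitary_matrices"
  then have "cmod (det (u\<^sup>\<dagger> ** u)) = 1" by (simp add: unitaryD)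
  then have "cmod (det u) * cmod (det u) = 1"
    by (simp add: det_mul det_ctranspose norm_mult)
  then show "cmod (det u) = 1"
    using norm_ge_zero[of "det u"] by (simp add: square_eq_1_iff)
qed

definition outer :: "complex^'n \<Rightarrow> complex^'n^'n" where
  "outer v = (\<chi> i j. v $ i * cnj (v $ j))"

definition cscale :: "complex \<Rightarrow> complex^'q^'p \<Rightarrow> complex^'q^'p" where
  "cscale c A = (\<chi> i j. c * A $ i $ j)"

text \<open>For a unit vector \<open>v\<close> and a phase \<open>\<zeta>\<close>, this unitary matrix multiplies \<open>v\<close> by \<open>\<zeta>\<close> and fixes the
  orthogonal complement of \<open>v\<close>.  Such matrices are the test variations in two maximum arguments over
  the unitary group.\<close>

definition phase_at :: "complex \<Rightarrow> complex^'n \<Rightarrow> complex^'n^'n" where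
  "phase_at \<zeta> v = mat 1 - cscale (1 - \<zeta>) (outer v)"

lemma cscale_nth [simp]: "cscale c A $ i $ j = c * (A $ i $ j)"
  by (simp add: cscale_def)

lemma mult_cscale_right: "A ** cscale c B = cscale c (A ** (B :: complex^'q^'p))"
  and mult_cscale_left: "cscale c A ** B = cscale c (A ** (B :: complex^'q^'p))"
  and cscale_cscale: "cscale c (cscale d A) = cscale (c * d) (A :: complex^'p^'r)"
  by (simp_all add: vec_eq_iff matrix_matrix_mult_def sum_distrib_left mult_ac)

lemma cscale_diff: "cscale c (A - B) = cscale c A - cscale c B"
  by (simp add: vec_eq_iff algebra_simps)

lemma trace_cscale: "trace (cscale c A) = c * trace A"
  by (simp add: trace_def sum_distrib_left)

lemma trace_outer: "trace (A ** outer v) = cinner v (A *v v)"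
  by (simp add: trace_def cinner_def matrix_matrix_mult_def outer_def matrix_vector_mult_def
      sum_distrib_left mult_ac)

lemma trace_outer': "trace (outer v ** A) = cinner v (A *v v)"
  by (metis trace_outer trace_mul_sym)

lemma outer_mult_outer: "outer v ** outer v = cscale (cinner v v) (outer v)"
  by (simp add: vec_eq_iff matrix_matrix_mult_def outer_def cinner_def sum_distrib_right
      sum_distrib_left mult_ac)

lemma ctranspose_phase_at: "(phase_at \<zeta> v)\<^sup>\<dagger> = phase_at (cnj \<zeta>) v"
  by (simp add: vec_eq_iff phase_at_def outer_def mat_def)

lemma phase_at_unitary:
  assumes v: "norm v = 1" and \<zeta>: "cmod \<zeta> = 1"
  shows "phase_at \<zeta> v \<in> unitary_matrices"
proof -
  have "cnj \<zeta> * \<zeta> = 1"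
    using \<zeta> by (metis complex_norm_square mult.commute of_real_1 one_power2)
  then have z: "(1 - cnj \<zeta>) * (1 - \<zeta>) = (1 - \<zeta>) + (1 - cnj \<zeta>)"
    by (simp add: algebra_simps)
  have "(phase_at \<zeta> v)\<^sup>\<dagger> ** phase_at \<zeta> v =
      mat 1 - cscale (1 - \<zeta>) (outer v) - cscale (1 - cnj \<zeta>) (outer v) +
      cscale ((1 - cnj \<zeta>) * (1 - \<zeta>)) (outer v)"
    unfolding ctranspose_phase_at unfolding phase_at_def
    by (simp add: matrix_ring_simps mult_cscale_right mult_cscale_left cscale_cscale
        cscale_diff outer_mult_outer cinner_self v mult.commute)
  also have "\<dots> = mat 1"
    unfolding z by (simp add: vec_eq_iff algebra_simps)
  finally show ?thesis by (simp add: unitary_iff)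
qed

lemma of_real_smult: "complex_of_real r *s v = r *\<^sub>R v"
  by (simp add: vec_eq_iff) (simp add: scaleR_conv_of_real)

subsection \<open>The spectral theorem\<close>

definition diag :: "('n \<Rightarrow> real) \<Rightarrow> complex^'n^'n" where
  "diag d = (\<chi> i j. if i = j then of_real (d i) else 0)"

lemma diag_mult_left: "(diag d ** A) $ i $ j = of_real (d i) * A $ i $ j"
  by (simp add: matrix_matrix_mult_def diag_def if_distrib[of "\<lambda>x. x * _"] cong: if_cong)

lemma diag_mult_right: "(A ** diag d) $ i $ j = A $ i $ j * of_real (d j)"
  by (simp add: matrix_matrix_mult_def diag_def if_distrib[of "\<lambda>x. _ * x"] cong: if_cong)

lemma diag_mult_diag: "diag d ** diag d' = diag (\<lambda>i. d i * d' i)"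
  by (simp add: vec_eq_iff diag_mult_left) (simp add: diag_def)

lemma ctranspose_diag [simp]: "(diag d)\<^sup>\<dagger> = diag d"
  by (simp add: vec_eq_iff diag_def)

lemma det_diag: "det (diag d) = of_real (\<Prod>i\<in>UNIV. d i)"
  by (subst det_diagonal) (simp_all add: diag_def)

lemma pos_semidef_diag: "(\<And>i. d i \<ge> 0) \<Longrightarrow> pos_semidef (diag d)"
proof (rule pos_semidefI)
  fix v
  assume d: "\<And>i. d i \<ge> 0"
  have "cinner v (diag d *v v) = (\<Sum>i\<in>UNIV. of_real (d i) * (cnj (v $ i) * v $ i))"
    by (simp add: cinner_def diag_def matrix_vector_mult_def if_distrib[of "\<lambda>x. x * _"] cong: if_cong)
      (simp add: mult_ac)
  also have "Re \<dots> = (\<Sum>i\<in>UNIV. d i * (cmod (v $ i))\<^sup>2)"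
    by (simp add: cmod_power2) (simp add: power2_eq_square)
  also have "\<dots> \<ge> 0" using d by (intro sum_nonneg) auto
  finally show "Re (cinner v (diag d *v v)) \<ge> 0" .
qed simp

text \<open>Fix a diagonal matrix \<open>D\<close> with distinct entries and let \<open>u\<close> maximise \<open>Re tr (D u A u\<^sup>\<dagger>)\<close> over the
  compact unitary group.  The first variation along phase rotations shows that \<open>u A u\<^sup>\<dagger>\<close> commutes
  with \<open>D\<close>, and hence is diagonal.\<close>

lemma spectral_theorem:
  fixes A :: "complex^'n^'n"
  assumes A: "A\<^sup>\<dagger> = A"
  obtains u d where "u \<in> unitary_matrices" "A = u\<^sup>\<dagger> ** diag d ** u"
proof -
  obtain e :: "'n \<Rightarrow> nat" where e: "inj e"
    using finite_imp_inj_to_nat_seg[of "UNIV :: 'n set"] by auto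
  define D where "D = diag (\<lambda>i. real (e i))"
  define F where "F u = Re (trace (D ** u ** A ** u\<^sup>\<dagger>))" for u
  have "continuous_on unitary_matrices F"
    unfolding F_def by (intro continuous_intros)
  then obtain u where u: "u \<in> unitary_matrices" and max: "\<And>v. v \<in> unitary_matrices \<Longrightarrow> F v \<le> F u"
    using continuous_attains_sup[OF compact_unitary, of F] unitary_mat1 by blast
  define M where "M = u ** A ** u\<^sup>\<dagger>"
  have M: "M\<^sup>\<dagger> = M"
    by (simp add: M_def ctranspose_mult A matrix_mul_assoc)
  have real: "Im (cinner v (M *v (D *v v))) = 0" if v: "norm v = 1" for v
  proof -
    define c where "c = cinner v (M *v (D *v v))"
    define K where "K = trace (D ** outer v ** M ** outer v)"
    have c': "cinner v (D *v (M *v v)) = cnj c"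
      unfolding c_def by (metis M D_def cinner_commute cinner_matrix ctranspose_diag)
    \<comment> \<open>the maximum property compared with the rotation of \<open>v\<close> by the angle \<open>t\<close>\<close>
    have ineq: "(1 - cos t) * (Re K - Re c) \<le> sin t * Im c" for t
    proof -
      define z where "z = 1 - cis t"
      let ?k = "phase_at (cis t) v"
      have k: "?k = mat 1 - cscale z (outer v)" "?k\<^sup>\<dagger> = mat 1 - cscale (cnj z) (outer v)"
        unfolding ctranspose_phase_at by (simp_all add: phase_at_def z_def)
      have "trace (D ** ?k ** M ** ?k\<^sup>\<dagger>) =
          trace (D ** M) - z * c - cnj z * cnj c + z * cnj z * K"
      proof -
        have "D ** ?k ** M ** ?k\<^sup>\<dagger> = D ** M - cscale z (D ** outer v ** M)
           - cscale (cnj z) (D ** M ** outer v) + cscale (z * cnj z) (D ** outer v ** M ** outer v)"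
          unfolding k(2) unfolding k(1)
          by (simp add: matrix_ring_simps mult_cscale_right mult_cscale_left cscale_cscale
              cscale_diff mult.commute)
        moreover have "trace (D ** outer v ** M) = c"
          by (metis c_def matrix_vector_mul_assoc matrix_mul_assoc trace_mul_sym trace_outer)
        moreover have "trace (D ** M ** outer v) = cnj c"
          by (simp add: trace_outer c'[symmetric] matrix_vector_mul_assoc)
        ultimately show ?thesis
          by (simp add: trace_add trace_sub trace_cscale K_def)
      qed
      moreover have "F (?k ** u) \<le> F u"
        by (intro max unitary_mult phase_at_unitary v u) simp
      then have "Re (trace (D ** ?k ** M ** ?k\<^sup>\<dagger>)) \<le> Re (trace (D ** M))"
        by (simp add: F_def M_def ctranspose_mult matrix_mul_assoc)
      moreover have "z * cnj z = of_real (2 * (1 - cos t))"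
        using sin_cos_squared_add[of t]
        by (simp add: z_def complex_eq_iff power2_eq_square algebra_simps)
      ultimately have "Re (trace (D ** M) - z * c - cnj z * cnj c + of_real (2 * (1 - cos t)) * K)
          \<le> Re (trace (D ** M))"
        by metis
      then have "0 \<ge> - 2 * Re (z * c) + 2 * (1 - cos t) * Re K"
        by (simp add: algebra_simps)
      then show ?thesis
        by (simp add: z_def algebra_simps)
    qed
    \<comment> \<open>as a function of \<open>t\<close> the difference of the two sides has a minimum at \<open>0\<close>, with derivative \<open>Im c\<close>\<close>
    have "((\<lambda>t. sin t * Im c - (1 - cos t) * (Re K - Re c)) has_real_derivative Im c) (at 0)"
      by (auto intro!: derivative_eq_intros)
    then have "Im c = 0"
      by (rule DERIV_local_min[where d = 1]) (use ineq in auto)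
    then show ?thesis by (simp add: c_def)
  qed
  have "M ** D - D ** M = 0"
  proof (rule quad_form_zero_imp_zero)
    fix v
    show "cinner v ((M ** D - D ** M) *v v) = 0"
    proof (cases "v = 0")
      case False
      define w where "w = of_real (1 / norm v) *s v"
      have "norm w = 1"
        using False unfolding w_def of_real_smult by simp
      from real[OF this] have "Im (cinner w ((M ** D) *v w)) = 0"
        by (simp add: matrix_vector_mul_assoc)
      moreover have "cinner w ((D ** M) *v w) = cnj (cinner w ((M ** D) *v w))"
        by (metis M D_def cinner_ctranspose ctranspose_diag ctranspose_mult)
      ultimately have "cinner w ((M ** D - D ** M) *v w) = 0"
        by (simp add: matrix_vector_mult_diff_rdistrib cinner_diff_right complex_eq_iff)
      then show ?thesis
        using False by (simp add: w_def cinner_scale_left cinner_scale_right matrix_vector_scale)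
    qed (simp add: cinner_def)
  qed
  then have comm: "M $ i $ j * real (e j) = real (e i) * M $ i $ j" for i j
    by (metis D_def diag_mult_left diag_mult_right eq_iff_diff_eq_0 of_real_of_nat_eq)
  have "M = diag (\<lambda>i. Re (M $ i $ i))"
  proof (clarsimp simp: vec_eq_iff diag_def, intro conjI impI)
    fix i j
    show "M $ j $ j = of_real (Re (M $ j $ j))"
      by (metis M Reals_cnj_iff ctranspose_nth of_real_Re)
    assume "i \<noteq> j"
    then have "e i \<noteq> e j" using e by (auto dest: injD)
    then show "M $ i $ j = 0" using comm[of i j] by (simp add: mult.commute)
  qed
  moreover have "A = u\<^sup>\<dagger> ** M ** u"
    using u by (simp add: M_def matrix_mul_assoc unitaryD unitary_cancel)
  ultimately show ?thesis using u that by metis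
qed

lemma pos_semidef_diag_iff: "pos_semidef (diag d) \<longleftrightarrow> (\<forall>i. d i \<ge> 0)"
proof
  assume A: "pos_semidef (diag d)"
  show "\<forall>i. d i \<ge> 0"
  proof
    fix i show "d i \<ge> 0"
      using pos_semidefD[OF A, of "axis i 1"] by (simp add: cinner_axis_axis diag_def)
  qed
qed (simp add: pos_semidef_diag)

lemma pos_semidef_spectral:
  fixes A :: "complex^'n^'n"
  assumes A: "pos_semidef A"
  obtains u d where "u \<in> unitary_matrices" "\<And>i. d i \<ge> 0" "A = u\<^sup>\<dagger> ** diag d ** u"
proof -
  obtain u d where u: "u \<in> unitary_matrices" and eq: "A = u\<^sup>\<dagger> ** diag d ** u"
    using spectral_theorem[OF pos_semidef_hermitian[OF A]] .
  have "(u\<^sup>\<dagger>)\<^sup>\<dagger> ** A ** u\<^sup>\<dagger> = diag d"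
    using u by (simp add: eq matrix_mul_assoc unitaryD unitary_cancel)
  then have "pos_semidef (diag d)"
    by (metis A pos_semidef_conj)
  then show ?thesis using that[OF u _ eq] by (auto simp: pos_semidef_diag_iff)
qed

lemma pos_semidef_det: "pos_semidef A \<Longrightarrow> det A = of_real (cmod (det A))"
proof (erule pos_semidef_spectral)
  fix u d assume *: "u \<in> unitary_matrices" "\<And>i. d i \<ge> 0" "A = u\<^sup>\<dagger> ** diag d ** u"
  have "cnj (det u) * det u = 1"
    using det_unitary[OF *(1)] by (metis complex_norm_square mult.commute of_real_1 one_power2)
  then have "det A = of_real (\<Prod>i\<in>UNIV. d i)"
    by (simp add: *(3) det_mul det_ctranspose det_diag mult_ac)
  moreover have "(\<Prod>i\<in>UNIV. d i) \<ge> 0" using *(2) by (simp add: prod_nonneg)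
  ultimately show ?thesis by (simp add: prod_nonneg abs_of_nonneg del: of_real_prod)
qed

subsection \<open>The positive square root\<close>

text \<open>For two positive roots \<open>B\<close>, \<open>C\<close> with difference \<open>D\<close>, the equation \<open>B\<^sup>2 = C\<^sup>2\<close> gives
  \<open>tr (D B D) + tr (D C D) = 0\<close>; both terms are nonnegative, so \<open>D B D\<close>, \<open>D C D\<close> and finally their
  difference \<open>D\<^sup>3\<close> vanish.\<close>

lemma psd_root_unique:
  fixes B C :: "complex^'n^'n"
  assumes B: "pos_semidef B" and C: "pos_semidef C" and eq: "B ** B = C ** C"
  shows "B = C"
proof -
  define D where "D = B - C"
  have D: "D\<^sup>\<dagger> = D"
    by (simp add: D_def ctranspose_diff pos_semidef_hermitian B C)
  have psd: "pos_semidef (D ** B ** D)" "pos_semidef (D ** C ** D)"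
    using pos_semidef_conj[OF B, of D] pos_semidef_conj[OF C, of D] by (simp_all add: D)
  have "B ** D + D ** C = 0"
    by (simp add: D_def matrix_ring_simps eq)
  then have "trace (D ** (B ** D + D ** C)) = 0"
    by (simp add: trace_def)
  then have "trace (D ** B ** D) + trace (D ** C ** D) = 0"
    by (simp add: matrix_mult_add_right trace_add matrix_mul_assoc trace_mul_sym[of "D ** C" D])
  then have *: "Re (trace (D ** B ** D)) + Re (trace (D ** C ** D)) = 0"
    by (metis plus_complex.sel(1) zero_complex.sel(1))
  have nn: "Re (trace A) \<ge> 0" if "pos_semidef A" for A :: "complex^'n^'n"
    using pos_semidefD[OF that, of "axis _ 1"] by (simp add: trace_def sum_nonneg cinner_axis_axis)
  have "D ** B ** D = 0" "D ** C ** D = 0"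
    using nn[OF psd(1)] nn[OF psd(2)] * by (auto intro!: pos_semidef_trace_zero psd)
  then have "D ** D ** D = 0"
    by (simp add: D_def matrix_ring_simps)
  then have "(D ** D)\<^sup>\<dagger> ** (D ** D) = 0"
    by (simp add: ctranspose_mult D matrix_mul_assoc)
  then have "D\<^sup>\<dagger> ** D = 0"
    using norm_eq_trace[of "D ** D"] by (simp add: D trace_def)
  then show ?thesis
    using norm_eq_trace[of D] by (simp add: D_def trace_def)
qed

lemma psd_root_exists:
  assumes "pos_semidef A"
  obtains B where "pos_semidef B" "B ** B = A"
proof -
  obtain u d where *: "u \<in> unitary_matrices" "\<And>i. d i \<ge> 0" "A = u\<^sup>\<dagger> ** diag d ** u"
    using pos_semidef_spectral[OF assms] by blast
  show ?thesis
  proof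
    show "pos_semidef (u\<^sup>\<dagger> ** diag (\<lambda>i. sqrt (d i)) ** u)"
      using * by (intro pos_semidef_conj pos_semidef_diag) simp
    have "(u\<^sup>\<dagger> ** diag (\<lambda>i. sqrt (d i)) ** u) ** (u\<^sup>\<dagger> ** diag (\<lambda>i. sqrt (d i)) ** u) =
        u\<^sup>\<dagger> ** (diag (\<lambda>i. sqrt (d i)) ** diag (\<lambda>i. sqrt (d i))) ** u"
      by (simp add: matrix_mul_assoc unitary_cancel *)
    also have "\<dots> = A"
      using * by (simp add: diag_mult_diag)
    finally show "(u\<^sup>\<dagger> ** diag (\<lambda>i. sqrt (d i)) ** u) ** (u\<^sup>\<dagger> ** diag (\<lambda>i. sqrt (d i)) ** u) = A" .
  qed
qed

lemma psd_sqrt_unique: "pos_semidef B \<Longrightarrow> B ** B = A \<Longrightarrow> psd_sqrt A = B"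
  unfolding psd_sqrt_def by (rule the_equality) (auto intro: psd_root_unique)

lemma psd_sqrt_pos: "pos_semidef A \<Longrightarrow> pos_semidef (psd_sqrt A)"
  and psd_sqrt_square: "pos_semidef A \<Longrightarrow> psd_sqrt A ** psd_sqrt A = A"
  by (metis psd_root_exists psd_sqrt_unique)+

lemma psd_sqrt_det_nonzero: "pos_semidef A \<Longrightarrow> det A \<noteq> 0 \<Longrightarrow> det (psd_sqrt A) \<noteq> 0"
  by (metis psd_sqrt_square det_mul mult_zero_left)

text \<open>The graph of the root is closed because it is cut out by \<open>B\<^sup>2 = A\<close>, and the root is bounded on
  bounded sets; hence it is continuous.\<close>

lemma continuous_on_psd_sqrt: "continuous_on (psd_cone :: (complex^'n^'n) set) psd_sqrt"
proof -
  let ?N = "norm (mat 1 :: complex^'n^'n)"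
  have cont: "continuous_on (psd_cone \<inter> cball 0 r :: (complex^'n^'n) set) psd_sqrt" for r
  proof (rule continuous_from_closed_graph)
    show "compact (cball 0 (sqrt (?N * r)) :: (complex^'n^'n) set)" by simp
    have "norm (psd_sqrt A) \<le> sqrt (?N * r)" if "A \<in> psd_cone" "norm A \<le> r" for A :: "complex^'n^'n"
    proof -
      have A: "pos_semidef A" using that by (simp add: psd_cone_def)
      have "(norm (psd_sqrt A))\<^sup>2 = inner (mat 1) A"
        using psd_sqrt_square[OF A] pos_semidef_hermitian[OF psd_sqrt_pos[OF A]]
        by (simp add: norm_eq_trace inner_eq_trace)
      also have "\<dots> \<le> ?N * norm A" by (rule norm_cauchy_schwarz)
      also have "\<dots> \<le> ?N * r" using that by (intro mult_left_mono) auto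
      finally show ?thesis by (rule real_le_rsqrt)
    qed
    then show "psd_sqrt \<in> psd_cone \<inter> cball 0 r \<rightarrow> (cball 0 (sqrt (?N * r)) :: (complex^'n^'n) set)"
      by auto
    have "(\<lambda>x. (x, psd_sqrt x)) ` (psd_cone \<inter> cball 0 r) =
      ((psd_cone \<inter> cball 0 r) \<times> psd_cone) \<inter> {z :: (complex^'n^'n) \<times> (complex^'n^'n). snd z ** snd z = fst z}"
      by (auto simp: psd_cone_def psd_sqrt_pos psd_sqrt_square image_iff) (metis psd_sqrt_unique)
    also have "closed \<dots>"
      by (intro closed_Int closed_Times closed_psd_cone closed_cball closed_Collect_eq continuous_intros)
    finally show "closed ((\<lambda>x. (x, psd_sqrt x)) ` (psd_cone \<inter> cball 0 r :: (complex^'n^'n) set))" .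
  qed
  show ?thesis
    unfolding continuous_on_sequentially
  proof (intro allI ballI impI)
    fix X :: "nat \<Rightarrow> complex^'n^'n" and A
    assume A: "A \<in> psd_cone" and X: "(\<forall>n. X n \<in> psd_cone) \<and> X \<longlonglongrightarrow> A"
    then obtain r where r: "\<And>n. norm (X n) \<le> r"
      using convergent_imp_bounded[of X A] by (auto simp: bounded_iff)
    have "norm A \<le> r"
      using X r by (intro Lim_norm_ubound[of sequentially X A r]) auto
    then show "(psd_sqrt \<circ> X) \<longlonglongrightarrow> psd_sqrt A"
      using cont[of r] A X r unfolding continuous_on_sequentially by auto
  qed
qed

subsection \<open>Polar decomposition of rectangular matrices\<close>

text \<open>Let \<open>E\<close> be an isometric embedding and let \<open>u\<close> maximise \<open>Re tr (E\<^sup>\<dagger> u X)\<close> over the unitary group.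
  Comparing with \<open>phase_at \<zeta> v ** u\<close> shows \<open>Re \<langle>v, M v\<rangle> \<ge> Re (\<zeta> \<langle>v, M v\<rangle>)\<close> for \<open>M = u X E\<^sup>\<dagger>\<close> and all
  phases \<open>\<zeta>\<close>.  So \<open>M\<close> is positive semidefinite, which puts \<open>u X\<close> into the range of \<open>E\<close>.\<close>

lemma polar_decomposition:
  fixes X E :: "complex^'q^'p"
  assumes E: "E\<^sup>\<dagger> ** E = mat 1"
  obtains u h where "u \<in> unitary_matrices" "pos_semidef h" "u ** X = E ** h"
proof -
  define F where "F u = Re (trace (E\<^sup>\<dagger> ** (u ** X)))" for u
  have "continuous_on unitary_matrices F"
    unfolding F_def by (intro continuous_intros)
  then obtain u where u: "u \<in> unitary_matrices" and max: "\<And>v. v \<in> unitary_matrices \<Longrightarrow> F v \<le> F u"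
    using continuous_attains_sup[OF compact_unitary, of F] unitary_mat1 by blast
  define M where "M = u ** X ** E\<^sup>\<dagger>"
  have F: "F (k ** u) = Re (trace (k ** M))" for k
    using trace_mul_sym[of "E\<^sup>\<dagger>" "k ** u ** X"] by (simp add: F_def M_def matrix_mul_assoc)
  have unit: "cinner v (M *v v) = of_real (cmod (cinner v (M *v v)))" if v: "norm v = 1" for v
  proof -
    define c where "c = cinner v (M *v v)"
    \<comment> \<open>the phase that turns \<open>c\<close> into its absolute value\<close>
    define \<zeta> where "\<zeta> = (if c = 0 then 1 else cnj c / of_real (cmod c))"
    have \<zeta>: "cmod \<zeta> = 1" "\<zeta> * c = of_real (cmod c)"
      using complex_norm_square[of c]
      by (auto simp: \<zeta>_def norm_divide power2_eq_square mult.commute[of "cnj c"] field_simps)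
    have "F (phase_at \<zeta> v ** u) \<le> F u"
      by (intro max unitary_mult phase_at_unitary v u \<zeta>)
    then have "Re (trace (phase_at \<zeta> v ** M)) \<le> Re (trace M)"
      using F[of "mat 1"] by (simp add: F)
    moreover have "trace (phase_at \<zeta> v ** M) = trace M - (1 - \<zeta>) * c"
      by (simp add: phase_at_def matrix_ring_simps mult_cscale_left trace_sub trace_cscale
          trace_outer' c_def)
    ultimately have "cmod c \<le> Re c"
      using \<zeta>(2) by (simp add: left_diff_distrib)
    then have "Re c = cmod c"
      using complex_Re_le_cmod[of c] by simp
    then have "c = of_real (cmod c)"
      using cmod_power2[of c] by (simp add: complex_eq_iff)
    then show ?thesis by (simp add: c_def)
  qed
  have nonneg: "cinner v (M *v v) \<in> \<real> \<and> Re (cinner v (M *v v)) \<ge> 0" for v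
  proof (cases "v = 0")
    case False
    define w where "w = of_real (1 / norm v) *s v"
    have v: "v = of_real (norm v) *s w" using False by (simp add: w_def vec_eq_iff)
    have "norm w = 1"
      using False unfolding w_def of_real_smult by simp
    then have w: "cinner w (M *v w) = of_real (cmod (cinner w (M *v w)))"
      by (rule unit)
    have "cinner v (M *v v) = of_real ((norm v)\<^sup>2 * cmod (cinner w (M *v w)))"
      by (subst v, subst (2) v)
         (simp add: cinner_scale_left cinner_scale_right matrix_vector_scale power2_eq_square,
          subst w, simp)
    then show ?thesis by simp
  qed (simp add: cinner_def)
  then have M: "pos_semidef M"
    by (intro quad_form_nonneg_imp_pos_semidef) auto
  define h where "h = E\<^sup>\<dagger> ** M ** E"
  have "E ** X\<^sup>\<dagger> ** u\<^sup>\<dagger> = M"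
    using pos_semidef_hermitian[OF M] by (simp add: M_def ctranspose_mult matrix_mul_assoc)
  then have uX: "u ** X = E ** (X\<^sup>\<dagger> ** u\<^sup>\<dagger> ** E)"
    by (metis E M_def matrix_mul_assoc matrix_mul_rid)
  have h: "h = E\<^sup>\<dagger> ** (u ** X)"
    by (simp add: h_def M_def matrix_mul_assoc[symmetric] E)
  have "E ** (E\<^sup>\<dagger> ** (u ** X)) = u ** X"
    by (metis uX E matrix_mul_assoc matrix_mul_lid)
  then have "u ** X = E ** h" by (simp add: h)
  moreover have "pos_semidef h"
    unfolding h_def by (rule pos_semidef_conj[OF M])
  ultimately show ?thesis using u that by blast
qed

lemma pos_semidef_mat_abs: "pos_semidef (mat_abs x)"
  and mat_abs_square: "mat_abs x ** mat_abs x = x\<^sup>\<dagger> ** x"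
  by (simp_all add: mat_abs_def psd_sqrt_pos psd_sqrt_square pos_semidef_gram)

lemma mat_abs_unitary: "u \<in> unitary_matrices \<Longrightarrow> mat_abs (u ** x) = mat_abs x"
  by (simp add: mat_abs_def ctranspose_mult matrix_mul_assoc unitary_cancel)

lemma mat_abs_embed:
  assumes "E\<^sup>\<dagger> ** E = mat 1" "pos_semidef h"
  shows "mat_abs (E ** h) = h"
proof -
  have "(E ** h)\<^sup>\<dagger> ** (E ** h) = h ** h"
    using assms by (simp add: ctranspose_mult pos_semidef_hermitian) (metis matrix_mul_assoc matrix_mul_rid)
  then show ?thesis
    unfolding mat_abs_def using assms psd_sqrt_unique by auto
qed

text \<open>The unitary orbit of \<open>X\<close> contains \<open>E |X|\<close>; hence orbits are classified by the absolute value.\<close>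

lemma unitary_orbit_representative:
  fixes X E :: "complex^'q^'p"
  assumes E: "E\<^sup>\<dagger> ** E = mat 1"
  obtains u where "u \<in> unitary_matrices" "u ** X = E ** mat_abs X"
  using polar_decomposition[OF E, of X] mat_abs_embed[OF E] mat_abs_unitary by metis

lemma continuous_on_mat_abs: "continuous_on UNIV (mat_abs :: complex^'q^'p \<Rightarrow> _)"
proof -
  have "continuous_on UNIV (psd_sqrt \<circ> (\<lambda>x :: complex^'q^'p. x\<^sup>\<dagger> ** x))"
    by (intro continuous_on_compose continuous_intros continuous_on_subset[OF continuous_on_psd_sqrt])
       (auto simp: psd_cone_def pos_semidef_gram)
  then show ?thesis by (simp add: comp_def mat_abs_def[abs_def])
qed

lemma borel_measurable_mat_abs [measurable]:
  "f \<in> borel_measurable M \<Longrightarrow> (\<lambda>x. mat_abs (f x :: complex^'q^'p)) \<in> borel_measurable M"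
  by (rule borel_measurable_continuous_on[OF continuous_on_mat_abs])

text \<open>By the polar decomposition \<open>g = u\<^sup>\<dagger> h\<close>, both products are unitarily conjugate to \<open>h\<^sup>2\<close>.\<close>

lemma gram_conjugate:
  fixes g :: "complex^'n^'n"
  obtains u where "u \<in> unitary_matrices" "g ** g\<^sup>\<dagger> = u\<^sup>\<dagger> ** (g\<^sup>\<dagger> ** g) ** u"
proof -
  obtain u h where u: "u \<in> unitary_matrices" and h: "pos_semidef h" "u ** g = mat 1 ** h"
    using polar_decomposition[of "mat 1 :: complex^'n^'n" g] by auto
  then have "h ** h = (u ** g) ** (u ** g)\<^sup>\<dagger>" "h ** h = (u ** g)\<^sup>\<dagger> ** (u ** g)"
    by (simp_all add: pos_semidef_hermitian)
  then have 1: "h ** h = u ** (g ** g\<^sup>\<dagger>) ** u\<^sup>\<dagger>" and 2: "h ** h = g\<^sup>\<dagger> ** g"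
    using u by (simp_all add: ctranspose_mult matrix_mul_assoc unitary_cancel)
  have "g ** g\<^sup>\<dagger> = u\<^sup>\<dagger> ** (h ** h) ** u"
    unfolding 1 using u by (simp add: matrix_mul_assoc unitary_cancel unitaryD)
  then show ?thesis using u that 2 by simp
qed

section \<open>Lebesgue measure under linear maps of matrix spaces\<close>

lemma nn_integral_lborel_translate:
  fixes f :: "'a::euclidean_space \<Rightarrow> ennreal"
  assumes [measurable]: "f \<in> borel_measurable borel"
  shows "(\<integral>\<^sup>+x. f (x + c) \<partial>lborel) = (\<integral>\<^sup>+x. f x \<partial>lborel)"
proof -
  have "(\<integral>\<^sup>+x. f x \<partial>lborel) = (\<integral>\<^sup>+x. f x \<partial>distr lborel borel ((+) c))"
    by (simp add: lborel_distr_plus)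
  also have "\<dots> = (\<integral>\<^sup>+x. f (x + c) \<partial>lborel)"
    by (subst nn_integral_distr) (simp_all add: add.commute)
  finally show ?thesis by simp
qed

lemma linear_borel_measurable:
  fixes L :: "'a::euclidean_space \<Rightarrow> 'b::euclidean_space"
  shows "linear L \<Longrightarrow> L \<in> borel_measurable borel"
  by (simp add: borel_measurable_continuous_onI linear_continuous_on linear_conv_bounded_linear)

text \<open>Integrating \<open>f (L x) k y\<close> over \<open>x\<close> and \<open>y\<close> and translating each variable in turn moves \<open>L\<close> from
  \<open>f\<close> to \<open>k\<close>.  So the two integrals of \<open>f\<close> are proportional, with a factor that only depends on \<open>L\<close>.\<close>

lemma linear_transfer:
  fixes L :: "'a::euclidean_space \<Rightarrow> 'b::euclidean_space" and f k :: "'b \<Rightarrow> ennreal"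
  assumes L: "linear L" "surj L"
    and [measurable]: "f \<in> borel_measurable borel" "k \<in> borel_measurable borel"
    and k: "\<And>x. k (- x) = k x"
  shows "(\<integral>\<^sup>+x. f (L x) \<partial>lborel) * (\<integral>\<^sup>+y. k y \<partial>lborel) = (\<integral>\<^sup>+x. k (L x) \<partial>lborel) * (\<integral>\<^sup>+y. f y \<partial>lborel)"
proof -
  have [measurable]: "L \<in> borel_measurable borel" by (rule linear_borel_measurable[OF L(1)])
  have "(\<integral>\<^sup>+x. f (L x) \<partial>lborel) * (\<integral>\<^sup>+y. k y \<partial>lborel) = (\<integral>\<^sup>+x. f (L x) * (\<integral>\<^sup>+y. k (y + (- L x)) \<partial>lborel) \<partial>lborel)"
    by (simp only: nn_integral_lborel_translate[OF assms(4)]) (simp add: nn_integral_multc)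
  also have "\<dots> = (\<integral>\<^sup>+x. (\<integral>\<^sup>+y. f (L x) * k (y + (- L x)) \<partial>lborel) \<partial>lborel)"
    by (simp add: nn_integral_cmult)
  also have "\<dots> = (\<integral>\<^sup>+y. (\<integral>\<^sup>+x. f (L x) * k (y + (- L x)) \<partial>lborel) \<partial>lborel)"
    by (rule lborel_pair.Fubini'[symmetric]) measurable
  also have "\<dots> = (\<integral>\<^sup>+y. (\<integral>\<^sup>+x. f (L x + y) * k (L x) \<partial>lborel) \<partial>lborel)"
  proof (rule nn_integral_cong)
    fix y
    obtain c where c: "y = L c" using L(2) by auto
    have "(\<integral>\<^sup>+x. f (L x) * k (y + (- L x)) \<partial>lborel) = (\<integral>\<^sup>+x. f (L (x + c)) * k (y + (- L (x + c))) \<partial>lborel)"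
      by (rule nn_integral_lborel_translate[symmetric]) measurable
    also have "\<dots> = (\<integral>\<^sup>+x. f (L x + y) * k (L x) \<partial>lborel)"
      by (simp add: linear_add[OF L(1)] c k)
    finally show "(\<integral>\<^sup>+x. f (L x) * k (y + (- L x)) \<partial>lborel) = (\<integral>\<^sup>+x. f (L x + y) * k (L x) \<partial>lborel)" .
  qed
  also have "\<dots> = (\<integral>\<^sup>+x. (\<integral>\<^sup>+y. k (L x) * f (y + L x) \<partial>lborel) \<partial>lborel)"
    by (subst lborel_pair.Fubini') (measurable, simp add: mult.commute add.commute)
  also have "\<dots> = (\<integral>\<^sup>+x. k (L x) \<partial>lborel) * (\<integral>\<^sup>+y. f y \<partial>lborel)"
    by (simp add: nn_integral_cmult nn_integral_multc nn_integral_lborel_translate)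
  finally show ?thesis .
qed

lemma symmetric_box_indicator: "indicator (cbox (- One) One) (- x) = indicator (cbox (- One) One) (x :: 'a::euclidean_space)"
  by (auto simp: indicator_def mem_box)

lemma emeasure_unit_box: "emeasure lborel (cbox (- One) One :: 'a::euclidean_space set) = ennreal (2 ^ DIM('a))"
  by (subst emeasure_lborel_cbox) (auto simp: inner_simps)

lemma linear_change_of_variables:
  fixes L :: "'a::euclidean_space \<Rightarrow> 'b::euclidean_space"
  assumes L: "linear L" "bij L"
  obtains C :: real where "C > 0"
    "\<And>f. f \<in> borel_measurable borel \<Longrightarrow> (\<integral>\<^sup>+x. f (L x) \<partial>lborel) = ennreal C * (\<integral>\<^sup>+x. f x \<partial>lborel)"
proof -
  have [measurable]: "L \<in> borel_measurable borel" by (rule linear_borel_measurable[OF L(1)])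
  let ?B = "cbox (- One) One :: 'b set"
  define m where "m = emeasure lborel (L -` ?B)"
  have "L -` ?B = inv L ` ?B"
    using L(2) by (simp add: bij_vimage_eq_inv_image)
  moreover have "linear (inv L)"
  proof (rule linearI)
    have [simp]: "L (inv L x) = x" "inv L (L y) = y" for x y
      using L(2) by (simp_all add: bij_is_surj surj_f_inv_f bij_is_inj)
    fix x y :: 'b and r :: real
    have "inv L (L (inv L x + inv L y)) = inv L (x + y)"
      by (simp only: linear_add[OF L(1)]) simp
    then show "inv L (x + y) = inv L x + inv L y" by simp
    have "inv L (L (r *\<^sub>R inv L x)) = inv L (r *\<^sub>R x)"
      by (simp only: linear_cmul[OF L(1)]) simp
    then show "inv L (r *\<^sub>R x) = r *\<^sub>R inv L x" by simp
  qed
  ultimately have "compact (L -` ?B)"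
    by (metis compact_cbox compact_continuous_image linear_continuous_on linear_conv_bounded_linear)
  then have [measurable]: "L -` ?B \<in> sets borel"
    by (intro borel_closed compact_imp_closed)
  have fin: "m \<noteq> \<infinity>"
    using emeasure_compact_finite[OF \<open>compact (L -` ?B)\<close>] by (simp add: m_def less_top)
  have main: "(\<integral>\<^sup>+x. f (L x) \<partial>lborel) * ennreal (2 ^ DIM('b)) = m * (\<integral>\<^sup>+x. f x \<partial>lborel)"
    if [measurable]: "f \<in> borel_measurable borel" for f
  proof -
    have "(\<integral>\<^sup>+x. indicator ?B (L x) \<partial>lborel) = m"
      unfolding m_def
      by (subst nn_integral_indicator[symmetric], measurable) (simp add: indicator_def[abs_def])
    then show ?thesis
      using linear_transfer[OF L(1) bij_is_surj[OF L(2)] that, of "indicator ?B"]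
      by (simp add: symmetric_box_indicator emeasure_unit_box)
  qed
  have "m \<noteq> 0"
    using main[of "\<lambda>_. 1"] by (auto simp: ennreal_mult_eq_top_iff ennreal_top_mult)
  define C where "C = enn2real m / 2 ^ DIM('b)"
  have m: "m = ennreal (enn2real m)" "enn2real m > 0"
    using fin \<open>m \<noteq> 0\<close> by (auto simp: enn2real_positive_iff less_top zero_less_iff_neq_zero)
  show ?thesis
  proof
    show "C > 0" using m by (simp add: C_def)
    fix f :: "'b \<Rightarrow> ennreal" assume f: "f \<in> borel_measurable borel"
    have "ennreal C * (\<integral>\<^sup>+x. f x \<partial>lborel) = ennreal (inverse (2 ^ DIM('b))) * (m * (\<integral>\<^sup>+x. f x \<partial>lborel))"
      by (subst m(1)) (simp add: C_def divide_inverse ennreal_mult'' mult_ac)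
    also have "\<dots> = (ennreal (inverse (2 ^ DIM('b))) * ennreal (2 ^ DIM('b))) * (\<integral>\<^sup>+x. f (L x) \<partial>lborel)"
      by (simp only: main[OF f, symmetric] mult_ac)
    also have "\<dots> = (\<integral>\<^sup>+x. f (L x) \<partial>lborel)"
      by (simp add: ennreal_mult[symmetric] del: ennreal_power[symmetric])
    finally show "(\<integral>\<^sup>+x. f (L x) \<partial>lborel) = ennreal C * (\<integral>\<^sup>+x. f x \<partial>lborel)" ..
  qed
qed

lemma linear_isometry_change_of_variables:
  fixes L :: "'a::euclidean_space \<Rightarrow> 'a"
  assumes L: "linear L" "\<And>x. norm (L x) = norm x"
    and f [measurable]: "f \<in> borel_measurable borel"
  shows "(\<integral>\<^sup>+x. f (L x) \<partial>lborel) = (\<integral>\<^sup>+x. f x \<partial>lborel)"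
proof -
  have "inj L"
    using L by (metis linear_injective_0 norm_eq_zero)
  then have "bij L"
    using L(1) linear_injective_imp_surjective by (auto simp: bij_def)
  then obtain C where C: "C > 0" and eq: "\<And>f. f \<in> borel_measurable borel \<Longrightarrow>
      (\<integral>\<^sup>+x. f (L x) \<partial>lborel) = ennreal C * (\<integral>\<^sup>+x. f x \<partial>lborel)"
    using linear_change_of_variables[OF L(1)] by metis
  let ?B = "cball 0 1 :: 'a set"
  have "(\<integral>\<^sup>+x. indicator ?B (L x) \<partial>lborel) = (\<integral>\<^sup>+x. indicator ?B x \<partial>lborel)"
    by (intro nn_integral_cong) (simp add: indicator_def L(2))
  then have "emeasure lborel ?B = ennreal C * emeasure lborel ?B"
    using eq[of "indicator ?B"] by (simp add: borel_measurable_indicator)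
  moreover have "emeasure lborel ?B \<noteq> \<infinity>"
    using emeasure_lborel_cball_finite[of 0 1] by (simp add: less_top)
  moreover have "emeasure lborel ?B \<noteq> 0"
    using unit_ball_vol_pos[of "real DIM('a)"] by (auto simp: emeasure_cball less_le)
  ultimately have "ennreal C = 1"
    by (metis ennreal_mult_cancel_left mult.commute mult.right_neutral infinity_ennreal_def)
  then show ?thesis
    using eq[OF f] by simp
qed

text \<open>Averaging over the translates by \<open>t v\<close> with \<open>t\<close> in the unit interval does not change the measure of
  \<open>N\<close>, and by Fubini the average is an integral of one-dimensional measures of countable sets.\<close>

lemma null_set_by_shifting:
  fixes N :: "'a::euclidean_space set"
  assumes N [measurable]: "N \<in> sets borel"
    and line: "\<And>x. countable {t::real. x + t *\<^sub>R v \<in> N}"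
  shows "emeasure lborel N = 0"
proof -
  let ?I = "indicator {0..1::real} :: real \<Rightarrow> ennreal"
  have "emeasure lborel N = (\<integral>\<^sup>+t. ?I t * (\<integral>\<^sup>+x. indicator N x \<partial>lborel) \<partial>lborel)"
    by (simp add: nn_integral_multc)
  also have "\<dots> = (\<integral>\<^sup>+t. ?I t * (\<integral>\<^sup>+x. indicator N (x + t *\<^sub>R v) \<partial>lborel) \<partial>lborel)"
    by (subst nn_integral_lborel_translate) simp_all
  also have "\<dots> = (\<integral>\<^sup>+t. (\<integral>\<^sup>+x. ?I t * indicator N (x + t *\<^sub>R v) \<partial>lborel) \<partial>lborel)"
    by (simp add: nn_integral_cmult)
  also have "\<dots> = (\<integral>\<^sup>+x. (\<integral>\<^sup>+t. ?I t * indicator N (x + t *\<^sub>R v) \<partial>lborel) \<partial>lborel)"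
    by (rule lborel_pair.Fubini') measurable
  also have "\<dots> = (\<integral>\<^sup>+x. 0 \<partial>(lborel :: 'a measure))"
  proof (rule nn_integral_cong)
    fix x :: 'a
    have "AE t in lborel. t \<notin> {t. x + t *\<^sub>R v \<in> N}"
      by (rule AE_not_in countable_imp_null_set_lborel line)+
    then show "(\<integral>\<^sup>+t. ?I t * indicator N (x + t *\<^sub>R v) \<partial>lborel) = 0"
      by (subst nn_integral_0_iff_AE) (auto elim!: eventually_mono simp: indicator_def)
  qed
  finally show ?thesis by simp
qed

lemma scaleR_matrix_vector: "(c *\<^sub>R A) *v v = c *\<^sub>R (A *v (v :: complex^'n))"
  by (simp add: vec_eq_iff matrix_vector_mult_def scaleR_sum_right)

text \<open>The determinant is a polynomial in \<open>t\<close>.  It is not the zero polynomial because it does not vanish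
  when \<open>t\<close> exceeds the operator norm of \<open>A\<close>.\<close>

lemma finite_singular_shifts:
  fixes A :: "complex^'n^'n"
  shows "finite {t::real. det (A + t *\<^sub>R mat 1) = 0}"
proof -
  define P where "P = (\<Sum>p\<in>{p. p permutes (UNIV :: 'n set)}. of_int (sign p) *
     (\<Prod>i\<in>UNIV. [:A $ i $ p i, if i = p i then 1 else 0:]))"
  have P: "poly P (of_real t) = det (A + t *\<^sub>R mat 1)" for t
    unfolding P_def det_def poly_sum
    by (intro sum.cong refl)
       (simp add: poly_prod mat_def, intro prod.cong disjI2 refl, auto simp: scaleR_conv_of_real)
  obtain K where K: "\<And>v. norm (A *v v) \<le> norm v * K" "K > 0"
    using bounded_linear.pos_bounded[OF matrix_vector_mul_bounded_linear[of A]] by blast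
  have "det (A + (K + 1) *\<^sub>R mat 1) \<noteq> 0"
    unfolding det_nonzero_iff_kernel
  proof (intro allI impI)
    fix v assume "(A + (K + 1) *\<^sub>R mat 1) *v v = 0"
    then have "A *v v = - ((K + 1) *\<^sub>R v)"
      by (simp add: matrix_vector_mult_add_rdistrib scaleR_matrix_vector add_eq_0_iff2)
    then have "(K + 1) * norm v \<le> norm v * K"
      using K(1)[of v] K(2) by simp
    then show "v = 0" by (simp add: algebra_simps)
  qed
  then have "P \<noteq> 0"
    using P[of "K + 1"] by auto
  then have "finite {z. poly P z = 0}" by (rule poly_roots_finite)
  then have "finite (complex_of_real -` {z. poly P z = 0})"
    by (rule finite_vimageI) (simp add: inj_on_def)
  then show ?thesis by (simp add: vimage_def P)
qed

subsection \<open>Multiplication by matrices\<close>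

lemma lborel_unitary_left:
  assumes "f \<in> borel_measurable borel" "u \<in> unitary_matrices"
  shows "(\<integral>\<^sup>+X. f (u ** X) \<partial>lborel) = (\<integral>\<^sup>+X. f (X :: complex^'q^'p) \<partial>lborel)"
  using assms by (intro linear_isometry_change_of_variables linear_matrix_mult_left norm_unitary_left)

lemma lborel_unitary_right:
  assumes "f \<in> borel_measurable borel" "u \<in> unitary_matrices"
  shows "(\<integral>\<^sup>+X. f (X ** u) \<partial>lborel) = (\<integral>\<^sup>+X. f (X :: complex^'q^'p) \<partial>lborel)"
  using assms by (intro linear_isometry_change_of_variables linear_matrix_mult_right norm_unitary_right)

lemma lborel_ctranspose:
  assumes "f \<in> borel_measurable borel"
  shows "(\<integral>\<^sup>+X. f (X\<^sup>\<dagger>) \<partial>lborel) = (\<integral>\<^sup>+X. f (X :: complex^'q^'q) \<partial>lborel)"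
  using assms by (intro linear_isometry_change_of_variables linear_ctranspose norm_ctranspose)

lemma prod_Basis_vec:
  "(\<Prod>b\<in>Basis. g b) = (\<Prod>i\<in>UNIV. \<Prod>u\<in>Basis. g (axis i (u :: 'a::euclidean_space) :: 'a^'n))"
proof -
  have B: "(Basis :: ('a^'n) set) = (\<lambda>(i, u). axis i u) ` (UNIV \<times> Basis)"
    by (auto simp: Basis_vec_def)
  have "inj_on (\<lambda>(i, u). axis i u :: 'a^'n) (UNIV \<times> Basis)"
    by (auto simp: inj_on_def axis_eq_axis)
  then show ?thesis
    by (subst B, subst prod.reindex) (auto simp: prod.cartesian_product case_prod_beta)
qed

lemma axis_mult_diag:
  "axis i (axis j z) ** diag d = d j *\<^sub>R (axis i (axis j z) :: complex^'q^'p)"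
  by (simp add: vec_eq_iff diag_mult_right) (simp add: axis_def scaleR_conv_of_real)

text \<open>Every entry in column \<open>j\<close> has two real coordinates, and each is multiplied by \<open>d j\<close>.\<close>

lemma lborel_diag_right:
  fixes f :: "complex^'q^'p \<Rightarrow> ennreal"
  assumes [measurable]: "f \<in> borel_measurable borel" and d: "\<And>i. d i > 0"
  shows "ennreal ((\<Prod>i\<in>UNIV. d i) ^ (2 * CARD('p))) * (\<integral>\<^sup>+X. f (X ** diag d) \<partial>lborel) = (\<integral>\<^sup>+X. f X \<partial>lborel)"
proof -
  define c where "c b = inner (b ** diag d) b" for b :: "complex^'q^'p"
  have c: "c (axis i (axis j z)) = d j" if "z \<in> Basis" for i j z
    using that by (simp add: c_def axis_mult_diag inner_axis_axis)
  have b: "b ** diag d = c b *\<^sub>R b \<and> c b > 0" if b: "b \<in> Basis" for b :: "complex^'q^'p"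
  proof -
    obtain i j z where "b = axis i (axis j z)" "z \<in> Basis"
      using b unfolding Basis_vec_def by blast
    then show ?thesis using c d axis_mult_diag by metis
  qed
  have T: "0 + (\<Sum>j\<in>Basis. (c j * (X \<bullet> j)) *\<^sub>R j) = X ** diag d" for X :: "complex^'q^'p"
  proof -
    have "X ** diag d = (\<Sum>j\<in>Basis. (X \<bullet> j) *\<^sub>R j) ** diag d"
      by (simp add: euclidean_representation)
    also have "\<dots> = (\<Sum>j\<in>Basis. (X \<bullet> j) *\<^sub>R (j ** diag d))"
      by (simp add: linear_sum[OF linear_matrix_mult_right] linear_cmul[OF linear_matrix_mult_right])
    also have "\<dots> = (\<Sum>j\<in>Basis. (c j * (X \<bullet> j)) *\<^sub>R j)"
      using b by (intro sum.cong refl) (simp add: mult.commute)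
    finally show ?thesis by simp
  qed
  have "(\<Prod>b\<in>Basis. \<bar>c b\<bar>) = (\<Prod>i\<in>(UNIV :: 'p set). \<Prod>j\<in>UNIV. \<Prod>z\<in>(Basis :: complex set). \<bar>d j\<bar>)"
    unfolding prod_Basis_vec by (intro prod.cong refl) (simp add: c)
  also have "\<dots> = (\<Prod>i\<in>UNIV. d i) ^ (2 * CARD('p))"
    using d by (simp add: prod_power_distrib power_mult abs_of_pos)
  finally have prod: "(\<Prod>b\<in>Basis. \<bar>c b\<bar>) = (\<Prod>i\<in>UNIV. d i) ^ (2 * CARD('p))" .
  have "lborel = density (distr lborel borel (\<lambda>X :: complex^'q^'p. X ** diag d)) (\<lambda>_. ennreal (\<Prod>b\<in>Basis. \<bar>c b\<bar>))"
    using lborel_affine_euclidean[of c 0] b unfolding T by (metis order_less_irrefl)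
  then have "(\<integral>\<^sup>+X. f X \<partial>lborel) =
      (\<integral>\<^sup>+X. f X \<partial>density (distr lborel borel (\<lambda>X. X ** diag d)) (\<lambda>_. ennreal (\<Prod>b\<in>Basis. \<bar>c b\<bar>)))"
    by simp
  also have "\<dots> = ennreal (\<Prod>b\<in>Basis. \<bar>c b\<bar>) * (\<integral>\<^sup>+X. f (X ** diag d) \<partial>lborel)"
    by (simp add: nn_integral_density nn_integral_distr nn_integral_cmult)
  finally show ?thesis by (simp add: prod)
qed

text \<open>Unitary diagonalisation reduces this to a diagonal factor.\<close>

lemma lborel_pos_def_right:
  fixes f :: "complex^'q^'p \<Rightarrow> ennreal"
  assumes [measurable]: "f \<in> borel_measurable borel" and k: "pos_def k"
  shows "ennreal (cmod (det k) ^ (2 * CARD('p))) * (\<integral>\<^sup>+X. f (X ** k) \<partial>lborel) = (\<integral>\<^sup>+X. f X \<partial>lborel)"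
proof -
  obtain u d where u: "u \<in> unitary_matrices" and d: "\<And>i. d i \<ge> 0" and eq: "k = u\<^sup>\<dagger> ** diag d ** u"
    using k pos_semidef_spectral[of k] by (auto simp: pos_def_iff)
  have det: "cmod (det k) = (\<Prod>i\<in>UNIV. d i)"
    using u d by (simp add: eq det_mul norm_mult det_ctranspose det_unitary det_diag prod_norm[symmetric]
        abs_of_nonneg)
  have "d i \<noteq> 0" for i
  proof
    assume "d i = 0"
    then have "(\<Prod>i\<in>UNIV. d i) = 0" by (auto intro: prod_zero)
    then show False using k by (metis det norm_eq_zero pos_def_iff)
  qed
  then have d': "d i > 0" for i using d[of i] by (simp add: less_le)
  have "(\<integral>\<^sup>+X. f (X ** k) \<partial>lborel) = (\<integral>\<^sup>+X. f (X ** u\<^sup>\<dagger> ** diag d ** u) \<partial>lborel)"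
    by (simp add: eq matrix_mul_assoc)
  also have "\<dots> = (\<integral>\<^sup>+X. f (X ** diag d ** u) \<partial>lborel)"
    by (rule lborel_unitary_right) (auto simp: unitary_ctranspose u)
  finally show ?thesis
    using lborel_diag_right[of "\<lambda>X. f (X ** u)" d] d' u by (simp add: det lborel_unitary_right)
qed

lemma lborel_pos_def_left:
  fixes f :: "complex^'q^'q \<Rightarrow> ennreal"
  assumes [measurable]: "f \<in> borel_measurable borel" and k: "pos_def k"
  shows "ennreal (cmod (det k) ^ (2 * CARD('q))) * (\<integral>\<^sup>+X. f (k ** X) \<partial>lborel) = (\<integral>\<^sup>+X. f X \<partial>lborel)"
proof -
  have "(\<integral>\<^sup>+X. f (k ** X) \<partial>lborel) = (\<integral>\<^sup>+X. f ((X ** k)\<^sup>\<dagger>) \<partial>lborel)"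
    using k lborel_ctranspose[of "\<lambda>X. f (k ** X)"]
    by (simp add: ctranspose_mult pos_def_iff pos_semidef_hermitian)
  then show ?thesis
    using lborel_pos_def_right[of "\<lambda>X. f (X\<^sup>\<dagger>)", OF _ k] by (simp add: lborel_ctranspose)
qed

subsection \<open>Lebesgue measure on the Hermitian matrices\<close>

text \<open>Adding the symmetric real part and the antisymmetric imaginary part identifies Hermitian
  matrices with real square matrices; Lebesgue measure is transported along this linear bijection.\<close>

definition herm :: "real^'n^'n \<Rightarrow> complex^'n^'n" where
  "herm M = (\<chi> i j. Complex ((M $ i $ j + M $ j $ i) / 2) ((M $ i $ j - M $ j $ i) / 2))"

definition unherm :: "complex^'n^'n \<Rightarrow> real^'n^'n" where
  "unherm A = (\<chi> i j. Re (A $ i $ j) + Im (A $ i $ j))"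

lemma herm_hermitian [simp]: "(herm M)\<^sup>\<dagger> = herm M"
  by (simp add: herm_def vec_eq_iff complex_eq_iff add_divide_distrib diff_divide_distrib)

lemma unherm_herm [simp]: "unherm (herm M) = M"
  by (simp add: herm_def unherm_def vec_eq_iff add_divide_distrib diff_divide_distrib)

lemma herm_unherm: "A\<^sup>\<dagger> = A \<Longrightarrow> herm (unherm A) = A"
proof -
  assume "A\<^sup>\<dagger> = A"
  then have A: "A $ j $ i = cnj (A $ i $ j)" for i j by (metis ctranspose_nth)
  have "herm (unherm A) $ i $ j = A $ i $ j" for i j
    using A[where i = i and j = j] by (simp add: herm_def unherm_def complex_eq_iff)
  then show ?thesis
    by (simp add: vec_eq_iff)
qed

lemma linear_herm: "linear (herm :: real^'n^'n \<Rightarrow> _)"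
  by (rule linearI) (simp_all add: herm_def vec_eq_iff complex_eq_iff
      add_divide_distrib diff_divide_distrib right_diff_distrib distrib_left)

lemma linear_unherm: "linear (unherm :: complex^'n^'n \<Rightarrow> _)"
  by (rule linearI) (simp_all add: unherm_def vec_eq_iff algebra_simps)

lemma borel_measurable_herm [measurable]: "herm \<in> borel_measurable borel"
  and borel_measurable_unherm [measurable]: "unherm \<in> borel_measurable borel"
  by (rule linear_borel_measurable linear_herm linear_unherm)+

lemma borel_measurable_cscale [measurable]:
  "f \<in> borel_measurable M \<Longrightarrow> (\<lambda>x. cscale c (f x :: complex^'q^'p)) \<in> borel_measurable M"
  by (rule measurable_compose[OF _ linear_borel_measurable])
     (auto intro!: linearI simp: vec_eq_iff algebra_simps)

lemma hermitian_conj: "(g\<^sup>\<dagger> ** herm M ** g)\<^sup>\<dagger> = g\<^sup>\<dagger> ** herm M ** g"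
  by (simp add: ctranspose_mult matrix_mul_assoc)

lemma det_nonzero_inverse:
  fixes g :: "complex^'n^'n"
  assumes "det g \<noteq> 0"
  obtains h where "g ** h = mat 1" "h ** g = mat 1"
  using assms invertible_det_nz invertible_def by metis

text \<open>The space of all complex matrices splits into two copies of the Hermitian ones, and
  \<open>A \<mapsto> g\<^sup>\<dagger> A g\<close> acts on both by the same map.  Hence its Jacobian on the Hermitian matrices is the
  square root of its Jacobian on all matrices.\<close>

lemma lborel_herm_conj:
  fixes f :: "complex^'q^'q \<Rightarrow> ennreal"
  assumes det: "det g \<noteq> 0" and J: "J > 0"
    and jac: "\<And>F. F \<in> borel_measurable borel \<Longrightarrow>
      ennreal (J\<^sup>2) * (\<integral>\<^sup>+A. F (g\<^sup>\<dagger> ** A ** g) \<partial>lborel) = (\<integral>\<^sup>+A. F (A :: complex^'q^'q) \<partial>lborel)"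
    and f [measurable]: "f \<in> borel_measurable borel"
  shows "ennreal J * (\<integral>\<^sup>+M. f (g\<^sup>\<dagger> ** herm M ** g) \<partial>lborel) = (\<integral>\<^sup>+M. f (herm M) \<partial>lborel)"
proof -
  \<comment> \<open>\<open>L\<close> is the map in the coordinates of the Hermitian space, and \<open>C\<close> is its inverse Jacobian\<close>
  define L where "L M = unherm (g\<^sup>\<dagger> ** herm M ** g)" for M
  have herm_L: "herm (L M) = g\<^sup>\<dagger> ** herm M ** g" for M
    by (simp add: L_def herm_unherm hermitian_conj)
  obtain h where h: "g ** h = mat 1" "h ** g = mat 1"
    using det det_nonzero_inverse by blast
  have linL: "linear L"
    by (rule linearI)
       (simp_all add: L_def linear_add[OF linear_herm] linear_cmul[OF linear_herm]
         matrix_ring_simps linear_add[OF linear_unherm] linear_cmul[OF linear_unherm])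
  have "L (unherm (h\<^sup>\<dagger> ** herm M ** h)) = M" "unherm (h\<^sup>\<dagger> ** herm (L M) ** h) = M" for M
  proof -
    have *: "X ** h ** g = X" "X ** g ** h = X" "g\<^sup>\<dagger> ** h\<^sup>\<dagger> = mat 1" "h\<^sup>\<dagger> ** g\<^sup>\<dagger> = mat 1" for X :: "complex^'q^'q"
      using h by (simp_all add: matrix_mul_assoc[symmetric] ctranspose_mult[symmetric])
    show "L (unherm (h\<^sup>\<dagger> ** herm M ** h)) = M" "unherm (h\<^sup>\<dagger> ** herm (L M) ** h) = M"
      unfolding herm_L by (simp_all add: L_def herm_unherm hermitian_conj matrix_mul_assoc *)
  qed
  then have "bij L"
    by (intro o_bij[of "\<lambda>M. unherm (h\<^sup>\<dagger> ** herm M ** h)"]) (simp_all add: fun_eq_iff)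
  then obtain C where C: "C > 0" and CL: "\<And>f. f \<in> borel_measurable borel \<Longrightarrow>
      (\<integral>\<^sup>+x. f (L x) \<partial>lborel) = ennreal C * (\<integral>\<^sup>+x. f x \<partial>lborel)"
    using linear_change_of_variables[OF linL] by metis
  \<comment> \<open>the splitting of a matrix into Hermitian and skew-Hermitian parts, and its inverse\<close>
  define H where "H z = herm (fst z) + cscale \<i> (herm (snd z))" for z :: "(real^'q^'q) \<times> (real^'q^'q)"
  define H' where "H' A = (unherm ((1/2) *\<^sub>R (A + A\<^sup>\<dagger>)), unherm (cscale (- \<i>/2) (A - A\<^sup>\<dagger>)))" for A :: "complex^'q^'q"
  have cs: "(cscale \<i> X)\<^sup>\<dagger> = - cscale \<i> (X\<^sup>\<dagger>)" for X :: "complex^'q^'q"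
    by (simp add: vec_eq_iff)
  have H'H: "H' (H z) = z" for z
  proof -
    have 1: "(1/2) *\<^sub>R (H z + (H z)\<^sup>\<dagger>) = herm (fst z)"
      by (simp add: H_def ctranspose_add cs)
    have 2: "cscale (- \<i>/2) (H z - (H z)\<^sup>\<dagger>) = herm (snd z)"
      by (simp add: H_def ctranspose_add cs) (simp add: vec_eq_iff field_simps)
    show ?thesis unfolding H'_def 1 2 by simp
  qed
  have HH': "H (H' A) = A" for A
  proof -
    have 1: "herm (unherm ((1/2) *\<^sub>R (A + A\<^sup>\<dagger>))) = (1/2) *\<^sub>R (A + A\<^sup>\<dagger>)"
      by (rule herm_unherm) (simp add: ctranspose_add ctranspose_scaleR add.commute)
    have 2: "herm (unherm (cscale (- \<i>/2) (A - A\<^sup>\<dagger>))) = cscale (- \<i>/2) (A - A\<^sup>\<dagger>)"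
      by (rule herm_unherm) (simp add: vec_eq_iff field_simps)
    show ?thesis unfolding H'_def H_def fst_conv snd_conv 1 2
      by (simp add: vec_eq_iff complex_eq_iff field_simps)
  qed
  have linH: "linear H"
    by (rule linearI)
       (simp_all add: H_def linear_add[OF linear_herm] linear_cmul[OF linear_herm] vec_eq_iff algebra_simps)
  have "bij H"
    by (intro o_bij[of H']) (simp_all add: fun_eq_iff H'H HH')
  then obtain D where D: "D > 0" and DH: "\<And>f. f \<in> borel_measurable borel \<Longrightarrow>
      (\<integral>\<^sup>+x. f (H x) \<partial>lborel) = ennreal D * (\<integral>\<^sup>+x. f x \<partial>lborel)"
    using linear_change_of_variables[OF linH] by metis
  have gH: "g\<^sup>\<dagger> ** H z ** g = H (L (fst z), L (snd z))" for z
    by (simp add: H_def herm_L matrix_ring_simps mult_cscale_left mult_cscale_right)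
  \<comment> \<open>testing with a product function compares \<open>J\<^sup>2 C\<^sup>2\<close> with 1\<close>
  define ind :: "real^'q^'q \<Rightarrow> ennreal" where "ind = indicator (cbox (- One) One)"
  have [measurable]: "ind \<in> borel_measurable borel" "L \<in> borel_measurable borel"
    by (auto simp: ind_def linear_borel_measurable linL)
  have ind: "(\<integral>\<^sup>+M. ind M \<partial>lborel) = ennreal (2 ^ DIM(real^'q^'q))"
    by (simp add: ind_def emeasure_unit_box)
  define F where "F A = (case H' A of (M, N) \<Rightarrow> ind M * ind N)" for A
  have [measurable]: "F \<in> borel_measurable borel"
    unfolding F_def H'_def case_prod_conv by measurable
  have prod: "(\<integral>\<^sup>+z. a (fst z) * a (snd z) \<partial>lborel) = (\<integral>\<^sup>+M. a M \<partial>lborel)\<^sup>2"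
    if [measurable]: "a \<in> borel_measurable borel" for a :: "real^'q^'q \<Rightarrow> ennreal"
  proof -
    have "(\<integral>\<^sup>+z. a (fst z) * a (snd z) \<partial>lborel) = (\<integral>\<^sup>+M. (\<integral>\<^sup>+N. a M * a N \<partial>lborel) \<partial>lborel)"
      by (subst lborel_prod[symmetric], subst lborel.nn_integral_fst[symmetric]) simp_all
    also have "\<dots> = (\<integral>\<^sup>+M. a M \<partial>lborel)\<^sup>2"
      by (simp add: nn_integral_cmult nn_integral_multc power2_eq_square)
    finally show ?thesis .
  qed
  have 1: "ennreal D * (\<integral>\<^sup>+A. F A \<partial>lborel) = (\<integral>\<^sup>+M. ind M \<partial>lborel)\<^sup>2"
    using DH[of F] prod[of ind] by (simp add: F_def H'H case_prod_beta)
  have mF: "(\<lambda>A. F (g\<^sup>\<dagger> ** A ** g)) \<in> borel_measurable borel"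
    by measurable
  have 2: "ennreal D * (\<integral>\<^sup>+A. F (g\<^sup>\<dagger> ** A ** g) \<partial>lborel) = (ennreal C * (\<integral>\<^sup>+M. ind M \<partial>lborel))\<^sup>2"
    using DH[OF mF] prod[of "\<lambda>M. ind (L M)"] CL[of ind]
    by (simp add: gH F_def H'H)
  have "ennreal (J\<^sup>2) * (ennreal C * (\<integral>\<^sup>+M. ind M \<partial>lborel))\<^sup>2 = (\<integral>\<^sup>+M. ind M \<partial>lborel)\<^sup>2"
    unfolding 1[symmetric] 2[symmetric] using jac[of F] by (simp add: mult.left_commute)
  moreover obtain n :: real where n: "n > 0" "(\<integral>\<^sup>+M. ind M \<partial>lborel) = ennreal n"
    using ind by (metis zero_less_power zero_less_numeral)
  ultimately have "ennreal (J\<^sup>2 * (C * n)\<^sup>2) = ennreal (n\<^sup>2)"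
    using C J by (simp add: ennreal_mult[symmetric] ennreal_power)
  then have "(J * C)\<^sup>2 * n\<^sup>2 = 1 * n\<^sup>2"
    using C J n(1) by (subst (asm) ennreal_inj) (auto simp: power_mult_distrib)
  then have "(J * C)\<^sup>2 = 1"
    using n(1) by simp
  moreover have "J * C > 0" using C J by simp
  ultimately have "J * C = 1"
    by (simp add: power2_eq_1_iff)
  then have "ennreal J * ennreal C = 1"
    using C J by (simp add: ennreal_mult[symmetric])
  then show ?thesis
    using CL[of "\<lambda>M. f (herm M)"] by (simp add: herm_L mult.assoc[symmetric])
qed

lemma lborel_herm_pos_def:
  fixes f :: "complex^'q^'q \<Rightarrow> ennreal"
  assumes f: "f \<in> borel_measurable borel" and k: "pos_def k"
  shows "ennreal (cmod (det k) ^ (2 * CARD('q))) * (\<integral>\<^sup>+M. f (k ** herm M ** k) \<partial>lborel) = (\<integral>\<^sup>+M. f (herm M) \<partial>lborel)"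
proof -
  have k': "k\<^sup>\<dagger> = k" "det k \<noteq> 0"
    using k by (auto simp: pos_def_iff pos_semidef_hermitian)
  have "ennreal (cmod (det k) ^ (2 * CARD('q))) * (\<integral>\<^sup>+M. f (k\<^sup>\<dagger> ** herm M ** k) \<partial>lborel) = (\<integral>\<^sup>+M. f (herm M) \<partial>lborel)"
  proof (intro lborel_herm_conj f)
    fix F :: "complex^'q^'q \<Rightarrow> ennreal" assume [measurable]: "F \<in> borel_measurable borel"
    show "ennreal ((cmod (det k) ^ (2 * CARD('q)))\<^sup>2) * (\<integral>\<^sup>+A. F (k\<^sup>\<dagger> ** A ** k) \<partial>lborel) = (\<integral>\<^sup>+A. F A \<partial>lborel)"
      using lborel_pos_def_left[of "\<lambda>A. F (A ** k)", OF _ k] lborel_pos_def_right[of F, OF _ k]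
      by (simp add: k' power2_eq_square ennreal_mult mult.assoc)
  qed (use k' in auto)
  then show ?thesis by (simp add: k')
qed

lemma lborel_herm_unitary:
  fixes f :: "complex^'q^'q \<Rightarrow> ennreal"
  assumes f: "f \<in> borel_measurable borel" and u: "u \<in> unitary_matrices"
  shows "(\<integral>\<^sup>+M. f (u\<^sup>\<dagger> ** herm M ** u) \<partial>lborel) = (\<integral>\<^sup>+M. f (herm M) \<partial>lborel)"
proof -
  have "ennreal 1 * (\<integral>\<^sup>+M. f (u\<^sup>\<dagger> ** herm M ** u) \<partial>lborel) = (\<integral>\<^sup>+M. f (herm M) \<partial>lborel)"
  proof (rule lborel_herm_conj)
    show "det u \<noteq> 0" using det_unitary[OF u] by auto
    fix F :: "complex^'q^'q \<Rightarrow> ennreal" assume [measurable]: "F \<in> borel_measurable borel"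
    show "ennreal (1\<^sup>2) * (\<integral>\<^sup>+A. F (u\<^sup>\<dagger> ** A ** u) \<partial>lborel) = (\<integral>\<^sup>+A. F A \<partial>lborel)"
      using lborel_unitary_left[of "\<lambda>A. F (A ** u)", OF _ unitary_ctranspose[OF u]]
        lborel_unitary_right[of F, OF _ u] by simp
  qed (use f in auto)
  then show ?thesis by simp
qed

lemma lborel_herm_translate:
  fixes f :: "complex^'q^'q \<Rightarrow> ennreal"
  assumes [measurable]: "f \<in> borel_measurable borel" and B: "B\<^sup>\<dagger> = B"
  shows "(\<integral>\<^sup>+M. f (herm M + B) \<partial>lborel) = (\<integral>\<^sup>+M. f (herm M) \<partial>lborel)"
  using nn_integral_lborel_translate[of "\<lambda>M. f (herm M)" "unherm B"]
  by (simp add: linear_add[OF linear_herm] herm_unherm[OF B])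

section \<open>Haar measure on the unitary group\<close>

text \<open>Writing the inverse by Cramer's rule makes its Borel measurability on the whole space evident; on
  singular matrices the value is 0.\<close>

definition cramer_inverse :: "complex^'n^'n \<Rightarrow> complex^'n^'n" where
  "cramer_inverse A = cscale (inverse (det A))
     (\<chi> i j. det (\<chi> k l. if l = i then axis j 1 $ k else A $ k $ l))"

lemma cramer_inverse:
  assumes A: "det A \<noteq> 0"
  shows "A ** cramer_inverse A = mat 1" "cramer_inverse A ** A = mat 1"
proof -
  have "A *v (\<chi> i. cramer_inverse A $ i $ j) = axis j 1" for j
    unfolding cramer[OF A] by (simp add: vec_eq_iff cramer_inverse_def field_simps)
  then have "(A ** cramer_inverse A) $ i $ j = mat 1 $ i $ j" for i j
    by (simp add: vec_eq_iff matrix_vector_mult_def matrix_matrix_mult_def mat_def axis_def)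
  then show "A ** cramer_inverse A = mat 1" by (simp add: vec_eq_iff)
  then show "cramer_inverse A ** A = mat 1" by (simp add: matrix_left_right_inverse)
qed

lemma cramer_inverse_unique:
  assumes "B ** A = mat 1"
  shows "cramer_inverse A = B"
proof -
  have "det B * det A = 1" using assms by (metis det_mul det_I)
  then have "det A \<noteq> 0" by auto
  then show ?thesis
    using assms cramer_inverse(1)[of A] by (metis matrix_mul_assoc matrix_mul_lid matrix_mul_rid)
qed

lemma borel_measurable_cramer_inverse [measurable]:
  assumes f [measurable]: "f \<in> borel_measurable M"
  shows "(\<lambda>x. cramer_inverse (f x)) \<in> borel_measurable M"
proof -
  have "continuous_on UNIV (\<lambda>A. \<chi> i j. det (\<chi> k l. if l = i then axis j 1 $ k else (A :: complex^'b^'b) $ k $ l))"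
    by (intro continuous_on_vec_lambda continuous_on_det, rename_tac i j k l, case_tac "l = i")
       (auto intro!: continuous_intros)
  from borel_measurable_continuous_on[OF this f]
  have "(\<lambda>x. \<chi> i j. det (\<chi> k l. if l = i then axis j 1 $ k else f x $ k $ l)) \<in> borel_measurable M" .
  then show ?thesis
    unfolding cramer_inverse_def
    by (rule borel_measurable_continuous_Pair[rotated])
       (auto simp: cscale_def intro!: continuous_intros continuous_on_vec_lambda)
qed

text \<open>The isometric factor in \<open>X = polar_part X ** mat_abs X\<close>, for matrices \<open>X\<close> of full column
  rank.\<close>

definition polar_part :: "complex^'q^'p \<Rightarrow> complex^'q^'p" where
  "polar_part X = X ** cramer_inverse (mat_abs X)"

lemma borel_measurable_polar_part [measurable]:
  "f \<in> borel_measurable M \<Longrightarrow> (\<lambda>x. polar_part (f x)) \<in> borel_measurable M"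
  unfolding polar_part_def by measurable

lemma det_mat_abs: "det (X\<^sup>\<dagger> ** X) \<noteq> 0 \<Longrightarrow> det (mat_abs X) \<noteq> 0"
  by (metis det_mul mat_abs_square mult_zero_left)

lemma polar_part_unitary_left: "u \<in> unitary_matrices \<Longrightarrow> polar_part (u ** X) = u ** polar_part X"
  by (simp add: polar_part_def mat_abs_unitary matrix_mul_assoc)

lemma polar_part_unitary_right:
  assumes u: "u \<in> unitary_matrices" and X: "det (X\<^sup>\<dagger> ** X) \<noteq> 0"
  shows "polar_part (X ** u) = polar_part X ** u"
proof -
  have "mat_abs (X ** u) = u\<^sup>\<dagger> ** mat_abs X ** u"
    unfolding mat_abs_def[of "X ** u"]
  proof (rule psd_sqrt_unique)
    show "pos_semidef (u\<^sup>\<dagger> ** mat_abs X ** u)"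
      by (intro pos_semidef_conj pos_semidef_mat_abs)
    have "(u\<^sup>\<dagger> ** mat_abs X ** u) ** (u\<^sup>\<dagger> ** mat_abs X ** u) = u\<^sup>\<dagger> ** (mat_abs X ** mat_abs X) ** u"
      using u by (simp add: matrix_mul_assoc unitary_cancel)
    then show "(u\<^sup>\<dagger> ** mat_abs X ** u) ** (u\<^sup>\<dagger> ** mat_abs X ** u) = (X ** u)\<^sup>\<dagger> ** (X ** u)"
      by (simp add: mat_abs_square ctranspose_mult matrix_mul_assoc)
  qed
  moreover have "(u\<^sup>\<dagger> ** cramer_inverse (mat_abs X) ** u) ** (u\<^sup>\<dagger> ** mat_abs X ** u) = mat 1"
    using u cramer_inverse(2)[OF det_mat_abs[OF X]]
    by (simp add: matrix_mul_assoc unitary_cancel)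
       (metis matrix_mul_assoc matrix_mul_rid unitaryD(1))
  ultimately have "cramer_inverse (mat_abs (X ** u)) = u\<^sup>\<dagger> ** cramer_inverse (mat_abs X) ** u"
    by (metis cramer_inverse_unique)
  then show ?thesis
    using u by (simp add: polar_part_def matrix_mul_assoc unitary_cancel)
qed

lemma polar_part_representative:
  fixes X E :: "complex^'q^'p"
  assumes E: "E\<^sup>\<dagger> ** E = mat 1" and X: "det (X\<^sup>\<dagger> ** X) \<noteq> 0"
  obtains u where "u \<in> unitary_matrices" "polar_part X = u ** E"
proof -
  obtain u where u: "u \<in> unitary_matrices" "u ** X = E ** mat_abs X"
    using unitary_orbit_representative[OF E] .
  have "polar_part X = u\<^sup>\<dagger> ** (u ** X) ** cramer_inverse (mat_abs X)"
    using u(1) by (simp add: polar_part_def matrix_mul_assoc unitaryD)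
  also have "\<dots> = u\<^sup>\<dagger> ** E ** (mat_abs X ** cramer_inverse (mat_abs X))"
    by (simp add: u(2) matrix_mul_assoc)
  also have "\<dots> = u\<^sup>\<dagger> ** E"
    using cramer_inverse(1)[OF det_mat_abs[OF X]] by simp
  finally show ?thesis
    using u(1) that unitary_ctranspose by blast
qed

definition invertible_ball :: "(complex^'n^'n) set" where
  "invertible_ball = {X. det X \<noteq> 0 \<and> norm X \<le> 1}"

lemma invertible_ball_measurable [measurable]: "invertible_ball \<in> sets borel"
  unfolding invertible_ball_def by measurable

lemma emeasure_singular_matrices: "emeasure lborel {X :: complex^'n^'n. det X = 0} = 0"
proof (rule null_set_by_shifting[where v = "mat 1"])
  show "countable {t. X + t *\<^sub>R mat 1 \<in> {X :: complex^'n^'n. det X = 0}}" for X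
    using finite_singular_shifts[of X] by (simp add: countable_finite)
qed measurable

lemma emeasure_invertible_ball:
  "emeasure lborel (invertible_ball :: (complex^'n^'n) set) \<noteq> 0"
  "emeasure lborel (invertible_ball :: (complex^'n^'n) set) \<noteq> \<infinity>"
proof -
  have "emeasure lborel (cball 0 1 :: (complex^'n^'n) set) \<le>
      emeasure lborel (invertible_ball \<union> {X :: complex^'n^'n. det X = 0})"
    by (rule emeasure_mono) (auto simp: invertible_ball_def)
  also have "\<dots> \<le> emeasure lborel (invertible_ball :: (complex^'n^'n) set) + emeasure lborel {X :: complex^'n^'n. det X = 0}"
    by (rule emeasure_subadditive) measurable
  finally show "emeasure lborel (invertible_ball :: (complex^'n^'n) set) \<noteq> 0"
    using unit_ball_vol_pos[of "real DIM(complex^'n^'n)"]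
    by (auto simp: emeasure_singular_matrices emeasure_cball less_le)
  have "emeasure lborel (invertible_ball :: (complex^'n^'n) set) \<le> emeasure lborel (cball 0 1 :: (complex^'n^'n) set)"
    by (rule emeasure_mono) (auto simp: invertible_ball_def)
  then show "emeasure lborel (invertible_ball :: (complex^'n^'n) set) \<noteq> \<infinity>"
    using emeasure_lborel_cball_finite[of "0 :: complex^'n^'n" 1] by (auto simp: top_unique)
qed

text \<open>The polar part of a uniformly distributed matrix.  Lebesgue measure on the square matrices is
  invariant under unitary multiplication on both sides and the polar part is equivariant, so its
  law is the normalised Haar measure.\<close>

definition haar :: "(complex^'n^'n) measure" where
  "haar = distr (uniform_measure lborel invertible_ball) borel polar_part"

lemma sets_haar [simp, measurable_cong]: "sets haar = sets borel"
  and space_haar [simp]: "space haar = UNIV"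
  by (simp_all add: haar_def)

lemma nn_integral_haar:
  fixes f :: "complex^'n^'n \<Rightarrow> ennreal"
  assumes [measurable]: "f \<in> borel_measurable borel"
  shows "(\<integral>\<^sup>+u. f u \<partial>haar) =
    (\<integral>\<^sup>+X. f (polar_part X) * indicator invertible_ball X \<partial>lborel) / emeasure lborel (invertible_ball :: (complex^'n^'n) set)"
  unfolding haar_def by (simp add: nn_integral_distr nn_integral_uniform_measure)

lemma emeasure_haar_UNIV [simp]: "emeasure (haar :: (complex^'n^'n) measure) UNIV = 1"
  using nn_integral_haar[of "\<lambda>_ :: complex^'n^'n. 1"] emeasure_invertible_ball[where 'n = 'n]
  by (simp add: ennreal_divide_self top.not_eq_extremum)

lemma finite_measure_haar: "finite_measure haar"
  by (rule finite_measureI) simp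

lemma sigma_finite_measure_haar: "sigma_finite_measure haar"
  by (rule finite_measure.axioms(1)[OF finite_measure_haar])

lemma haar_left_invariant:
  fixes f :: "complex^'n^'n \<Rightarrow> ennreal"
  assumes [measurable]: "f \<in> borel_measurable borel" and u: "u \<in> unitary_matrices"
  shows "(\<integral>\<^sup>+v. f (u ** v) \<partial>haar) = (\<integral>\<^sup>+v. f v \<partial>haar)"
proof -
  have "f (u ** polar_part X) * indicator invertible_ball X =
      f (polar_part (u ** X)) * indicator invertible_ball (u ** X)" for X
    using det_unitary[OF u]
    by (auto simp: polar_part_unitary_left[OF u] norm_unitary_left[OF u] det_mul invertible_ball_def
        split: split_indicator)
  then show ?thesis
    using lborel_unitary_left[of "\<lambda>X. f (polar_part X) * indicator invertible_ball X", OF _ u]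
    by (simp add: nn_integral_haar)
qed

lemma haar_right_invariant:
  fixes f :: "complex^'n^'n \<Rightarrow> ennreal"
  assumes [measurable]: "f \<in> borel_measurable borel" and u: "u \<in> unitary_matrices"
  shows "(\<integral>\<^sup>+v. f (v ** u) \<partial>haar) = (\<integral>\<^sup>+v. f v \<partial>haar)"
proof -
  have "f (polar_part X ** u) * indicator invertible_ball X =
      f (polar_part (X ** u)) * indicator invertible_ball (X ** u)" for X
    using det_unitary[OF u] polar_part_unitary_right[OF u, of X]
    by (auto simp: norm_unitary_right[OF u] det_mul det_ctranspose invertible_ball_def
        split: split_indicator)
  then show ?thesis
    using lborel_unitary_right[of "\<lambda>X. f (polar_part X) * indicator invertible_ball X", OF _ u]
    by (simp add: nn_integral_haar)
qed

lemma AE_haar_unitary: "AE u in (haar :: (complex^'n^'n) measure). u \<in> unitary_matrices"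
proof -
  have "emeasure haar (- unitary_matrices :: (complex^'n^'n) set) = 0"
  proof -
    have "polar_part X \<in> unitary_matrices" if X: "det X \<noteq> 0" for X :: "complex^'n^'n"
    proof -
      obtain u where "u \<in> unitary_matrices" "polar_part X = u ** mat 1"
        using polar_part_representative[of "mat 1" X] X by (auto simp: det_mul det_ctranspose)
      then show ?thesis by simp
    qed
    then have "(\<integral>\<^sup>+X. indicator (- unitary_matrices) (polar_part X) * indicator invertible_ball X
          \<partial>(lborel :: (complex^'n^'n) measure)) =
        (\<integral>\<^sup>+X. 0 \<partial>(lborel :: (complex^'n^'n) measure))"
      by (intro nn_integral_cong) (auto simp: invertible_ball_def split: split_indicator)
    then show ?thesis
      using nn_integral_haar[of "indicator (- unitary_matrices :: (complex^'n^'n) set)"]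
      by (simp add: borel_comp)
  qed
  then show ?thesis
    by (intro AE_I[of _ _ "- unitary_matrices"]) (auto simp: borel_comp)
qed

text \<open>Rotating \<open>X\<close> by a Haar distributed unitary matrix does not change Lebesgue measure, and turns
  the polar part into a uniformly distributed isometry that is independent of \<open>X\<^sup>\<dagger> X\<close>.\<close>

lemma polar_integration:
  fixes E :: "complex^'q^'p" and F :: "complex^'q^'p \<Rightarrow> ennreal" and h :: "complex^'q^'q \<Rightarrow> ennreal"
  assumes E: "E\<^sup>\<dagger> ** E = mat 1"
    and [measurable]: "F \<in> borel_measurable borel" "h \<in> borel_measurable borel"
    and h0: "\<And>A. det A = 0 \<Longrightarrow> h A = 0"
  shows "(\<integral>\<^sup>+X. F (polar_part X) * h (X\<^sup>\<dagger> ** X) \<partial>lborel) =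
    (\<integral>\<^sup>+u. F (u ** E) \<partial>haar) * (\<integral>\<^sup>+X. h ((X :: complex^'q^'p)\<^sup>\<dagger> ** X) \<partial>lborel)"
proof -
  interpret pair_sigma_finite "haar :: (complex^'p^'p) measure" "lborel :: (complex^'q^'p) measure"
    by (intro pair_sigma_finite.intro sigma_finite_measure_haar sigma_finite_lborel)
  have rot: "(\<integral>\<^sup>+X. F (polar_part X) * h (X\<^sup>\<dagger> ** X) \<partial>lborel) =
      (\<integral>\<^sup>+X. F (u ** polar_part X) * h (X\<^sup>\<dagger> ** X) \<partial>lborel)" if u: "u \<in> unitary_matrices" for u :: "complex^'p^'p"
    using lborel_unitary_left[of "\<lambda>X. F (polar_part X) * h (X\<^sup>\<dagger> ** X)", OF _ u] u
    by (simp add: polar_part_unitary_left ctranspose_mult matrix_mul_assoc unitary_cancel)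
  have "(\<integral>\<^sup>+X. F (polar_part X) * h (X\<^sup>\<dagger> ** X) \<partial>lborel) =
      (\<integral>\<^sup>+u. (\<integral>\<^sup>+X. F (polar_part X) * h (X\<^sup>\<dagger> ** X) \<partial>lborel) \<partial>(haar :: (complex^'p^'p) measure))"
    by simp
  also have "\<dots> = (\<integral>\<^sup>+u. (\<integral>\<^sup>+X. F (u ** polar_part X) * h (X\<^sup>\<dagger> ** X) \<partial>lborel) \<partial>haar)"
    by (rule nn_integral_cong_AE) (use AE_haar_unitary rot in \<open>auto elim!: eventually_mono\<close>)
  also have "\<dots> = (\<integral>\<^sup>+X. (\<integral>\<^sup>+u. F (u ** polar_part X) * h (X\<^sup>\<dagger> ** X) \<partial>haar) \<partial>lborel)"
    by (rule Fubini'[symmetric]) measurable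
  also have "\<dots> = (\<integral>\<^sup>+X. (\<integral>\<^sup>+u. F (u ** E) \<partial>haar) * h ((X :: complex^'q^'p)\<^sup>\<dagger> ** X) \<partial>lborel)"
  proof (rule nn_integral_cong)
    fix X :: "complex^'q^'p"
    show "(\<integral>\<^sup>+u. F (u ** polar_part X) * h (X\<^sup>\<dagger> ** X) \<partial>haar) = (\<integral>\<^sup>+u. F (u ** E) \<partial>haar) * h (X\<^sup>\<dagger> ** X)"
    proof (cases "det (X\<^sup>\<dagger> ** X) = 0")
      case False
      then obtain v where v: "v \<in> unitary_matrices" "polar_part X = v ** E"
        using polar_part_representative[OF E] by blast
      have "(\<integral>\<^sup>+u. F (u ** polar_part X) \<partial>haar) = (\<integral>\<^sup>+u. F ((u ** v) ** E) \<partial>haar)"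
        by (simp add: v matrix_mul_assoc)
      also have "\<dots> = (\<integral>\<^sup>+u. F (u ** E) \<partial>haar)"
        by (rule haar_right_invariant) (simp_all add: v)
      finally show ?thesis by (simp add: nn_integral_multc)
    qed (simp add: h0)
  qed
  also have "\<dots> = (\<integral>\<^sup>+u. F (u ** E) \<partial>haar) * (\<integral>\<^sup>+X. h ((X :: complex^'q^'p)\<^sup>\<dagger> ** X) \<partial>lborel)"
    by (simp add: nn_integral_cmult)
  finally show ?thesis .
qed

section \<open>Invariant measures on the positive definite cone\<close>

lemma pos_semidef_of_square_root: "pos_semidef B \<Longrightarrow> B ** B = A \<Longrightarrow> pos_semidef A"
  by (metis pos_semidef_gram pos_semidef_hermitian)

text \<open>Outside the cone no positive root exists, so there the description operator in the definition
  yields one and the same matrix.\<close>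

lemma borel_measurable_psd_sqrt [measurable]:
  assumes "f \<in> borel_measurable M"
  shows "(\<lambda>x. psd_sqrt (f x :: complex^'n^'n)) \<in> borel_measurable M"
proof (rule measurable_compose[OF assms])
  define c where "c = (THE B :: complex^'n^'n. False)"
  have "psd_sqrt A = c" if "A \<notin> psd_cone" for A :: "complex^'n^'n"
  proof -
    have "(\<lambda>B. pos_semidef B \<and> B ** B = A) = (\<lambda>B. False)"
      using that pos_semidef_of_square_root by (auto simp: psd_cone_def)
    then show ?thesis unfolding psd_sqrt_def c_def by simp
  qed
  then have *: "psd_sqrt = (\<lambda>A :: complex^'n^'n. if A \<in> psd_cone then psd_sqrt A else c)"
    by auto
  show "(psd_sqrt :: complex^'n^'n \<Rightarrow> _) \<in> borel_measurable borel"
    by (subst *, rule measurable_If_restrict_space_iff[THEN iffD2])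
       (auto intro: borel_measurable_continuous_on_restrict continuous_on_psd_sqrt)
qed

lemma pred_pos_semidef [measurable (raw)]:
  assumes [measurable]: "f \<in> borel_measurable M"
  shows "Measurable.pred M (\<lambda>x. pos_semidef (f x :: complex^'n^'n))"
proof -
  have "Measurable.pred M (\<lambda>x. f x \<in> psd_cone)" by measurable
  then show ?thesis by (simp add: psd_cone_def)
qed

lemma pred_pos_def [measurable (raw)]:
  assumes [measurable]: "f \<in> borel_measurable M"
  shows "Measurable.pred M (\<lambda>x. pos_def (f x :: complex^'n^'n))"
  unfolding pos_def_iff by measurable

lemma pos_def_hermitian: "pos_def A \<Longrightarrow> A\<^sup>\<dagger> = A"
  by (simp add: pos_def_iff pos_semidef_hermitian)

lemma pos_def_det: "pos_def A \<Longrightarrow> det A \<noteq> 0"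
  by (simp add: pos_def_iff)

lemma pos_def_sqrt: "pos_def A \<Longrightarrow> pos_def (psd_sqrt A)"
  by (simp add: pos_def_iff psd_sqrt_pos psd_sqrt_det_nonzero)

lemma pos_def_sqrt_square: "pos_def A \<Longrightarrow> psd_sqrt A ** psd_sqrt A = A"
  by (simp add: pos_def_iff psd_sqrt_square)

lemma pos_def_inverse:
  assumes A: "pos_def A"
  shows "pos_def (cramer_inverse A)"
proof -
  let ?B = "cramer_inverse A"
  note inv = cramer_inverse[OF pos_def_det[OF A]]
  have "?B\<^sup>\<dagger> ** A = mat 1"
    using inv(1) by (metis A ctranspose_mult ctranspose_mat1 pos_def_hermitian)
  then have "?B\<^sup>\<dagger> = ?B" by (metis cramer_inverse_unique)
  then have "?B\<^sup>\<dagger> ** A ** ?B = ?B"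
    using inv by simp
  then have "pos_semidef ?B"
    using A by (metis pos_def_iff pos_semidef_conj)
  moreover have "det ?B \<noteq> 0" using inv(2) by (metis det_I det_mul mult_zero_left zero_neq_one)
  ultimately show ?thesis by (simp add: pos_def_iff)
qed

lemma pos_def_conj_iff:
  assumes g: "det g \<noteq> 0"
  shows "pos_def (g\<^sup>\<dagger> ** A ** g) \<longleftrightarrow> pos_def A"
proof -
  have *: "pos_def (h\<^sup>\<dagger> ** B ** h)" if "det h \<noteq> 0" "pos_def B" for h B :: "complex^'a^'a"
    using that pos_semidef_conj by (auto simp: pos_def_iff det_mul det_ctranspose)
  obtain h where h: "g ** h = mat 1" "h ** g = mat 1"
    using det_nonzero_inverse[OF g] .
  have "h\<^sup>\<dagger> ** (g\<^sup>\<dagger> ** A ** g) ** h = (g ** h)\<^sup>\<dagger> ** A ** (g ** h)"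
    by (simp add: ctranspose_mult matrix_mul_assoc)
  then have "h\<^sup>\<dagger> ** (g\<^sup>\<dagger> ** A ** g) ** h = A" by (simp add: h)
  moreover have "det h \<noteq> 0" using h by (metis det_I det_mul mult_zero_left zero_neq_one)
  ultimately show ?thesis using *[OF g] *[of h "g\<^sup>\<dagger> ** A ** g"] by auto
qed

lemma pos_def_conj_iff':
  assumes k: "pos_def k"
  shows "pos_def (k ** A ** k) \<longleftrightarrow> pos_def A"
  using pos_def_conj_iff[OF pos_def_det[OF k], of A] by (simp add: pos_def_hermitian[OF k])

text \<open>With \<open>g = a b\<close> the two arguments are \<open>g g\<^sup>\<dagger>\<close> and \<open>g\<^sup>\<dagger> g\<close>, which are unitarily conjugate.\<close>

lemma unitarily_invariant_swap:
  assumes f: "\<And>u A. u \<in> unitary_matrices \<Longrightarrow> f (u\<^sup>\<dagger> ** A ** u) = f A"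
    and a: "a\<^sup>\<dagger> = a" and b: "b\<^sup>\<dagger> = b"
  shows "f (a ** (b ** b) ** a) = f (b ** (a ** a) ** b)"
proof -
  obtain u where "u \<in> unitary_matrices" "(a ** b) ** (a ** b)\<^sup>\<dagger> = u\<^sup>\<dagger> ** ((a ** b)\<^sup>\<dagger> ** (a ** b)) ** u"
    using gram_conjugate[of "a ** b"] .
  then show ?thesis
    using f[of u "(a ** b)\<^sup>\<dagger> ** (a ** b)"] by (simp add: ctranspose_mult a b matrix_mul_assoc)
qed

text \<open>The cone of positive definite matrices is acted on by \<open>T \<mapsto> k T k\<close>.  A double integral of \<open>f S\<close>
  and \<open>h T\<close> is transformed by \<open>T \<mapsto> S\<^sup>1\<^sup>/\<^sup>2 T S\<^sup>1\<^sup>/\<^sup>2\<close>, then by \<open>S \<mapsto> T\<^sup>-\<^sup>1\<^sup>/\<^sup>2 S T\<^sup>-\<^sup>1\<^sup>/\<^sup>2\<close> and finally by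
  \<open>T \<mapsto> S\<^sup>-\<^sup>1\<^sup>/\<^sup>2 T S\<^sup>-\<^sup>1\<^sup>/\<^sup>2\<close>.  The outcome is that \<open>f\<close> and \<open>h\<close> have traded places, up to an inversion.\<close>

lemma invariant_exchange:
  fixes T1 :: "'a \<Rightarrow> complex^'q^'q" and T2 :: "'b \<Rightarrow> complex^'q^'q"
  assumes sf: "sigma_finite_measure M1" "sigma_finite_measure M2"
    and [measurable]: "T1 \<in> borel_measurable M1" "T2 \<in> borel_measurable M2"
    and pd: "AE x in M1. pos_def (T1 x)" "AE y in M2. pos_def (T2 y)"
    and inv1: "\<And>f k. f \<in> borel_measurable borel \<Longrightarrow> pos_def k \<Longrightarrow>
      (\<integral>\<^sup>+x. f (k ** T1 x ** k) \<partial>M1) = (\<integral>\<^sup>+x. f (T1 x) \<partial>M1)"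
    and inv2: "\<And>f k. f \<in> borel_measurable borel \<Longrightarrow> pos_def k \<Longrightarrow>
      (\<integral>\<^sup>+x. f (k ** T2 x ** k) \<partial>M2) = (\<integral>\<^sup>+x. f (T2 x) \<partial>M2)"
    and f [measurable]: "f \<in> borel_measurable borel" and fu: "\<And>u A. u \<in> unitary_matrices \<Longrightarrow> f (u\<^sup>\<dagger> ** A ** u) = f A"
    and h [measurable]: "h \<in> borel_measurable borel" and hu: "\<And>u A. u \<in> unitary_matrices \<Longrightarrow> h (u\<^sup>\<dagger> ** A ** u) = h A"
  shows "(\<integral>\<^sup>+x. f (T1 x) \<partial>M1) * (\<integral>\<^sup>+y. h (T2 y) \<partial>M2) =
    (\<integral>\<^sup>+x. h (T1 x) \<partial>M1) * (\<integral>\<^sup>+y. f (cramer_inverse (T2 y)) \<partial>M2)"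
proof -
  interpret pair_sigma_finite M1 M2
    using sf by (rule pair_sigma_finite.intro)
  define r where "r = (psd_sqrt :: complex^'q^'q \<Rightarrow> _)"
  define k where "k S = cramer_inverse (r S)" for S
  have [measurable]: "r \<in> borel_measurable borel" "k \<in> borel_measurable borel"
    unfolding k_def r_def by measurable
  have r: "pos_def (r S)" "(r S)\<^sup>\<dagger> = r S" "r S ** r S = S" if "pos_def S" for S
    using that by (auto simp: r_def pos_def_sqrt pos_def_sqrt_square pos_def_hermitian)
  have k: "pos_def (k S)" "(k S)\<^sup>\<dagger> = k S" "r S ** k S = mat 1" "k S ** r S = mat 1" if "pos_def S" for S
    using r[OF that] by (auto simp: k_def pos_def_inverse pos_def_hermitian cramer_inverse pos_def_det)
  have k2: "k S ** k S = cramer_inverse S" if "pos_def S" for S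
  proof -
    have "(k S ** k S) ** (r S ** r S) = mat 1"
      using k[OF that] by (metis matrix_mul_assoc matrix_mul_lid)
    then show ?thesis using r(3)[OF that] cramer_inverse_unique by metis
  qed
  have inv_kTk: "cramer_inverse (k S ** T ** k S) = r S ** cramer_inverse T ** r S" if "pos_def S" "pos_def T" for S T
  proof (rule cramer_inverse_unique)
    have "(r S ** cramer_inverse T ** r S) ** (k S ** T ** k S) = r S ** cramer_inverse T ** (r S ** k S) ** T ** k S"
      by (simp add: matrix_mul_assoc)
    also have "\<dots> = r S ** (cramer_inverse T ** T) ** k S"
      using k[OF that(1)] by (simp add: matrix_mul_assoc)
    finally show "(r S ** cramer_inverse T ** r S) ** (k S ** T ** k S) = mat 1"
      using k[OF that(1)] cramer_inverse[OF pos_def_det[OF that(2)]] by simp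
  qed
  have "(\<integral>\<^sup>+x. f (T1 x) \<partial>M1) * (\<integral>\<^sup>+y. h (T2 y) \<partial>M2) = (\<integral>\<^sup>+x. f (T1 x) * (\<integral>\<^sup>+y. h (T2 y) \<partial>M2) \<partial>M1)"
    by (simp add: nn_integral_multc)
  also have "\<dots> = (\<integral>\<^sup>+x. (\<integral>\<^sup>+y. f (T1 x) * h (r (T2 y) ** T1 x ** r (T2 y)) \<partial>M2) \<partial>M1)"
  proof (rule nn_integral_cong_AE, use pd(1) in eventually_elim)
    fix x assume x: "pos_def (T1 x)"
    have "(\<integral>\<^sup>+y. h (T2 y) \<partial>M2) = (\<integral>\<^sup>+y. h (r (T1 x) ** T2 y ** r (T1 x)) \<partial>M2)"
      by (rule inv2[symmetric]) (simp_all add: r x)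
    also have "\<dots> = (\<integral>\<^sup>+y. h (r (T2 y) ** T1 x ** r (T2 y)) \<partial>M2)"
    proof (rule nn_integral_cong_AE, use pd(2) in eventually_elim)
      fix y assume y: "pos_def (T2 y)"
      show "h (r (T1 x) ** T2 y ** r (T1 x)) = h (r (T2 y) ** T1 x ** r (T2 y))"
        using unitarily_invariant_swap[of h "r (T1 x)" "r (T2 y)", OF hu] r[OF x] r[OF y] by simp
    qed
    finally show "f (T1 x) * (\<integral>\<^sup>+y. h (T2 y) \<partial>M2) = (\<integral>\<^sup>+y. f (T1 x) * h (r (T2 y) ** T1 x ** r (T2 y)) \<partial>M2)"
      by (simp add: nn_integral_cmult)
  qed
  also have "\<dots> = (\<integral>\<^sup>+y. (\<integral>\<^sup>+x. f (T1 x) * h (r (T2 y) ** T1 x ** r (T2 y)) \<partial>M1) \<partial>M2)"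
    by (rule Fubini'[symmetric]) measurable
  also have "\<dots> = (\<integral>\<^sup>+y. (\<integral>\<^sup>+x. h (T1 x) * f (r (T1 x) ** cramer_inverse (T2 y) ** r (T1 x)) \<partial>M1) \<partial>M2)"
  proof (rule nn_integral_cong_AE, use pd(2) in eventually_elim)
    fix y assume y: "pos_def (T2 y)"
    let ?k = "k (T2 y)" and ?r = "r (T2 y)"
    have rk: "?r ** (?k ** S ** ?k) ** ?r = S" for S
    proof -
      have "?r ** (?k ** S ** ?k) ** ?r = (?r ** ?k) ** S ** (?k ** ?r)" by (simp add: matrix_mul_assoc)
      then show ?thesis using k[OF y] by simp
    qed
    have "(\<integral>\<^sup>+x. f (T1 x) * h (?r ** T1 x ** ?r) \<partial>M1) =
        (\<integral>\<^sup>+x. f (?k ** T1 x ** ?k) * h (?r ** (?k ** T1 x ** ?k) ** ?r) \<partial>M1)"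
      by (rule inv1[symmetric]) (simp_all add: k y)
    also have "\<dots> = (\<integral>\<^sup>+x. h (T1 x) * f (r (T1 x) ** cramer_inverse (T2 y) ** r (T1 x)) \<partial>M1)"
    proof (rule nn_integral_cong_AE, use pd(1) in eventually_elim)
      fix x assume x: "pos_def (T1 x)"
      show "f (?k ** T1 x ** ?k) * h (?r ** (?k ** T1 x ** ?k) ** ?r) =
          h (T1 x) * f (r (T1 x) ** cramer_inverse (T2 y) ** r (T1 x))"
        using unitarily_invariant_swap[of f ?k "r (T1 x)", OF fu] r[OF x] k[OF y]
        by (simp add: rk k2[OF y] mult.commute)
    qed
    finally show "(\<integral>\<^sup>+x. f (T1 x) * h (?r ** T1 x ** ?r) \<partial>M1) =
      (\<integral>\<^sup>+x. h (T1 x) * f (r (T1 x) ** cramer_inverse (T2 y) ** r (T1 x)) \<partial>M1)" .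
  qed
  also have "\<dots> = (\<integral>\<^sup>+x. (\<integral>\<^sup>+y. h (T1 x) * f (r (T1 x) ** cramer_inverse (T2 y) ** r (T1 x)) \<partial>M2) \<partial>M1)"
    by (rule Fubini') measurable
  also have "\<dots> = (\<integral>\<^sup>+x. h (T1 x) * (\<integral>\<^sup>+y. f (cramer_inverse (T2 y)) \<partial>M2) \<partial>M1)"
  proof (rule nn_integral_cong_AE, use pd(1) in eventually_elim)
    fix x assume x: "pos_def (T1 x)"
    have "(\<integral>\<^sup>+y. f (r (T1 x) ** cramer_inverse (T2 y) ** r (T1 x)) \<partial>M2) =
        (\<integral>\<^sup>+y. f (cramer_inverse (k (T1 x) ** T2 y ** k (T1 x))) \<partial>M2)"
      by (rule nn_integral_cong_AE, use pd(2) in eventually_elim) (simp add: inv_kTk x)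
    also have "\<dots> = (\<integral>\<^sup>+y. f (cramer_inverse (T2 y)) \<partial>M2)"
      by (rule inv2) (simp_all add: k x)
    finally show "(\<integral>\<^sup>+y. h (T1 x) * f (r (T1 x) ** cramer_inverse (T2 y) ** r (T1 x)) \<partial>M2) =
        h (T1 x) * (\<integral>\<^sup>+y. f (cramer_inverse (T2 y)) \<partial>M2)"
      by (simp add: nn_integral_cmult)
  qed
  also have "\<dots> = (\<integral>\<^sup>+x. h (T1 x) \<partial>M1) * (\<integral>\<^sup>+y. f (cramer_inverse (T2 y)) \<partial>M2)"
    by (simp add: nn_integral_multc)
  finally show ?thesis .
qed

text \<open>Applied to twice the same measure, the exchange shows that an invariant measure does not change
  under inversion.  So for two measures the exchange becomes proportionality.  Averaging over the
  unitary group removes the restriction to unitarily invariant \<open>f\<close>.\<close>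

lemma invariant_measure_unique:
  fixes T1 :: "'a \<Rightarrow> complex^'q^'q" and T2 :: "'b \<Rightarrow> complex^'q^'q"
  assumes sf: "sigma_finite_measure M1" "sigma_finite_measure M2"
    and [measurable]: "T1 \<in> borel_measurable M1" "T2 \<in> borel_measurable M2"
    and pd: "AE x in M1. pos_def (T1 x)" "AE y in M2. pos_def (T2 y)"
    and inv1: "\<And>f k. f \<in> borel_measurable borel \<Longrightarrow> pos_def k \<Longrightarrow>
      (\<integral>\<^sup>+x. f (k ** T1 x ** k) \<partial>M1) = (\<integral>\<^sup>+x. f (T1 x) \<partial>M1)"
    and inv2: "\<And>f k. f \<in> borel_measurable borel \<Longrightarrow> pos_def k \<Longrightarrow>
      (\<integral>\<^sup>+x. f (k ** T2 x ** k) \<partial>M2) = (\<integral>\<^sup>+x. f (T2 x) \<partial>M2)"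
    and uni1: "\<And>f u. f \<in> borel_measurable borel \<Longrightarrow> u \<in> unitary_matrices \<Longrightarrow>
      (\<integral>\<^sup>+x. f (u\<^sup>\<dagger> ** T1 x ** u) \<partial>M1) = (\<integral>\<^sup>+x. f (T1 x) \<partial>M1)"
    and uni2: "\<And>f u. f \<in> borel_measurable borel \<Longrightarrow> u \<in> unitary_matrices \<Longrightarrow>
      (\<integral>\<^sup>+x. f (u\<^sup>\<dagger> ** T2 x ** u) \<partial>M2) = (\<integral>\<^sup>+x. f (T2 x) \<partial>M2)"
    and h [measurable]: "h \<in> borel_measurable borel" and hu: "\<And>u A. u \<in> unitary_matrices \<Longrightarrow> h (u\<^sup>\<dagger> ** A ** u) = h A"
    and h_int: "(\<integral>\<^sup>+y. h (T2 y) \<partial>M2) \<noteq> 0" "(\<integral>\<^sup>+y. h (T2 y) \<partial>M2) \<noteq> \<infinity>"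
    and f [measurable]: "f \<in> borel_measurable borel"
  shows "(\<integral>\<^sup>+x. f (T1 x) \<partial>M1) * (\<integral>\<^sup>+y. h (T2 y) \<partial>M2) = (\<integral>\<^sup>+x. h (T1 x) \<partial>M1) * (\<integral>\<^sup>+y. f (T2 y) \<partial>M2)"
proof -
  \<comment> \<open>the average of \<open>f\<close> over the conjugations by unitary matrices\<close>
  define g where "g A = (\<integral>\<^sup>+u. f (u\<^sup>\<dagger> ** A ** u) \<partial>haar)" for A :: "complex^'q^'q"
  interpret haar: sigma_finite_measure "haar :: (complex^'q^'q) measure"
    by (rule sigma_finite_measure_haar)
  have g [measurable]: "g \<in> borel_measurable borel"
    unfolding g_def by measurable
  have gu: "g (v\<^sup>\<dagger> ** A ** v) = g A" if v: "v \<in> unitary_matrices" for v A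
    using haar_left_invariant[of "\<lambda>u. f (u\<^sup>\<dagger> ** A ** u)", OF _ v]
    by (simp add: g_def ctranspose_mult matrix_mul_assoc)
  have avg: "(\<integral>\<^sup>+x. g (T x) \<partial>M) = (\<integral>\<^sup>+x. f (T x) \<partial>M)"
    if M: "sigma_finite_measure M" and [measurable]: "T \<in> borel_measurable M"
      and uni: "\<And>f u. f \<in> borel_measurable borel \<Longrightarrow> u \<in> unitary_matrices \<Longrightarrow>
        (\<integral>\<^sup>+x. f (u\<^sup>\<dagger> ** T x ** u) \<partial>M) = (\<integral>\<^sup>+x. f (T x) \<partial>M)"
    for M :: "'c measure" and T :: "'c \<Rightarrow> complex^'q^'q"
  proof -
    interpret pair_sigma_finite M "haar :: (complex^'q^'q) measure"
      using M sigma_finite_measure_haar by (rule pair_sigma_finite.intro)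
    have "(\<integral>\<^sup>+x. g (T x) \<partial>M) = (\<integral>\<^sup>+u. (\<integral>\<^sup>+x. f (u\<^sup>\<dagger> ** T x ** u) \<partial>M) \<partial>haar)"
      unfolding g_def by (rule Fubini'[symmetric]) measurable
    also have "\<dots> = (\<integral>\<^sup>+u. (\<integral>\<^sup>+x. f (T x) \<partial>M) \<partial>(haar :: (complex^'q^'q) measure))"
      by (rule nn_integral_cong_AE) (use AE_haar_unitary uni[OF f] in \<open>auto elim!: eventually_mono\<close>)
    finally show ?thesis by simp
  qed
  have 1: "(\<integral>\<^sup>+x. g (T1 x) \<partial>M1) * (\<integral>\<^sup>+y. h (T2 y) \<partial>M2) =
      (\<integral>\<^sup>+x. h (T1 x) \<partial>M1) * (\<integral>\<^sup>+y. g (cramer_inverse (T2 y)) \<partial>M2)"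
    by (rule invariant_exchange) (simp_all add: sf pd inv1 inv2 gu hu)
  have "(\<integral>\<^sup>+x. g (T2 x) \<partial>M2) * (\<integral>\<^sup>+y. h (T2 y) \<partial>M2) =
      (\<integral>\<^sup>+x. h (T2 x) \<partial>M2) * (\<integral>\<^sup>+y. g (cramer_inverse (T2 y)) \<partial>M2)"
    by (rule invariant_exchange) (simp_all add: sf pd inv2 gu hu)
  then have 2: "(\<integral>\<^sup>+y. g (cramer_inverse (T2 y)) \<partial>M2) = (\<integral>\<^sup>+x. g (T2 x) \<partial>M2)"
    using h_int by (simp add: mult.commute[of _ "\<integral>\<^sup>+y. h (T2 y) \<partial>M2"] ennreal_mult_cancel_left)
  show ?thesis
    using 1 unfolding 2 by (simp add: avg sf uni1 uni2)
qed

section \<open>Truncations of Haar distributed unitary matrices\<close>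

text \<open>The component of \<open>X\<close> orthogonal to the range of an isometric embedding \<open>E\<close>.\<close>

definition off :: "complex^'q^'p \<Rightarrow> complex^'q^'p \<Rightarrow> complex^'q^'p" where
  "off E X = X - E ** (E\<^sup>\<dagger> ** X)"

abbreviation gram :: "complex^'q^'p \<Rightarrow> complex^'q^'q" where
  "gram X \<equiv> X\<^sup>\<dagger> ** X"

lemma borel_measurable_off [measurable]:
  assumes [measurable]: "f \<in> borel_measurable M"
  shows "(\<lambda>x. off E (f x)) \<in> borel_measurable M"
  unfolding off_def by measurable

lemma off_orthogonal: "E\<^sup>\<dagger> ** E = mat 1 \<Longrightarrow> E\<^sup>\<dagger> ** off E X = 0"
  by (simp add: off_def matrix_mult_diff_right matrix_mul_assoc)

lemma off_embed_add: "E\<^sup>\<dagger> ** E = mat 1 \<Longrightarrow> off E (E ** A + off E X) = off E X"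
  by (simp add: off_def matrix_ring_simps matrix_mul_assoc)

lemma off_mult_right: "off E (X ** k) = off E X ** k"
  by (simp add: off_def matrix_ring_simps matrix_mul_assoc)

lemma gram_mult_right: "gram (X ** k) = k\<^sup>\<dagger> ** gram X ** k"
  by (simp add: ctranspose_mult matrix_mul_assoc)

definition unit_ball :: "complex^'q^'q \<Rightarrow> ennreal" where
  "unit_ball A = indicator (cball 0 1) A"

lemma borel_measurable_unit_ball [measurable]: "unit_ball \<in> borel_measurable borel"
  unfolding unit_ball_def[abs_def] by (intro borel_measurable_indicator borel_closed closed_cball)

lemma unit_ball_integral:
  "(\<integral>\<^sup>+A. unit_ball A \<partial>(lborel :: (complex^'q^'q) measure)) \<noteq> 0"
  "(\<integral>\<^sup>+A. unit_ball A \<partial>(lborel :: (complex^'q^'q) measure)) \<noteq> \<infinity>"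
  using unit_ball_vol_pos[of "real DIM(complex^'q^'q)"] emeasure_lborel_cball_finite[of "0 :: complex^'q^'q" 1]
  by (auto simp: emeasure_cball less_le unit_ball_def)

text \<open>Lebesgue measure on the rectangular matrices is a product of Lebesgue measure on the component
  in the range of \<open>E\<close> and of a measure on the component orthogonal to it.  The latter is realised as
  the law of \<open>off E X\<close> when the component of \<open>X\<close> in the range is confined to the unit ball.\<close>

lemma lborel_split:
  fixes E :: "complex^'q^'p"
  assumes E: "E\<^sup>\<dagger> ** E = mat 1" and [measurable]: "F \<in> borel_measurable borel"
  shows "(\<integral>\<^sup>+X. F X \<partial>lborel) * (\<integral>\<^sup>+A. unit_ball A \<partial>(lborel :: (complex^'q^'q) measure)) =
    (\<integral>\<^sup>+X. unit_ball (E\<^sup>\<dagger> ** X) * (\<integral>\<^sup>+A. F (E ** A + off E X) \<partial>lborel) \<partial>lborel)"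
proof -
  have "(\<integral>\<^sup>+X. unit_ball (E\<^sup>\<dagger> ** X) * (\<integral>\<^sup>+A. F (E ** A + off E X) \<partial>lborel) \<partial>lborel) =
    (\<integral>\<^sup>+X. (\<integral>\<^sup>+A. unit_ball (E\<^sup>\<dagger> ** X) * F (X + E ** A) \<partial>lborel) \<partial>lborel)"
  proof (rule nn_integral_cong)
    fix X :: "complex^'q^'p"
    have "(\<integral>\<^sup>+A. F (E ** A + off E X) \<partial>lborel) = (\<integral>\<^sup>+A. F (E ** (A + E\<^sup>\<dagger> ** X) + off E X) \<partial>lborel)"
      by (rule nn_integral_lborel_translate[symmetric]) measurable
    then show "unit_ball (E\<^sup>\<dagger> ** X) * (\<integral>\<^sup>+A. F (E ** A + off E X) \<partial>lborel) =
        (\<integral>\<^sup>+A. unit_ball (E\<^sup>\<dagger> ** X) * F (X + E ** A) \<partial>lborel)"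
      by (subst nn_integral_cmult) (simp_all add: off_def matrix_ring_simps add.commute)
  qed
  also have "\<dots> = (\<integral>\<^sup>+A. (\<integral>\<^sup>+X. unit_ball (E\<^sup>\<dagger> ** X) * F (X + E ** A) \<partial>lborel) \<partial>lborel)"
    by (rule lborel_pair.Fubini'[symmetric]) measurable
  also have "\<dots> = (\<integral>\<^sup>+A. (\<integral>\<^sup>+X. unit_ball (A + (- (E\<^sup>\<dagger> ** X))) * F X \<partial>lborel) \<partial>lborel)"
  proof (rule nn_integral_cong)
    fix A :: "complex^'q^'q"
    have "(\<integral>\<^sup>+X. unit_ball (E\<^sup>\<dagger> ** X) * F (X + E ** A) \<partial>lborel) =
        (\<integral>\<^sup>+X. unit_ball (E\<^sup>\<dagger> ** (X + - (E ** A))) * F ((X + - (E ** A)) + E ** A) \<partial>lborel)"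
      by (rule nn_integral_lborel_translate[symmetric]) measurable
    also have "\<dots> = (\<integral>\<^sup>+X. unit_ball (A + (- (E\<^sup>\<dagger> ** X))) * F X \<partial>lborel)"
      by (simp add: matrix_ring_simps matrix_mul_assoc E)
         (simp add: unit_ball_def indicator_def norm_minus_commute)
    finally show "(\<integral>\<^sup>+X. unit_ball (E\<^sup>\<dagger> ** X) * F (X + E ** A) \<partial>lborel) =
      (\<integral>\<^sup>+X. unit_ball (A + (- (E\<^sup>\<dagger> ** X))) * F X \<partial>lborel)" .
  qed
  also have "\<dots> = (\<integral>\<^sup>+X. (\<integral>\<^sup>+A. unit_ball (A + (- (E\<^sup>\<dagger> ** X))) * F X \<partial>lborel) \<partial>lborel)"
    by (rule lborel_pair.Fubini') measurable
  also have "\<dots> = (\<integral>\<^sup>+X. (\<integral>\<^sup>+A. unit_ball A \<partial>(lborel :: (complex^'q^'q) measure)) * F X \<partial>lborel)"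
    by (subst nn_integral_multc, measurable, subst nn_integral_lborel_translate) simp_all
  also have "\<dots> = (\<integral>\<^sup>+X. F X \<partial>lborel) * (\<integral>\<^sup>+A. unit_ball A \<partial>(lborel :: (complex^'q^'q) measure))"
    by (subst nn_integral_cmult) (simp_all add: mult.commute)
  finally show ?thesis by simp
qed

text \<open>Since the two components are independent, the function by which the component in the range is
  weighted only contributes its integral.\<close>

lemma off_law_factor:
  fixes E :: "complex^'q^'p"
  assumes E: "E\<^sup>\<dagger> ** E = mat 1"
    and [measurable]: "k \<in> borel_measurable borel" "G \<in> borel_measurable borel"
  shows "(\<integral>\<^sup>+X. k (E\<^sup>\<dagger> ** X) * G (off E X) \<partial>lborel) * (\<integral>\<^sup>+A. unit_ball A \<partial>(lborel :: (complex^'q^'q) measure)) =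
    (\<integral>\<^sup>+A. k A \<partial>lborel) * (\<integral>\<^sup>+X. unit_ball (E\<^sup>\<dagger> ** X) * G (off E X) \<partial>lborel)"
proof -
  have in_range: "E\<^sup>\<dagger> ** (E ** A + off E X) = A" for A X
    by (simp add: matrix_mult_add_right matrix_mul_assoc E off_orthogonal[OF E])
  have "(\<integral>\<^sup>+X. k (E\<^sup>\<dagger> ** X) * G (off E X) \<partial>lborel) * (\<integral>\<^sup>+A. unit_ball A \<partial>(lborel :: (complex^'q^'q) measure)) =
      (\<integral>\<^sup>+X. unit_ball (E\<^sup>\<dagger> ** X) * (\<integral>\<^sup>+A. k A * G (off E X) \<partial>lborel) \<partial>lborel)"
    by (subst lborel_split[OF E], measurable) (simp only: in_range off_embed_add[OF E])
  also have "\<dots> = (\<integral>\<^sup>+X. (\<integral>\<^sup>+A. k A \<partial>lborel) * (unit_ball (E\<^sup>\<dagger> ** X) * G (off E X)) \<partial>lborel)"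
    by (simp add: nn_integral_multc mult_ac)
  also have "\<dots> = (\<integral>\<^sup>+A. k A \<partial>lborel) * (\<integral>\<^sup>+X. unit_ball (E\<^sup>\<dagger> ** X) * G (off E X) \<partial>lborel)"
    by (rule nn_integral_cmult) measurable
  finally show ?thesis .
qed

text \<open>The Jacobian of \<open>X \<mapsto> X k\<close> is that of its restriction to the orthogonal component times that of
  its restriction to the component in the range of \<open>E\<close>.  So the exponent is a difference.\<close>

lemma off_law_scaling:
  fixes E :: "complex^'q^'p"
  assumes E: "E\<^sup>\<dagger> ** E = mat 1" and pq: "CARD('q) \<le> CARD('p)"
    and [measurable]: "G \<in> borel_measurable borel" and k: "pos_def k"
  shows "ennreal (cmod (det k) ^ (2 * (CARD('p) - CARD('q)))) * (\<integral>\<^sup>+X. unit_ball (E\<^sup>\<dagger> ** X) * G (off E X ** k) \<partial>lborel) =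
    (\<integral>\<^sup>+X. unit_ball (E\<^sup>\<dagger> ** X) * G (off E X) \<partial>lborel)"
proof -
  let ?U = "\<integral>\<^sup>+A. unit_ball A \<partial>(lborel :: (complex^'q^'q) measure)"
  let ?N = "\<integral>\<^sup>+X. unit_ball (E\<^sup>\<dagger> ** X) * G (off E X) \<partial>lborel"
  let ?Nk = "\<integral>\<^sup>+X. unit_ball (E\<^sup>\<dagger> ** X) * G (off E X ** k) \<partial>lborel"
  define d where "d = cmod (det k)"
  have d: "d > 0" using pos_def_det[OF k] by (simp add: d_def)
  define l where "l = cramer_inverse k"
  have l: "X ** k ** l = X" for X :: "complex^'q^'m"
    using cramer_inverse[OF pos_def_det[OF k]] by (simp add: l_def matrix_mul_assoc[symmetric])
  have 1: "ennreal (d ^ (2 * CARD('p))) * ?Nk = (\<integral>\<^sup>+X. unit_ball (E\<^sup>\<dagger> ** X ** l) * G (off E X) \<partial>lborel)"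
    using lborel_pos_def_right[of "\<lambda>X. unit_ball (E\<^sup>\<dagger> ** X ** l) * G (off E X)", OF _ k]
    by (simp add: d_def off_mult_right matrix_mul_assoc l)
  have 2: "ennreal (d ^ (2 * CARD('q))) * ?U = (\<integral>\<^sup>+A. unit_ball (A ** l) \<partial>(lborel :: (complex^'q^'q) measure))"
    using lborel_pos_def_right[of "\<lambda>A :: complex^'q^'q. unit_ball (A ** l)", OF _ k] by (simp add: d_def l)
  have pow: "ennreal (d ^ (2 * CARD('p))) = ennreal (d ^ (2 * CARD('q))) * ennreal (d ^ (2 * (CARD('p) - CARD('q))))"
  proof -
    have "2 * CARD('p) = 2 * CARD('q) + 2 * (CARD('p) - CARD('q))" using pq by simp
    then have "d ^ (2 * CARD('p)) = d ^ (2 * CARD('q)) * d ^ (2 * (CARD('p) - CARD('q)))"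
      by (metis power_add)
    then show ?thesis using d by (simp only: ennreal_mult zero_le_power less_imp_le)
  qed
  have "ennreal (d ^ (2 * CARD('q))) * ?U * (ennreal (d ^ (2 * (CARD('p) - CARD('q)))) * ?Nk) =
      (ennreal (d ^ (2 * CARD('p))) * ?Nk) * ?U"
    unfolding pow by (simp only: mult_ac)
  also have "\<dots> = (ennreal (d ^ (2 * CARD('q))) * ?U) * ?N"
    unfolding 1 2 by (rule off_law_factor[OF E]) measurable
  finally have eq: "ennreal (d ^ (2 * CARD('q))) * ?U * (ennreal (d ^ (2 * (CARD('p) - CARD('q)))) * ?Nk) =
      (ennreal (d ^ (2 * CARD('q))) * ?U) * ?N" .
  have "ennreal (d ^ (2 * CARD('q))) * ?U \<noteq> 0"
    using unit_ball_integral(1)[where 'q = 'q] d by simp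
  moreover have "ennreal (d ^ (2 * CARD('q))) * ?U \<noteq> \<infinity>"
    using unit_ball_integral(2)[where 'q = 'q] by (auto simp: ennreal_mult_eq_top_iff)
  ultimately show ?thesis
    using eq unfolding ennreal_mult_cancel_left d_def[symmetric] by auto
qed

lemma off_law_unitary:
  fixes E :: "complex^'q^'p"
  assumes [measurable]: "G \<in> borel_measurable borel" and u: "u \<in> unitary_matrices"
  shows "(\<integral>\<^sup>+X. unit_ball (E\<^sup>\<dagger> ** X) * G (off E X ** u) \<partial>lborel) =
    (\<integral>\<^sup>+X. unit_ball (E\<^sup>\<dagger> ** X) * G (off E X) \<partial>lborel)"
proof -
  have "unit_ball (E\<^sup>\<dagger> ** (X ** u)) = unit_ball (E\<^sup>\<dagger> ** X)" for X
    using norm_unitary_right[OF u, of "E\<^sup>\<dagger> ** X"] by (simp add: matrix_mul_assoc unit_ball_def indicator_def)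
  then show ?thesis
    using lborel_unitary_right[of "\<lambda>X. unit_ball (E\<^sup>\<dagger> ** X) * G (off E X)", OF _ u]
    by (simp add: off_mult_right)
qed

lemma gram_det_nonzero:
  fixes Y E' :: "complex^'q^'p"
  assumes "det (E'\<^sup>\<dagger> ** Y) \<noteq> 0"
  shows "det (gram Y) \<noteq> 0"
  unfolding det_nonzero_iff_kernel
proof (intro allI impI)
  fix v assume "gram Y *v v = 0"
  then have "cinner (Y *v v) (Y *v v) = 0"
    by (simp add: cinner_matrix' matrix_vector_mul_assoc) (simp add: cinner_def)
  then have "Y *v v = 0" by (simp add: cinner_self)
  then have "(E'\<^sup>\<dagger> ** Y) *v v = 0" by (simp add: matrix_vector_mul_assoc[symmetric])
  then show "v = 0" using assms by (simp add: det_nonzero_iff_kernel)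
qed

text \<open>Along a line in the direction of the isometry \<open>E'\<close>, full rank is guaranteed by the square matrix
  \<open>E'\<^sup>\<dagger> L X + t\<close>, which is singular for finitely many \<open>t\<close> only.  The hypothesis on \<open>L\<close> covers both
  \<open>X\<close> itself and its component orthogonal to a range that is orthogonal to that of \<open>E'\<close>.\<close>

lemma AE_full_rank:
  fixes E' :: "complex^'q^'p" and L :: "complex^'q^'p \<Rightarrow> complex^'q^'p"
  assumes E': "E'\<^sup>\<dagger> ** E' = mat 1" and L [measurable]: "L \<in> borel_measurable borel"
    and shift: "\<And>X t. L (X + t *\<^sub>R E') = L X + t *\<^sub>R E'"
  shows "AE X in lborel. pos_def (gram (L X))"
proof -
  have "emeasure lborel {X. det (gram (L X)) = 0} = 0"
  proof (rule null_set_by_shifting[where v = E'])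
    fix X
    have "E'\<^sup>\<dagger> ** L (X + t *\<^sub>R E') = E'\<^sup>\<dagger> ** L X + t *\<^sub>R mat 1" for t
      by (simp add: shift matrix_ring_simps E')
    then have sub: "{t. X + t *\<^sub>R E' \<in> {X. det (gram (L X)) = 0}} \<subseteq> {t. det (E'\<^sup>\<dagger> ** L X + t *\<^sub>R mat 1) = 0}"
      using gram_det_nonzero[of E' "L (X + _ *\<^sub>R E')"] by fastforce
    show "countable {t. X + t *\<^sub>R E' \<in> {X. det (gram (L X)) = 0}}"
      by (rule countable_finite finite_subset[OF sub] finite_singular_shifts)+
  qed measurable
  then have "AE X in lborel. det (gram (L X)) \<noteq> 0"
    by (intro AE_I[of _ _ "{X. det (gram (L X)) = 0}"]) auto
  then show ?thesis
    by eventually_elim (simp add: pos_def_iff pos_semidef_gram)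
qed

text \<open>Small Hermitian perturbations of a multiple of the identity are positive definite.  This makes
  the cone carry mass near the origin.\<close>

lemma pos_def_near_identity:
  obtains \<epsilon> where "\<epsilon> > 0" "\<And>A :: complex^'q^'q. A\<^sup>\<dagger> = A \<Longrightarrow> norm (A - mat 1) \<le> \<epsilon> \<Longrightarrow> pos_def A"
proof -
  have "bounded_bilinear (\<lambda>(A :: complex^'q^'q) v. A *v v)"
    unfolding bilinear_conv_bounded_bilinear[symmetric] bilinear_def
    by (auto intro!: linearI simp: matrix_vector_mult_add_rdistrib scaleR_matrix_vector)
  then obtain K where K: "K > 0" "\<And>(A :: complex^'q^'q) v. norm (A *v v) \<le> norm A * norm v * K"
    using bounded_bilinear.pos_bounded by blast
  show ?thesis
  proof
    show "1 / (2 * K) > 0" using K by simp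
    fix A :: "complex^'q^'q"
    assume A: "A\<^sup>\<dagger> = A" and near: "norm (A - mat 1) \<le> 1 / (2 * K)"
    have "Re (cinner v (A *v v)) > 0" if "v \<noteq> 0" for v
    proof -
      have "cinner v (A *v v) = cinner v v + cinner v ((A - mat 1) *v v)"
        by (simp add: matrix_vector_mult_diff_rdistrib cinner_diff_right)
      moreover have "\<bar>Re (cinner v w)\<bar> \<le> norm v * norm w" for w
      proof -
        have "Re (cinner v w) = inner v w"
          by (simp add: cinner_def inner_vec_def inner_complex_def)
        then show ?thesis by (simp add: Cauchy_Schwarz_ineq2)
      qed
      moreover have "norm v * norm ((A - mat 1) *v v) \<le> norm v * (norm v / 2)"
      proof -
        have "norm ((A - mat 1) *v v) \<le> norm (A - mat 1) * (norm v * K)"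
          using K(2)[of "A - mat 1" v] by (simp add: mult.assoc)
        also have "\<dots> \<le> 1 / (2 * K) * (norm v * K)"
          using near K(1) by (intro mult_right_mono) auto
        also have "\<dots> = norm v / 2" using K(1) by simp
        finally show ?thesis by (rule mult_left_mono) simp
      qed
      ultimately have "Re (cinner v (A *v v)) \<ge> (norm v)\<^sup>2 - norm v * (norm v / 2)"
        by (smt (verit) Re_complex_of_real cinner_self plus_complex.sel(1))
      moreover have "(norm v)\<^sup>2 - norm v * (norm v / 2) > 0"
        using that by (simp add: power2_eq_square)
      ultimately show ?thesis by linarith
    qed
    then show "pos_def A"
      using A by (simp add: pos_def_def hermitian_def quad_form_cinner)
  qed
qed

lemma emeasure_pos_def_ball:
  "emeasure lborel {M :: real^'q^'q. pos_def (herm M) \<and> norm (herm M) \<le> r} \<noteq> \<infinity>"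
  "\<exists>r. emeasure lborel {M :: real^'q^'q. pos_def (herm M) \<and> norm (herm M) \<le> r} \<noteq> 0"
proof -
  have "compact (unherm ` cball 0 r :: (real^'q^'q) set)"
    by (metis compact_cball compact_continuous_image linear_unherm linear_continuous_on linear_conv_bounded_linear)
  then have "emeasure lborel (unherm ` cball 0 r :: (real^'q^'q) set) < \<infinity>"
    by (rule emeasure_compact_finite)
  moreover have "emeasure lborel {M :: real^'q^'q. pos_def (herm M) \<and> norm (herm M) \<le> r} \<le>
      emeasure lborel (unherm ` cball 0 r :: (real^'q^'q) set)"
    by (rule emeasure_mono)
       (auto intro!: image_eqI[of _ _ "herm _"] borel_closed compact_imp_closed \<open>compact (unherm ` cball 0 r)\<close>)
  ultimately show "emeasure lborel {M :: real^'q^'q. pos_def (herm M) \<and> norm (herm M) \<le> r} \<noteq> \<infinity>"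
    by (auto simp: top_unique)
  obtain \<epsilon> where \<epsilon>: "\<epsilon> > 0" "\<And>A :: complex^'q^'q. A\<^sup>\<dagger> = A \<Longrightarrow> norm (A - mat 1) \<le> \<epsilon> \<Longrightarrow> pos_def A"
    using pos_def_near_identity by blast
  obtain K where K: "K > 0" "\<And>M :: real^'q^'q. norm (herm M) \<le> norm M * K"
    using bounded_linear.pos_bounded[OF linear_herm[unfolded linear_conv_bounded_linear]] by blast
  let ?M0 = "unherm (mat 1) :: real^'q^'q"
  let ?r = "norm (mat 1 :: complex^'q^'q) + \<epsilon>"
  have near: "norm (herm M - mat 1) \<le> \<epsilon>" if "M \<in> cball ?M0 (\<epsilon> / K)" for M
  proof -
    have "herm M - mat 1 = herm (M - ?M0)"
      by (simp add: linear_diff[OF linear_herm] herm_unherm)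
    then have "norm (herm M - mat 1) \<le> norm (M - ?M0) * K"
      using K(2)[of "M - ?M0"] by simp
    also have "\<dots> \<le> \<epsilon> / K * K"
      using that K(1) by (intro mult_right_mono) (auto simp: dist_norm norm_minus_commute)
    finally show ?thesis using K(1) by simp
  qed
  then have "cball ?M0 (\<epsilon> / K) \<subseteq> {M :: real^'q^'q. pos_def (herm M) \<and> norm (herm M) \<le> ?r}"
  proof (intro subsetI CollectI conjI)
    fix M assume M: "M \<in> cball ?M0 (\<epsilon> / K)"
    show "pos_def (herm M)" by (rule \<epsilon>(2)[OF herm_hermitian near[OF M]])
    show "norm (herm M) \<le> ?r"
      using near[OF M] norm_triangle_sub[of "herm M" "mat 1"] by simp
  qed
  then have "emeasure lborel (cball ?M0 (\<epsilon> / K)) \<le> emeasure lborel {M :: real^'q^'q. pos_def (herm M) \<and> norm (herm M) \<le> ?r}"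
    by (intro emeasure_mono) auto
  moreover have "emeasure lborel (cball ?M0 (\<epsilon> / K)) > 0"
    using unit_ball_vol_pos[of "real DIM(real^'q^'q)"] \<epsilon> K by (simp add: emeasure_cball)
  ultimately show "\<exists>r. emeasure lborel {M :: real^'q^'q. pos_def (herm M) \<and> norm (herm M) \<le> r} \<noteq> 0"
    by (intro exI[of _ ?r]) auto
qed

text \<open>Divided by \<open>det S\<^sup>p\<^sup>-\<^sup>q\<close>, the law of the Gram matrix \<open>S\<close> of the orthogonal component is invariant
  under \<open>S \<mapsto> k S k\<close>, and so is Lebesgue measure on the cone divided by \<open>det S\<^sup>q\<close>.  By uniqueness the
  first law has a density proportional to \<open>det S\<^sup>p\<^sup>-\<^sup>2\<^sup>q\<close>.\<close>

lemma off_gram_law: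
  fixes E E' :: "complex^'q^'p"
  assumes E: "E\<^sup>\<dagger> ** E = mat 1" and E': "E'\<^sup>\<dagger> ** E' = mat 1" and EE': "E\<^sup>\<dagger> ** E' = 0"
    and pq: "2 * CARD('q) \<le> CARD('p)"
  obtains c :: ennreal where "\<And>f. f \<in> borel_measurable borel \<Longrightarrow>
    (\<integral>\<^sup>+X. unit_ball (E\<^sup>\<dagger> ** X) * f (gram (off E X)) \<partial>lborel) =
    c * (\<integral>\<^sup>+M. (if pos_def (herm M) then ennreal (cmod (det (herm M)) ^ (CARD('p) - 2 * CARD('q))) else 0) *
      f (herm M :: complex^'q^'q) \<partial>lborel)"
proof -
  define m where "m = CARD('p) - CARD('q)"
  define w where "w n S = ennreal (inverse (cmod (det S) ^ n))" for n and S :: "complex^'q^'q"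
  have [measurable]: "w n \<in> borel_measurable borel" for n
    unfolding w_def by measurable
  have w_conj: "w n (k ** S ** k) * ennreal (cmod (det k) ^ (2 * n)) = w n S" if k: "pos_def k" for n k S
  proof -
    have "inverse (cmod (det S * (det k)\<^sup>2) ^ n) * cmod (det k) ^ (2 * n) = inverse (cmod (det S) ^ n)"
      using pos_def_det[OF k] by (simp add: norm_mult norm_power power_mult_distrib power_mult[symmetric])
    then show ?thesis
      by (simp add: w_def det_mul ennreal_mult[symmetric] power2_eq_square mult_ac)
  qed
  have w_unitary: "w n (u\<^sup>\<dagger> ** S ** u) = w n S" if "u \<in> unitary_matrices" for n u S
    using that by (simp add: w_def det_mul norm_mult det_ctranspose det_unitary)
  define pd where "pd S = (if pos_def S then 1 else 0 :: ennreal)" for S :: "complex^'q^'q"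
  have [measurable]: "pd \<in> borel_measurable borel"
    unfolding pd_def by measurable
  define T1 where "T1 X = gram (off E X)" for X
  define M1 where "M1 = density lborel (\<lambda>X. unit_ball (E\<^sup>\<dagger> ** X) * w m (T1 X))"
  define M2 where "M2 = density lborel (\<lambda>M. pd (herm M) * w (CARD('q)) (herm M))"
  have [measurable]: "T1 \<in> borel_measurable borel"
    unfolding T1_def by measurable
  have M1: "(\<integral>\<^sup>+X. f (T1 X) \<partial>M1) = (\<integral>\<^sup>+X. unit_ball (E\<^sup>\<dagger> ** X) * (w m (T1 X) * f (T1 X)) \<partial>lborel)"
    if [measurable]: "f \<in> borel_measurable borel" for f
    unfolding M1_def by (subst nn_integral_density) (simp_all add: mult.assoc)
  have M2: "(\<integral>\<^sup>+M. f (herm M) \<partial>M2) = (\<integral>\<^sup>+M. pd (herm M) * (w (CARD('q)) (herm M) * f (herm M)) \<partial>lborel)"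
    if [measurable]: "f \<in> borel_measurable borel" for f
    unfolding M2_def by (subst nn_integral_density) (simp_all add: mult.assoc)
  have AE1: "AE X in lborel. pos_def (T1 X)"
    unfolding T1_def
    by (rule AE_full_rank[OF E']) (simp_all add: off_def matrix_ring_simps EE')
  obtain r where r: "emeasure lborel {M :: real^'q^'q. pos_def (herm M) \<and> norm (herm M) \<le> r} \<noteq> 0"
    using emeasure_pos_def_ball(2) by blast
  \<comment> \<open>the weight \<open>det S\<^sup>q\<close> makes the integral over \<open>M2\<close> a Lebesgue measure, finite and nonzero\<close>
  define h where "h S = (if norm S \<le> r then ennreal (cmod (det S) ^ CARD('q)) else 0)" for S :: "complex^'q^'q"
  have [measurable]: "h \<in> borel_measurable borel"
    unfolding h_def by measurable
  have h2: "(\<integral>\<^sup>+M. h (herm M) \<partial>M2) = emeasure lborel {M :: real^'q^'q. pos_def (herm M) \<and> norm (herm M) \<le> r}"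
  proof -
    have "pd S * (w (CARD('q)) S * h S) = indicator {S. pos_def S \<and> norm S \<le> r} S" for S
      using pos_def_det[of S] by (simp add: pd_def w_def h_def ennreal_mult[symmetric])
    then have "(\<integral>\<^sup>+M. h (herm M) \<partial>M2) = (\<integral>\<^sup>+M. indicator {M. pos_def (herm M) \<and> norm (herm M) \<le> r} M \<partial>(lborel :: (real^'q^'q) measure))"
      by (subst M2, measurable, intro nn_integral_cong) (simp add: indicator_def)
    also have "\<dots> = emeasure lborel {M :: real^'q^'q. pos_def (herm M) \<and> norm (herm M) \<le> r}"
      by (rule nn_integral_indicator) measurable
    finally show ?thesis .
  qed
  define c where "c = (\<integral>\<^sup>+X. h (T1 X) \<partial>M1) / (\<integral>\<^sup>+M. h (herm M) \<partial>M2)"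
  have unique: "(\<integral>\<^sup>+X. f (T1 X) \<partial>M1) * (\<integral>\<^sup>+M. h (herm M) \<partial>M2) = (\<integral>\<^sup>+X. h (T1 X) \<partial>M1) * (\<integral>\<^sup>+M. f (herm M) \<partial>M2)"
    if [measurable]: "f \<in> borel_measurable borel" for f
  proof (rule invariant_measure_unique)
    show "sigma_finite_measure M1" "sigma_finite_measure M2"
      unfolding M1_def M2_def
      by (subst sigma_finite_measure.sigma_finite_iff_density_finite[OF sigma_finite_lborel];
          simp add: unit_ball_def w_def pd_def ennreal_mult_eq_top_iff indicator_def)+
    show "AE X in M1. pos_def (T1 X)"
      unfolding M1_def by (subst AE_density, measurable) (use AE1 in \<open>auto elim!: eventually_mono\<close>)
    show "AE M in M2. pos_def (herm M)"
      unfolding M2_def by (subst AE_density) (auto simp: pd_def)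
    show "(\<integral>\<^sup>+x. f (k ** T1 x ** k) \<partial>M1) = (\<integral>\<^sup>+x. f (T1 x) \<partial>M1)"
      if [measurable]: "f \<in> borel_measurable borel" and k: "pos_def k" for f k
    proof -
      define G where "G Y = w m (gram Y) * f (gram Y)" for Y :: "complex^'q^'p"
      have [measurable]: "G \<in> borel_measurable borel"
        unfolding G_def by measurable
      have Gk: "w m (T1 X) * f (k ** T1 X ** k) = ennreal (cmod (det k) ^ (2 * m)) * G (off E X ** k)" for X
        by (subst w_conj[OF k, symmetric])
           (simp add: G_def T1_def gram_mult_right pos_def_hermitian[OF k] mult_ac)
      have "(\<integral>\<^sup>+x. f (k ** T1 x ** k) \<partial>M1) =
          (\<integral>\<^sup>+X. unit_ball (E\<^sup>\<dagger> ** X) * (ennreal (cmod (det k) ^ (2 * m)) * G (off E X ** k)) \<partial>lborel)"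
        by (subst M1[of "\<lambda>S. f (k ** S ** k)"]) (simp_all add: Gk)
      also have "\<dots> = ennreal (cmod (det k) ^ (2 * m)) * (\<integral>\<^sup>+X. unit_ball (E\<^sup>\<dagger> ** X) * G (off E X ** k) \<partial>lborel)"
        by (subst nn_integral_cmult[symmetric]) (simp_all add: mult_ac)
      also have "\<dots> = (\<integral>\<^sup>+X. unit_ball (E\<^sup>\<dagger> ** X) * G (off E X) \<partial>lborel)"
        unfolding m_def using pq by (intro off_law_scaling[OF E _ _ k]) auto
      also have "\<dots> = (\<integral>\<^sup>+x. f (T1 x) \<partial>M1)"
        by (subst M1) (simp_all add: G_def T1_def)
      finally show ?thesis .
    qed
    show "(\<integral>\<^sup>+x. f (u\<^sup>\<dagger> ** T1 x ** u) \<partial>M1) = (\<integral>\<^sup>+x. f (T1 x) \<partial>M1)"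
      if [measurable]: "f \<in> borel_measurable borel" and u: "u \<in> unitary_matrices" for f u
    proof -
      have "(\<integral>\<^sup>+x. f (u\<^sup>\<dagger> ** T1 x ** u) \<partial>M1) =
          (\<integral>\<^sup>+X. unit_ball (E\<^sup>\<dagger> ** X) * (w m (gram (off E X ** u)) * f (gram (off E X ** u))) \<partial>lborel)"
        by (subst M1[of "\<lambda>S. f (u\<^sup>\<dagger> ** S ** u)"]) (simp_all add: gram_mult_right w_unitary u T1_def)
      also have "\<dots> = (\<integral>\<^sup>+X. unit_ball (E\<^sup>\<dagger> ** X) * (w m (T1 X) * f (T1 X)) \<partial>lborel)"
        unfolding T1_def by (rule off_law_unitary) (simp_all add: u)
      finally show ?thesis by (subst M1) simp_all
    qed
    show "(\<integral>\<^sup>+x. f (k ** herm x ** k) \<partial>M2) = (\<integral>\<^sup>+x. f (herm x) \<partial>M2)"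
      if [measurable]: "f \<in> borel_measurable borel" and k: "pos_def k" for f k
    proof -
      define G where "G S = pd S * (w (CARD('q)) S * f S)" for S :: "complex^'q^'q"
      have [measurable]: "G \<in> borel_measurable borel"
        unfolding G_def by measurable
      have Gk: "pd S * (w (CARD('q)) S * f (k ** S ** k)) = ennreal (cmod (det k) ^ (2 * CARD('q))) * G (k ** S ** k)" for S
        by (subst w_conj[OF k, symmetric])
           (simp add: G_def pd_def pos_def_conj_iff'[OF k] mult_ac)
      have "(\<integral>\<^sup>+x. f (k ** herm x ** k) \<partial>M2) = (\<integral>\<^sup>+M. ennreal (cmod (det k) ^ (2 * CARD('q))) * G (k ** herm M ** k) \<partial>lborel)"
        by (subst M2[of "\<lambda>S. f (k ** S ** k)"]) (simp_all add: Gk)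
      also have "\<dots> = (\<integral>\<^sup>+M. G (herm M) \<partial>lborel)"
        by (subst nn_integral_cmult) (simp_all add: lborel_herm_pos_def k)
      finally show ?thesis by (subst M2) (simp_all add: G_def)
    qed
    show "(\<integral>\<^sup>+x. f (u\<^sup>\<dagger> ** herm x ** u) \<partial>M2) = (\<integral>\<^sup>+x. f (herm x) \<partial>M2)"
      if [measurable]: "f \<in> borel_measurable borel" and u: "u \<in> unitary_matrices" for f u
    proof -
      have det: "det u \<noteq> 0" using det_unitary[OF u] by auto
      have "pd S * (w (CARD('q)) S * f (u\<^sup>\<dagger> ** S ** u)) =
          pd (u\<^sup>\<dagger> ** S ** u) * (w (CARD('q)) (u\<^sup>\<dagger> ** S ** u) * f (u\<^sup>\<dagger> ** S ** u))" for S
        by (simp add: w_unitary[OF u] pd_def pos_def_conj_iff[OF det])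
      then have "(\<integral>\<^sup>+x. f (u\<^sup>\<dagger> ** herm x ** u) \<partial>M2) =
          (\<integral>\<^sup>+M. (\<lambda>S. pd S * (w (CARD('q)) S * f S)) (u\<^sup>\<dagger> ** herm M ** u) \<partial>lborel)"
        by (subst M2[of "\<lambda>S. f (u\<^sup>\<dagger> ** S ** u)"]) simp_all
      also have "\<dots> = (\<integral>\<^sup>+M. (\<lambda>S. pd S * (w (CARD('q)) S * f S)) (herm M) \<partial>lborel)"
        by (rule lborel_herm_unitary) (simp_all add: u)
      finally show ?thesis by (subst M2) simp_all
    qed
    show "h (u\<^sup>\<dagger> ** A ** u) = h A" if "u \<in> unitary_matrices" for u A
      using that by (simp add: h_def norm_unitary_right norm_unitary_left unitary_ctranspose
          det_mul norm_mult det_ctranspose det_unitary)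
    show "(\<integral>\<^sup>+M. h (herm M) \<partial>M2) \<noteq> 0" "(\<integral>\<^sup>+M. h (herm M) \<partial>M2) \<noteq> \<infinity>"
      unfolding h2 using r emeasure_pos_def_ball(1) by auto
  qed (simp_all add: M1_def M2_def)
  show ?thesis
  proof
    fix f :: "complex^'q^'q \<Rightarrow> ennreal" assume [measurable]: "f \<in> borel_measurable borel"
    define F where "F S = ennreal (cmod (det S) ^ m) * f S" for S
    have [measurable]: "F \<in> borel_measurable borel"
      unfolding F_def by measurable
    have cancel: "w m S * F S = f S" if "pos_def S" for S
      using pos_def_det[OF that] by (simp add: w_def F_def mult.assoc[symmetric] ennreal_mult[symmetric])
    have "(\<integral>\<^sup>+X. unit_ball (E\<^sup>\<dagger> ** X) * f (gram (off E X)) \<partial>lborel) = (\<integral>\<^sup>+X. F (T1 X) \<partial>M1)"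
      by (subst M1, measurable, rule nn_integral_cong_AE, use AE1 in eventually_elim)
         (simp add: cancel, simp add: T1_def)
    also have "\<dots> = (\<integral>\<^sup>+X. F (T1 X) \<partial>M1) * (\<integral>\<^sup>+M. h (herm M) \<partial>M2) / (\<integral>\<^sup>+M. h (herm M) \<partial>M2)"
      using r emeasure_pos_def_ball(1)[where 'q = 'q] unfolding h2 by (simp add: mult_divide_eq_ennreal)
    also have "\<dots> = c * (\<integral>\<^sup>+M. F (herm M) \<partial>M2)"
      unfolding c_def by (subst unique) (simp_all add: ennreal_times_divide mult.commute)
    also have "(\<integral>\<^sup>+M. F (herm M) \<partial>M2) = (\<integral>\<^sup>+M. (if pos_def (herm M) then ennreal (cmod (det (herm M)) ^ (CARD('p) - 2 * CARD('q))) else 0) * f (herm M) \<partial>lborel)"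
    proof (subst M2, measurable, rule nn_integral_cong)
      fix M
      have m: "m = CARD('q) + (CARD('p) - 2 * CARD('q))" using pq by (simp add: m_def)
      have "w (CARD('q)) S * F S = ennreal (cmod (det S) ^ (CARD('p) - 2 * CARD('q))) * f S" if "pos_def S" for S
        using pos_def_det[OF that]
        by (simp add: w_def F_def mult.assoc[symmetric] ennreal_mult[symmetric] m power_add)
      then show "pd (herm M) * (w (CARD('q)) (herm M) * F (herm M)) =
          (if pos_def (herm M) then ennreal (cmod (det (herm M)) ^ (CARD('p) - 2 * CARD('q))) else 0) * f (herm M)"
        by (simp add: pd_def)
    qed
    finally show "(\<integral>\<^sup>+X. unit_ball (E\<^sup>\<dagger> ** X) * f (gram (off E X)) \<partial>lborel) =
      c * (\<integral>\<^sup>+M. (if pos_def (herm M) then ennreal (cmod (det (herm M)) ^ (CARD('p) - 2 * CARD('q))) else 0) * f (herm M) \<partial>lborel)" .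
  qed
qed

text \<open>With \<open>n = p - 2 q\<close> this is, up to constant factors, the density at \<open>S\<close> of the Gram matrix of the
  orthogonal component, and for \<open>S = 1 - w\<^sup>\<dagger> w\<close> the density of a truncation at \<open>w\<close>.\<close>

definition cone_weight :: "nat \<Rightarrow> complex^'q^'q \<Rightarrow> ennreal" where
  "cone_weight n S = (if pos_def S then ennreal (cmod (det S) ^ n) else 0)"

lemma borel_measurable_cone_weight [measurable]: "cone_weight n \<in> borel_measurable borel"
  unfolding cone_weight_def[abs_def] by measurable

lemma cone_weight_conj:
  assumes k: "pos_def k"
  shows "cone_weight n (k ** S ** k) = ennreal (cmod (det k) ^ (2 * n)) * cone_weight n S"
proof -
  have "cmod (det (k ** S ** k)) ^ n = cmod (det k) ^ (2 * n) * cmod (det S) ^ n"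
    by (simp add: det_mul norm_mult power_mult_distrib mult_2 power_add)
  then show ?thesis
    by (simp add: cone_weight_def pos_def_conj_iff'[OF k] ennreal_mult)
qed

lemma gram_embed_add_off:
  assumes E: "E\<^sup>\<dagger> ** E = mat 1"
  shows "gram (E ** A + off E X) = gram A + gram (off E X)"
proof -
  note orth = off_orthogonal[OF E, of X]
  have orth': "(off E X)\<^sup>\<dagger> ** E = 0"
    using arg_cong[OF orth, of ctranspose] by (simp add: ctranspose_mult)
  have "gram (E ** A + off E X) =
      A\<^sup>\<dagger> ** (E\<^sup>\<dagger> ** E) ** A + A\<^sup>\<dagger> ** (E\<^sup>\<dagger> ** off E X) + (off E X)\<^sup>\<dagger> ** E ** A + gram (off E X)"
    by (simp add: ctranspose_add ctranspose_mult matrix_mult_add_left matrix_mult_add_right matrix_mul_assoc)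
  then show ?thesis
    by (simp add: E orth orth')
qed

text \<open>Computing the integral of \<open>\<phi> (E\<^sup>\<dagger> polar_part X) h (X\<^sup>\<dagger> X)\<close> in two ways.  On the one hand, polar
  integration yields the law of \<open>E\<^sup>\<dagger> u E\<close>.  On the other hand, write \<open>A\<close> for the component of \<open>X\<close> in the
  range of \<open>E\<close> and \<open>S\<close> for the Gram matrix of its orthogonal component.  Then \<open>X\<^sup>\<dagger> X = A\<^sup>\<dagger> A + S\<close>;
  translating \<open>S\<close> and rescaling \<open>A = w (A\<^sup>\<dagger> A + S)\<^sup>1\<^sup>/\<^sup>2\<close> separates the variables.\<close>

lemma truncation_law_proportional:
  fixes E E' :: "complex^'q^'p"
  assumes E: "E\<^sup>\<dagger> ** E = mat 1" and E': "E'\<^sup>\<dagger> ** E' = mat 1" and EE': "E\<^sup>\<dagger> ** E' = 0"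
    and pq: "2 * CARD('q) \<le> CARD('p)"
  obtains C :: ennreal where "\<And>\<phi>. \<phi> \<in> borel_measurable borel \<Longrightarrow>
    (\<integral>\<^sup>+u. \<phi> (E\<^sup>\<dagger> ** (u ** E)) \<partial>haar) =
    C * (\<integral>\<^sup>+A. cone_weight (CARD('p) - 2 * CARD('q)) (mat 1 - gram A) * \<phi> (A :: complex^'q^'q) \<partial>lborel)"
proof -
  define n where "n = CARD('p) - 2 * CARD('q)"
  \<comment> \<open>\<open>h (X\<^sup>\<dagger> X)\<close> confines \<open>X\<close> to the unit ball, up to a null set\<close>
  define h where "h S = (if pos_def S \<and> Re (trace S) \<le> 1 then 1 else 0 :: ennreal)" for S :: "complex^'q^'q"
  have [measurable]: "h \<in> borel_measurable borel"
    unfolding h_def by measurable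
  define V where "V = (\<integral>\<^sup>+X. h (gram X) \<partial>(lborel :: (complex^'q^'p) measure))"
  have "V = emeasure lborel (cball 0 1 :: (complex^'q^'p) set)"
  proof -
    have full: "AE X in lborel. pos_def (gram (X :: complex^'q^'p))"
      by (rule AE_full_rank[OF E', of "\<lambda>X. X"]) auto
    have "V = (\<integral>\<^sup>+X. indicator (cball 0 1) X \<partial>(lborel :: (complex^'q^'p) measure))"
      unfolding V_def
    proof (rule nn_integral_cong_AE, use full in eventually_elim)
      fix X :: "complex^'q^'p" assume "pos_def (gram X)"
      moreover have "norm X \<le> 1 \<longleftrightarrow> Re (trace (gram X)) \<le> 1"
        using norm_eq_trace[of X] by (metis abs_square_le_1 abs_norm_cancel)
      ultimately show "h (gram X) = indicator (cball 0 1) X"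
        by (simp add: h_def indicator_def)
    qed
    then show ?thesis by simp
  qed
  then have V: "V \<noteq> 0" "V \<noteq> \<infinity>"
    using unit_ball_vol_pos[of "real DIM(complex^'q^'p)"] emeasure_lborel_cball_finite[of "0 :: complex^'q^'p" 1]
    by (auto simp: emeasure_cball less_le)
  define U where "U = (\<integral>\<^sup>+A. unit_ball A \<partial>(lborel :: (complex^'q^'q) measure))"
  have U: "U \<noteq> 0" "U \<noteq> \<infinity>"
    unfolding U_def by (rule unit_ball_integral)+
  obtain c where c: "\<And>f. f \<in> borel_measurable borel \<Longrightarrow>
      (\<integral>\<^sup>+X. unit_ball (E\<^sup>\<dagger> ** X) * f (gram (off E X)) \<partial>lborel) =
      c * (\<integral>\<^sup>+M. cone_weight n (herm M) * f (herm M :: complex^'q^'q) \<partial>lborel)"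
    using off_gram_law[OF E E' EE' pq, folded n_def, folded cone_weight_def] by blast
  define r where "r = (psd_sqrt :: complex^'q^'q \<Rightarrow> _)"
  define k where "k S = cramer_inverse (r S)" for S
  have [measurable]: "r \<in> borel_measurable borel" "k \<in> borel_measurable borel"
    unfolding k_def r_def by measurable
  define K where "K S = h S * ennreal (cmod (det (r S)) ^ (2 * CARD('q))) * ennreal (cmod (det (r S)) ^ (2 * n))" for S
  have [measurable]: "K \<in> borel_measurable borel"
    unfolding K_def by measurable
  define D where "D = c * (\<integral>\<^sup>+M. K (herm M) \<partial>lborel)"
  have main: "(\<integral>\<^sup>+u. \<phi> (E\<^sup>\<dagger> ** (u ** E)) \<partial>haar) * (V * U) =
      D * (\<integral>\<^sup>+A. cone_weight n (mat 1 - gram A) * \<phi> A \<partial>lborel)"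
    if [measurable]: "\<phi> \<in> borel_measurable borel" for \<phi> :: "complex^'q^'q \<Rightarrow> ennreal"
  proof -
    let ?W = "\<integral>\<^sup>+A. cone_weight n (mat 1 - gram A) * \<phi> (A :: complex^'q^'q) \<partial>lborel"
    define F where "F X = \<phi> (E\<^sup>\<dagger> ** polar_part X) * h (gram X)" for X :: "complex^'q^'p"
    have [measurable]: "F \<in> borel_measurable borel"
      unfolding F_def by measurable
    define \<Psi> where "\<Psi> S = (\<integral>\<^sup>+A. \<phi> (A ** k (gram A + S)) * h (gram (A :: complex^'q^'q) + S) \<partial>lborel)" for S
    have [measurable]: "\<Psi> \<in> borel_measurable borel"
      unfolding \<Psi>_def by measurable
    have F_split: "F (E ** A + off E X) = \<phi> (A ** k (gram A + gram (off E X))) * h (gram A + gram (off E X))" for A X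
    proof -
      have "E\<^sup>\<dagger> ** (E ** A + off E X) = A"
        by (simp add: matrix_mult_add_right matrix_mul_assoc E off_orthogonal[OF E])
      then have "E\<^sup>\<dagger> ** polar_part (E ** A + off E X) = A ** k (gram A + gram (off E X))"
        by (simp add: polar_part_def matrix_mul_assoc mat_abs_def gram_embed_add_off[OF E] k_def r_def)
      then show ?thesis by (simp add: F_def gram_embed_add_off[OF E])
    qed
    \<comment> \<open>the substitution \<open>A = w H\<^sup>1\<^sup>/\<^sup>2\<close> for fixed \<open>H\<close>\<close>
    have inner: "(\<integral>\<^sup>+A. cone_weight n (H - gram A) * (\<phi> (A ** k H) * h H) \<partial>lborel) = K H * ?W" for H :: "complex^'q^'q"
    proof (cases "pos_def H")
      case True
      then have r: "pos_def (r H)" "r H ** r H = H" "r H ** k H = mat 1"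
        by (auto simp: r_def k_def pos_def_sqrt pos_def_sqrt_square cramer_inverse pos_def_det)
      have G: "H - gram (A ** r H) = r H ** (mat 1 - gram A) ** r H" for A :: "complex^'q^'q"
        by (simp add: gram_mult_right pos_def_hermitian[OF r(1)] matrix_ring_simps r(2))
      have cancel: "(A ** r H) ** k H = A" for A :: "complex^'q^'q"
        by (simp add: matrix_mul_assoc[symmetric] r(3))
      have "(\<integral>\<^sup>+A. cone_weight n (H - gram A) * (\<phi> (A ** k H) * h H) \<partial>lborel) =
          ennreal (cmod (det (r H)) ^ (2 * CARD('q))) *
          (\<integral>\<^sup>+A. cone_weight n (H - gram (A ** r H)) * (\<phi> ((A ** r H) ** k H) * h H) \<partial>(lborel :: (complex^'q^'q) measure))"
        by (rule lborel_pos_def_right[symmetric]) (measurable, rule r(1))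
      also have "(\<integral>\<^sup>+A. cone_weight n (H - gram (A ** r H)) * (\<phi> ((A ** r H) ** k H) * h H) \<partial>(lborel :: (complex^'q^'q) measure)) =
          (\<integral>\<^sup>+A. (ennreal (cmod (det (r H)) ^ (2 * n)) * h H) * (cone_weight n (mat 1 - gram A) * \<phi> A) \<partial>lborel)"
        by (intro nn_integral_cong)
           (simp only: G cone_weight_conj[OF r(1)] cancel, simp only: mult_ac)
      also have "\<dots> = (ennreal (cmod (det (r H)) ^ (2 * n)) * h H) * ?W"
        by (rule nn_integral_cmult) measurable
      finally show ?thesis by (simp add: K_def mult_ac)
    next
      case False
      then have "h H = 0" by (simp add: h_def)
      then show ?thesis by (simp add: K_def)
    qed
    have "(\<integral>\<^sup>+X. F X \<partial>lborel) = (\<integral>\<^sup>+u. \<phi> (E\<^sup>\<dagger> ** (u ** E)) \<partial>haar) * V"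
      unfolding F_def V_def
      by (rule polar_integration[OF E]) (measurable, auto simp: h_def dest: pos_def_det)
    then have "(\<integral>\<^sup>+u. \<phi> (E\<^sup>\<dagger> ** (u ** E)) \<partial>haar) * (V * U) = (\<integral>\<^sup>+X. F X \<partial>lborel) * U"
      by (simp only: mult.assoc)
    also have "\<dots> = (\<integral>\<^sup>+X. unit_ball (E\<^sup>\<dagger> ** X) * \<Psi> (gram (off E X)) \<partial>lborel)"
      unfolding U_def \<Psi>_def by (subst lborel_split[OF E]) (simp_all add: F_split)
    also have "\<dots> = c * (\<integral>\<^sup>+M. cone_weight n (herm M) * \<Psi> (herm M) \<partial>lborel)"
      by (rule c) measurable
    also have "(\<integral>\<^sup>+M. cone_weight n (herm M) * \<Psi> (herm M) \<partial>lborel) =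
        (\<integral>\<^sup>+M. (\<integral>\<^sup>+A. cone_weight n (herm M) * (\<phi> (A ** k (gram A + herm M)) * h (gram A + herm M)) \<partial>lborel) \<partial>lborel)"
      unfolding \<Psi>_def by (intro nn_integral_cong nn_integral_cmult[symmetric]) measurable
    also have "\<dots> = (\<integral>\<^sup>+A. (\<integral>\<^sup>+M. cone_weight n (herm M) * (\<phi> (A ** k (gram A + herm M)) * h (gram A + herm M)) \<partial>lborel) \<partial>lborel)"
      by (rule lborel_pair.Fubini') measurable
    also have "\<dots> = (\<integral>\<^sup>+A. (\<integral>\<^sup>+M. cone_weight n (herm M - gram A) * (\<phi> (A ** k (herm M)) * h (herm M)) \<partial>lborel) \<partial>lborel)"
    proof (rule nn_integral_cong)
      fix A :: "complex^'q^'q"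
      \<comment> \<open>the translation of \<open>S\<close> to \<open>H = A\<^sup>\<dagger> A + S\<close>\<close>
      have gram: "(- gram A)\<^sup>\<dagger> = - gram A"
        using ctranspose_diff[of 0 "gram A"] by (simp add: ctranspose_mult)
      have "(\<integral>\<^sup>+M. cone_weight n (herm M) * (\<phi> (A ** k (gram A + herm M)) * h (gram A + herm M)) \<partial>lborel) =
          (\<integral>\<^sup>+M. cone_weight n (herm M + - gram A) * (\<phi> (A ** k (gram A + (herm M + - gram A))) * h (gram A + (herm M + - gram A))) \<partial>lborel)"
        by (rule lborel_herm_translate[symmetric, of "\<lambda>S. cone_weight n S * (\<phi> (A ** k (gram A + S)) * h (gram A + S))"])
           (measurable, rule gram)
      then show "(\<integral>\<^sup>+M. cone_weight n (herm M) * (\<phi> (A ** k (gram A + herm M)) * h (gram A + herm M)) \<partial>lborel) =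
          (\<integral>\<^sup>+M. cone_weight n (herm M - gram A) * (\<phi> (A ** k (herm M)) * h (herm M)) \<partial>lborel)"
        by simp
    qed
    also have "\<dots> = (\<integral>\<^sup>+M. (\<integral>\<^sup>+A. cone_weight n (herm M - gram A) * (\<phi> (A ** k (herm M)) * h (herm M)) \<partial>lborel) \<partial>lborel)"
      by (rule lborel_pair.Fubini'[symmetric]) measurable
    also have "\<dots> = (\<integral>\<^sup>+M. K (herm M) * ?W \<partial>lborel)"
      by (simp add: inner)
    also have "\<dots> = (\<integral>\<^sup>+M. K (herm M) \<partial>lborel) * ?W"
      by (rule nn_integral_multc) measurable
    finally show ?thesis by (simp add: D_def mult.assoc)
  qed
  show ?thesis
  proof
    fix \<phi> :: "complex^'q^'q \<Rightarrow> ennreal" assume \<phi>: "\<phi> \<in> borel_measurable borel"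
    have "V * U \<noteq> 0" "V * U \<noteq> top"
      using V U by (auto simp: ennreal_mult_eq_top_iff)
    then have "(\<integral>\<^sup>+u. \<phi> (E\<^sup>\<dagger> ** (u ** E)) \<partial>haar) = (\<integral>\<^sup>+u. \<phi> (E\<^sup>\<dagger> ** (u ** E)) \<partial>haar) * (V * U) / (V * U)"
      by (intro mult_divide_eq_ennreal[symmetric])
    also have "\<dots> = (D / (V * U)) * (\<integral>\<^sup>+A. cone_weight n (mat 1 - gram A) * \<phi> A \<partial>lborel)"
      unfolding main[OF \<phi>] by (simp add: divide_ennreal_def mult_ac)
    finally show "(\<integral>\<^sup>+u. \<phi> (E\<^sup>\<dagger> ** (u ** E)) \<partial>haar) = (D / (V * U)) *
        (\<integral>\<^sup>+A. cone_weight (CARD('p) - 2 * CARD('q)) (mat 1 - gram A) * \<phi> A \<partial>lborel)"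
      by (simp add: n_def)
  qed
qed

text \<open>The constant of proportionality follows by integrating the function 1; it is finite because the
  integral of the density is not 0.\<close>

lemma truncation_law:
  fixes E E' :: "complex^'q^'p" and g :: "complex^'q^'q \<Rightarrow> complex"
  assumes E: "E\<^sup>\<dagger> ** E = mat 1" "E'\<^sup>\<dagger> ** E' = mat 1" "E\<^sup>\<dagger> ** E' = 0"
    and pq: "2 * CARD('q) \<le> CARD('p)"
    and g [measurable]: "g \<in> borel_measurable borel"
  shows "(LINT u|haar. g (E\<^sup>\<dagger> ** (u ** E))) = kappa TYPE('p) TYPE('q) *
    (LINT w:matrix_ball|lborel. g w * det (mat 1 - gram w) ^ (CARD('p) - 2 * CARD('q)))"
proof -
  define n where "n = CARD('p) - 2 * CARD('q)"
  obtain C where C: "\<And>\<phi>. \<phi> \<in> borel_measurable borel \<Longrightarrow> (\<integral>\<^sup>+u. \<phi> (E\<^sup>\<dagger> ** (u ** E)) \<partial>haar) =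
      C * (\<integral>\<^sup>+A. cone_weight n (mat 1 - gram A) * \<phi> (A :: complex^'q^'q) \<partial>lborel)"
    using truncation_law_proportional[OF E pq, folded n_def] by blast
  have one: "1 = C * (\<integral>\<^sup>+A. cone_weight n (mat 1 - gram (A :: complex^'q^'q)) \<partial>lborel)"
    using C[of "\<lambda>_. 1"] by simp
  have "C \<noteq> \<infinity>"
  proof
    assume "C = \<infinity>"
    then show False using one by (auto simp: ennreal_top_mult split: if_splits)
  qed
  define c where "c = enn2real C"
  have c: "C = ennreal c" "c \<ge> 0"
    using \<open>C \<noteq> \<infinity>\<close> by (auto simp: c_def less_top)
  define wt where "wt A = (if A \<in> matrix_ball then c * cmod (det (mat 1 - gram A)) ^ n else 0)" for A :: "complex^'q^'q"
  have ball: "A \<in> matrix_ball \<longleftrightarrow> pos_def (mat 1 - gram A)" for A :: "complex^'q^'q"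
    by (simp add: matrix_ball_def)
  have [measurable]: "wt \<in> borel_measurable borel"
    unfolding wt_def ball by measurable
  have wt: "C * cone_weight n (mat 1 - gram A) = ennreal (wt A)" for A
    using c by (simp add: wt_def ball cone_weight_def ennreal_mult)
  define T where "T u = E\<^sup>\<dagger> ** (u ** E)" for u
  have T [measurable]: "T \<in> borel_measurable haar"
    unfolding T_def by measurable
  have distr: "distr haar borel T = density lborel (\<lambda>A. ennreal (wt A))"
  proof (rule measure_eqI)
    fix B assume "B \<in> sets (distr haar borel T)"
    then have B [measurable]: "B \<in> sets borel" by simp
    have "emeasure (distr haar borel T) B = (\<integral>\<^sup>+u. indicator B (T u) \<partial>haar)"
      by (subst nn_integral_indicator[symmetric], simp, subst nn_integral_distr) simp_all
    also have "\<dots> = C * (\<integral>\<^sup>+A. cone_weight n (mat 1 - gram A) * indicator B A \<partial>lborel)"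
      unfolding T_def by (rule C) measurable
    also have "\<dots> = (\<integral>\<^sup>+A. ennreal (wt A) * indicator B A \<partial>lborel)"
      by (subst nn_integral_cmult[symmetric], measurable) (simp only: mult.assoc[symmetric] wt)
    also have "\<dots> = emeasure (density lborel (\<lambda>A. ennreal (wt A))) B"
      by (rule emeasure_density[symmetric]) measurable
    finally show "emeasure (distr haar borel T) B = emeasure (density lborel (\<lambda>A. ennreal (wt A))) B" .
  qed simp
  have det: "det (mat 1 - gram A) = of_real (cmod (det (mat 1 - gram A)))" if "A \<in> matrix_ball" for A :: "complex^'q^'q"
    using that by (intro pos_semidef_det pos_def_imp_pos_semidef) (simp add: ball)
  have int: "(LINT u|haar. f (T u)) = of_real c * (LINT w:matrix_ball|lborel. f w * det (mat 1 - gram w) ^ n)"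
    if [measurable]: "f \<in> borel_measurable borel" for f :: "complex^'q^'q \<Rightarrow> complex"
  proof -
    have "(LINT u|haar. f (T u)) = (LINT A|density lborel (\<lambda>A. ennreal (wt A)). f A)"
      unfolding distr[symmetric] by (rule integral_distr[symmetric]) measurable
    also have "\<dots> = (LINT A|lborel. wt A *\<^sub>R f A)"
    proof (rule integral_density)
      show "AE A in lborel. 0 \<le> wt A" using c by (simp add: wt_def)
    qed measurable
    also have "\<dots> = (LINT A|lborel. of_real c * (indicator matrix_ball A *\<^sub>R (f A * det (mat 1 - gram A) ^ n)))"
    proof (intro Bochner_Integration.integral_cong refl)
      fix A :: "complex^'q^'q"
      show "wt A *\<^sub>R f A = of_real c * (indicator matrix_ball A *\<^sub>R (f A * det (mat 1 - gram A) ^ n))"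
      proof (cases "A \<in> matrix_ball")
        case True
        then show ?thesis
          by (simp add: wt_def scaleR_conv_of_real det[OF True, symmetric])
      qed (simp add: wt_def)
    qed
    also have "\<dots> = of_real c * (LINT w:matrix_ball|lborel. f w * det (mat 1 - gram w) ^ n)"
      unfolding set_lebesgue_integral_def by (rule integral_mult_right_zero)
    finally show ?thesis .
  qed
  have "(LINT u|(haar :: (complex^'p^'p) measure). (1 :: complex)) = 1"
    by (simp add: measure_def)
  then have "(LINT w:(matrix_ball :: (complex^'q^'q) set)|lborel. det (mat 1 - gram w) ^ n) * of_real c = 1"
    using int[of "\<lambda>_. 1"] by (simp only: mult_1 mult.commute) simp
  then have "kappa TYPE('p) TYPE('q) = of_real c"
    unfolding kappa_def n_def[symmetric] by (rule inverse_unique)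
  then show ?thesis
    using int[OF g] by (simp add: T_def n_def)
qed

section \<open>Jordan decomposition of bounded measures\<close>

definition signed_measure :: "'a measure \<Rightarrow> ('a set \<Rightarrow> real) \<Rightarrow> bool" where
  "signed_measure M \<nu> \<longleftrightarrow> (\<forall>A :: nat \<Rightarrow> 'a set. range A \<subseteq> sets M \<longrightarrow> disjoint_family A \<longrightarrow>
     (\<lambda>i. \<nu> (A i)) sums \<nu> (\<Union>i. A i))"

lemma signed_measureD:
  fixes A :: "nat \<Rightarrow> 'a set"
  shows "signed_measure M \<nu> \<Longrightarrow> range A \<subseteq> sets M \<Longrightarrow> disjoint_family A \<Longrightarrow>
    (\<lambda>i. \<nu> (A i)) sums \<nu> (\<Union>i. A i)"
  unfolding signed_measure_def by blast

lemma signed_measure_uminus: "signed_measure M \<nu> \<Longrightarrow> signed_measure M (\<lambda>A. - \<nu> A)"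
  unfolding signed_measure_def using sums_minus by blast

lemma signed_measure_empty:
  assumes "signed_measure M \<nu>"
  shows "\<nu> {} = 0"
proof -
  have "(\<lambda>i :: nat. \<nu> {}) sums \<nu> {}"
    using signed_measureD[OF assms, of "\<lambda>_. {}"] by (simp add: disjoint_family_on_def)
  then have "(\<lambda>i :: nat. \<nu> {}) \<longlonglongrightarrow> 0"
    by (intro summable_LIMSEQ_zero sums_summable)
  then show ?thesis by (simp add: LIMSEQ_const_iff)
qed

lemma signed_measure_Un:
  assumes \<nu>: "signed_measure M \<nu>" and AB: "A \<in> sets M" "B \<in> sets M" "A \<inter> B = {}"
  shows "\<nu> (A \<union> B) = \<nu> A + \<nu> B"
proof -
  have "disjoint_family (binaryset A B)"
    using AB(3) by (auto simp: disjoint_family_on_def binaryset_def)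
  then have "(\<lambda>i. \<nu> (binaryset A B i)) sums \<nu> (A \<union> B)"
    using signed_measureD[OF \<nu>, of "binaryset A B"] AB by (simp add: range_binaryset_eq UN_binaryset_eq)
  then show ?thesis
    using binaryset_sums[of \<nu> A B] signed_measure_empty[OF \<nu>] sums_unique2 by blast
qed

lemma signed_measure_Diff:
  assumes \<nu>: "signed_measure M \<nu>" and AB: "A \<in> sets M" "B \<in> sets M" "A \<subseteq> B"
  shows "\<nu> (B - A) = \<nu> B - \<nu> A"
proof -
  have "A \<union> (B - A) = B" using AB(3) by blast
  then show ?thesis
    using signed_measure_Un[OF \<nu>, of A "B - A"] AB by auto
qed

text \<open>The positive variation of a signed set function.  The one of \<open>- \<nu>\<close> is the negative variation.\<close>

definition variation :: "'a measure \<Rightarrow> ('a set \<Rightarrow> real) \<Rightarrow> 'a set \<Rightarrow> ennreal" where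
  "variation M \<nu> E = (SUP A\<in>{A \<in> sets M. A \<subseteq> E}. ennreal (\<nu> A))"

lemma variation_upper: "A \<in> sets M \<Longrightarrow> A \<subseteq> E \<Longrightarrow> ennreal (\<nu> A) \<le> variation M \<nu> E"
  unfolding variation_def by (rule SUP_upper) auto

lemma variation_least: "(\<And>A. A \<in> sets M \<Longrightarrow> A \<subseteq> E \<Longrightarrow> ennreal (\<nu> A) \<le> c) \<Longrightarrow> variation M \<nu> E \<le> c"
  unfolding variation_def by (rule SUP_least) auto

lemma variation_mono: "E \<subseteq> F \<Longrightarrow> variation M \<nu> E \<le> variation M \<nu> F"
  by (intro variation_least variation_upper) auto

lemma variation_superadditive:
  assumes \<nu>: "signed_measure M \<nu>" and EF: "E \<inter> F = {}"
  shows "variation M \<nu> E + variation M \<nu> F \<le> variation M \<nu> (E \<union> F)"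
proof -
  have sum: "ennreal (\<nu> A) + ennreal (\<nu> B) \<le> variation M \<nu> (E \<union> F)"
    if A: "A \<in> sets M" "A \<subseteq> E" and B: "B \<in> sets M" "B \<subseteq> F" for A B
  proof -
    have "\<nu> (A \<union> B) = \<nu> A + \<nu> B"
      using A B EF by (intro signed_measure_Un[OF \<nu>]) auto
    moreover have "ennreal (\<nu> A) \<le> variation M \<nu> (E \<union> F)" "ennreal (\<nu> B) \<le> variation M \<nu> (E \<union> F)"
      "ennreal (\<nu> (A \<union> B)) \<le> variation M \<nu> (E \<union> F)"
      using A B by (auto intro!: variation_upper)
    ultimately show ?thesis
      unfolding ennreal_plus_if by metis
  qed
  have ne: "{A \<in> sets M. A \<subseteq> X} \<noteq> {}" for X by auto
  have "variation M \<nu> E + ennreal (\<nu> B) \<le> variation M \<nu> (E \<union> F)" if "B \<in> sets M" "B \<subseteq> F" for B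
    unfolding variation_def[of M \<nu> E]
    by (subst ennreal_SUP_add_left[symmetric, OF ne]) (auto intro!: SUP_least sum that)
  then show ?thesis
    unfolding variation_def[of M \<nu> F]
    by (subst ennreal_SUP_add_right[OF ne]) (auto intro!: SUP_least)
qed

lemma ennreal_le_suminf:
  fixes x :: "nat \<Rightarrow> real"
  assumes "x sums s"
  shows "ennreal s \<le> (\<Sum>i. ennreal (x i))"
proof (rule LIMSEQ_le_const2)
  show "(\<lambda>n. ennreal (\<Sum>i<n. x i)) \<longlonglongrightarrow> ennreal s"
    using assms by (intro tendsto_ennrealI) (simp add: sums_def)
  have "ennreal (\<Sum>i<n. x i) \<le> (\<Sum>i<n. ennreal (x i))" for n
  proof (induction n)
    case (Suc n)
    have "ennreal ((\<Sum>i<n. x i) + x n) \<le> ennreal (\<Sum>i<n. x i) + ennreal (x n)"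
      unfolding ennreal_plus_if by (rule ennreal_leI) auto
    also have "\<dots> \<le> (\<Sum>i<n. ennreal (x i)) + ennreal (x n)"
      using Suc by (rule add_right_mono)
    finally show ?case by simp
  qed simp
  moreover have "(\<Sum>i<n. ennreal (x i)) \<le> (\<Sum>i. ennreal (x i))" for n
    by (rule sum_le_suminf) auto
  ultimately have "ennreal (\<Sum>i<n. x i) \<le> (\<Sum>i. ennreal (x i))" for n
    by (rule order_trans)
  then show "\<exists>N. \<forall>n\<ge>N. ennreal (\<Sum>i<n. x i) \<le> (\<Sum>i. ennreal (x i))"
    by simp
qed

lemma variation_countably_additive:
  assumes \<nu>: "signed_measure M \<nu>"
  shows "countably_additive (sets M) (variation M \<nu>)"
proof (rule countably_additiveI)
  fix A :: "nat \<Rightarrow> 'a set"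
  assume A: "range A \<subseteq> sets M" "disjoint_family A"
  show "(\<Sum>i. variation M \<nu> (A i)) = variation M \<nu> (\<Union>i. A i)"
  proof (rule antisym)
    have "(\<Sum>i<n. variation M \<nu> (A i)) \<le> variation M \<nu> (\<Union>i<n. A i)" for n
    proof (induction n)
      case (Suc n)
      have "A i \<inter> A n = {}" if "i < n" for i
        using A(2) that unfolding disjoint_family_on_def by (metis UNIV_I less_irrefl)
      then have "(\<Union>i<n. A i) \<inter> A n = {}"
        by blast
      from variation_superadditive[OF \<nu> this]
      have "variation M \<nu> (\<Union>i<n. A i) + variation M \<nu> (A n) \<le> variation M \<nu> (\<Union>i<Suc n. A i)"
        by (simp add: lessThan_Suc Un_commute)
      from order_trans[OF add_right_mono[OF Suc] this] show ?case
        by simp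
    qed simp
    moreover have "variation M \<nu> (\<Union>i<n. A i) \<le> variation M \<nu> (\<Union>i. A i)" for n
      by (rule variation_mono) auto
    ultimately show "(\<Sum>i. variation M \<nu> (A i)) \<le> variation M \<nu> (\<Union>i. A i)"
      by (intro suminf_le_const) (auto intro: order_trans)
    show "variation M \<nu> (\<Union>i. A i) \<le> (\<Sum>i. variation M \<nu> (A i))"
    proof (rule variation_least)
      fix B assume B: "B \<in> sets M" "B \<subseteq> (\<Union>i. A i)"
      have "(\<lambda>i. \<nu> (B \<inter> A i)) sums \<nu> (\<Union>i. B \<inter> A i)"
        using A B by (intro signed_measureD[OF \<nu>]) (auto simp: disjoint_family_on_def)
      moreover have "(\<Union>i. B \<inter> A i) = B" using B by blast
      ultimately have "ennreal (\<nu> B) \<le> (\<Sum>i. ennreal (\<nu> (B \<inter> A i)))"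
        using ennreal_le_suminf by fastforce
      also have "\<dots> \<le> (\<Sum>i. variation M \<nu> (A i))"
        using A B by (intro suminf_le variation_upper) auto
      finally show "ennreal (\<nu> B) \<le> (\<Sum>i. variation M \<nu> (A i))" .
    qed
  qed
qed

lemma sets_pos_variation [simp, measurable_cong]: "sets (pos_variation M \<nu>) = sets M"
  and space_pos_variation [simp]: "space (pos_variation M \<nu>) = space M"
  by (simp_all add: pos_variation_def)

lemma emeasure_pos_variation:
  assumes \<nu>: "signed_measure M \<nu>" and E: "E \<in> sets M"
  shows "emeasure (pos_variation M \<nu>) E = variation M \<nu> E"
  unfolding pos_variation_def variation_def[symmetric]
proof (rule emeasure_measure_of_sigma)
  have "variation M \<nu> {} \<le> 0"
    by (rule variation_least) (simp add: signed_measure_empty[OF \<nu>])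
  then show "positive (sets M) (variation M \<nu>)"
    by (simp add: positive_def)
  show "sigma_algebra (space M) (sets M)" by (rule sets.sigma_algebra_axioms)
  show "countably_additive (sets M) (variation M \<nu>)"
    by (rule variation_countably_additive[OF \<nu>])
qed (rule E)

text \<open>If the variation of a set were infinite, the set could be split into a part on which \<open>\<nu>\<close> is at
  least 1 in absolute value and a part of again infinite variation.  Iterating this contradicts the
  convergence in the definition of countable additivity.\<close>

lemma variation_finite:
  assumes \<nu>: "signed_measure M \<nu>"
  shows "variation M \<nu> (space M) \<noteq> \<infinity>"
proof
  assume inf: "variation M \<nu> (space M) = \<infinity>"
  let ?P = "\<lambda>E. E \<in> sets M \<and> variation M \<nu> E = \<infinity>"
  have step: "\<exists>F. ?P F \<and> F \<subseteq> E \<and> 1 \<le> \<bar>\<nu> (E - F)\<bar>" if E: "?P E" for E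
  proof -
    have "ennreal (\<bar>\<nu> E\<bar> + 1) < variation M \<nu> E"
      using E by simp
    then obtain A where A: "A \<in> sets M" "A \<subseteq> E" "ennreal (\<bar>\<nu> E\<bar> + 1) < ennreal (\<nu> A)"
      unfolding variation_def less_SUP_iff by auto
    then have \<nu>A: "\<nu> A > \<bar>\<nu> E\<bar> + 1"
      using ennreal_less_iff[of "\<bar>\<nu> E\<bar> + 1" "\<nu> A"] by simp
    have \<nu>D: "\<nu> (E - A) = \<nu> E - \<nu> A"
      using E A by (intro signed_measure_Diff[OF \<nu>]) auto
    have "variation M \<nu> E = variation M \<nu> A + variation M \<nu> (E - A)"
    proof -
      have "emeasure (pos_variation M \<nu>) A + emeasure (pos_variation M \<nu>) (E - A) =
          emeasure (pos_variation M \<nu>) (A \<union> (E - A))"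
        using E A by (intro plus_emeasure) auto
      moreover have "A \<union> (E - A) = E" using A by blast
      moreover have "E \<in> sets M" "E - A \<in> sets M" using E A by auto
      ultimately show ?thesis
        using emeasure_pos_variation[OF \<nu>, of E] emeasure_pos_variation[OF \<nu>, of "E - A"]
          emeasure_pos_variation[OF \<nu>, of A] A(1) by simp
    qed
    then have "variation M \<nu> A + variation M \<nu> (E - A) = top"
      using E by simp
    then consider "variation M \<nu> A = \<infinity>" | "variation M \<nu> (E - A) = \<infinity>"
      unfolding ennreal_add_eq_top by auto
    then show ?thesis
    proof cases
      case 1
      then show ?thesis using A \<nu>A \<nu>D by (intro exI[of _ A]) auto
    next
      case 2
      have "E - (E - A) = A" using A by blast
      then show ?thesis using 2 A E \<nu>A by (intro exI[of _ "E - A"]) auto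
    qed
  qed
  have "\<exists>F. \<forall>n. ?P (F n) \<and> (F (Suc n) \<subseteq> F n \<and> 1 \<le> \<bar>\<nu> (F n - F (Suc n))\<bar>)"
    by (rule dependent_nat_choice) (use inf step in auto)
  then obtain F where F: "\<And>n. F n \<in> sets M" "\<And>n. F (Suc n) \<subseteq> F n" "\<And>n. 1 \<le> \<bar>\<nu> (F n - F (Suc n))\<bar>"
    by blast
  have dec: "F n \<subseteq> F m" if "m \<le> n" for m n
    using that F(2) by (rule lift_Suc_antimono_le[of F, rotated]) 
  have "disjoint_family (\<lambda>n. F n - F (Suc n))"
    unfolding disjoint_family_on_def
  proof (intro ballI impI)
    fix m n :: nat assume "m \<noteq> n"
    then have "Suc m \<le> n \<or> Suc n \<le> m" by auto
    then show "(F m - F (Suc m)) \<inter> (F n - F (Suc n)) = {}"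
      using dec[of "Suc m" n] dec[of "Suc n" m] by blast
  qed
  then have "(\<lambda>n. \<nu> (F n - F (Suc n))) sums \<nu> (\<Union>n. F n - F (Suc n))"
    using F(1) by (intro signed_measureD[OF \<nu>]) auto
  then have "(\<lambda>n. \<nu> (F n - F (Suc n))) \<longlonglongrightarrow> 0"
    by (intro summable_LIMSEQ_zero sums_summable)
  from LIMSEQ_D[OF this, of 1] obtain n where "\<bar>\<nu> (F n - F (Suc n))\<bar> < 1"
    by auto
  then show False
    using F(3)[of n] by simp
qed

lemma finite_measure_pos_variation: "signed_measure M \<nu> \<Longrightarrow> finite_measure (pos_variation M \<nu>)"
  by (rule finite_measureI) (simp add: emeasure_pos_variation variation_finite[unfolded infinity_ennreal_def])

text \<open>For \<open>A \<subseteq> E\<close>, replacing \<open>\<nu> A\<close> by \<open>\<nu> E + (- \<nu>) (E - A)\<close> bounds the variation of \<open>\<nu>\<close> on \<open>E\<close> by \<open>\<nu> E\<close>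
  plus that of \<open>- \<nu>\<close>; the converse inequality is the same statement for \<open>- \<nu>\<close>.\<close>

lemma jordan_decomposition:
  assumes \<nu>: "signed_measure M \<nu>" and E: "E \<in> sets M"
  shows "\<nu> E = measure (pos_variation M \<nu>) E - measure (pos_variation M (\<lambda>A. - \<nu> A)) E"
proof -
  have half: "measure (pos_variation M \<nu>) E \<le> \<nu> E + measure (pos_variation M (\<lambda>A. - \<nu> A)) E"
    if \<nu>: "signed_measure M \<nu>" for \<nu>
  proof -
    interpret p: finite_measure "pos_variation M \<nu>"
      by (rule finite_measure_pos_variation[OF \<nu>])
    interpret n: finite_measure "pos_variation M (\<lambda>A. - \<nu> A)"
      by (rule finite_measure_pos_variation[OF signed_measure_uminus[OF \<nu>]])
    let ?n = "measure (pos_variation M (\<lambda>A. - \<nu> A)) E"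
    have le: "- \<nu> B \<le> ?n" if "B \<in> sets M" "B \<subseteq> E" for B
      using variation_upper[of B M E "\<lambda>A. - \<nu> A"] that E
      by (simp add: emeasure_pos_variation[OF signed_measure_uminus[OF \<nu>], symmetric] n.emeasure_eq_measure)
    have "variation M \<nu> E \<le> ennreal (\<nu> E + ?n)"
    proof (rule variation_least)
      fix A assume A: "A \<in> sets M" "A \<subseteq> E"
      then have "\<nu> A \<le> \<nu> E + ?n"
        using le[of "E - A"] signed_measure_Diff[OF \<nu> A(1) E A(2)] E by auto
      then show "ennreal (\<nu> A) \<le> ennreal (\<nu> E + ?n)" by (rule ennreal_leI)
    qed
    moreover have "\<nu> E + ?n \<ge> 0" using le[OF E] by simp
    ultimately show ?thesis
      using E by (simp add: emeasure_pos_variation[OF \<nu>, symmetric] p.emeasure_eq_measure)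
  qed
  show ?thesis
    using half[OF \<nu>] half[OF signed_measure_uminus[OF \<nu>]] by simp
qed

definition of_measure :: "'a measure \<Rightarrow> 'a set \<Rightarrow> complex" where
  "of_measure N A = of_real (measure N A)"

lemma signed_measure_measure:
  assumes "finite_measure N" "sets N = sets M"
  shows "signed_measure M (measure N)"
  unfolding signed_measure_def
  using finite_measure.finite_measure_UNION[OF assms(1)] by (simp add: assms(2)[symmetric])

lemma pos_variation_measure:
  assumes N: "finite_measure N" "sets N = sets M"
  shows "pos_variation M (measure N) = N"
proof (rule measure_eqI)
  interpret finite_measure N by fact
  fix E assume "E \<in> sets (pos_variation M (measure N))"
  then have E: "E \<in> sets M" by simp
  have "variation M (measure N) E = ennreal (measure N E)"
    using E by (intro antisym variation_least variation_upper ennreal_leI finite_measure_mono)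
       (auto simp: N(2))
  then show "emeasure (pos_variation M (measure N)) E = emeasure N E"
    using E by (simp add: emeasure_pos_variation signed_measure_measure N emeasure_eq_measure)
qed (simp add: N)

lemma pos_variation_nonpos:
  fixes f :: "'a \<Rightarrow> complex"
  assumes \<nu>: "signed_measure M \<nu>" and neg: "\<And>A. \<nu> A \<le> 0"
  shows "(LINT x|pos_variation M \<nu>. f x) = 0"
proof -
  have "variation M \<nu> (space M) \<le> 0"
    by (rule variation_least) (simp add: ennreal_neg neg)
  then have "emeasure (pos_variation M \<nu>) (space M) = 0"
    by (simp add: emeasure_pos_variation[OF \<nu>])
  then have "AE x in pos_variation M \<nu>. f x = 0"
    by (intro AE_I[of _ _ "space M"]) auto
  then show ?thesis by (rule integral_eq_zero_AE)
qed

lemma cintegral_of_measure: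
  assumes N: "finite_measure N" "sets N = sets M"
  shows "cintegral M (of_measure N) f = (LINT x|N. f x)"
proof -
  have zero: "signed_measure M (\<lambda>_. 0)" by (simp add: signed_measure_def)
  show ?thesis
    unfolding cintegral_def of_measure_def
    using pos_variation_measure[OF N] pos_variation_nonpos[OF zero, of f]
      pos_variation_nonpos[OF signed_measure_uminus[OF signed_measure_measure[OF N]], of f]
    by (simp add: measure_nonneg)
qed

lemma of_measure_bounded:
  assumes N: "finite_measure N" "sets N = sets M"
  shows "of_measure N \<in> bounded_measures M"
  using signed_measure_measure[OF N] N(2)
  by (auto simp: bounded_measures_def signed_measure_def of_measure_def measure_notin_sets sums_of_real_iff)

lemma bounded_measures_signed:
  assumes "\<mu> \<in> bounded_measures M"
  shows "signed_measure M (\<lambda>A. Re (\<mu> A))" "signed_measure M (\<lambda>A. Im (\<mu> A))"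
  using assms by (auto simp: bounded_measures_def signed_measure_def sums_complex_iff)

section \<open>Biinvariant measures and their images in the orbit space\<close>

lemma borel_measurable_fst_comp [measurable (raw)]:
  "f \<in> borel_measurable M \<Longrightarrow> (\<lambda>x. fst (f x :: 'a::second_countable_topology \<times> 'b::second_countable_topology)) \<in> borel_measurable M"
  by (rule borel_measurable_continuous_on) (intro continuous_intros)

lemma borel_measurable_snd_comp [measurable (raw)]:
  "f \<in> borel_measurable M \<Longrightarrow> (\<lambda>x. snd (f x :: 'a::second_countable_topology \<times> 'b::second_countable_topology)) \<in> borel_measurable M"
  by (rule borel_measurable_continuous_on) (intro continuous_intros)

lemma semi_mult_measurable [measurable]:
  assumes [measurable]: "f \<in> borel_measurable M" "g \<in> borel_measurable M"
  shows "(\<lambda>x. semi_mult (f x) (g x)) \<in> borel_measurable M"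
  unfolding semi_mult_def heis_mult_def heis_act_def fst_conv snd_conv
  by (intro borel_measurable_Pair borel_measurable_diff borel_measurable_add) measurable

lemma orbit_proj_measurable [measurable]:
  assumes [measurable]: "f \<in> borel_measurable M"
  shows "(\<lambda>x. orbit_proj (f x)) \<in> borel_measurable M"
  unfolding orbit_proj_def by measurable

lemma semi_carrier_measurable [measurable]: "semi_carrier \<in> sets borel"
  unfolding semi_carrier_def by (intro borel_closed closed_Times closed_unitary closed_UNIV)

lemma orbit_cone_measurable [measurable]: "psd_cone \<times> UNIV \<in> sets borel"
  by (intro borel_closed closed_Times closed_psd_cone closed_UNIV)

lemma space_semi_space [simp]: "space semi_space = semi_carrier"
  and space_orbit_space [simp]: "space orbit_space = psd_cone \<times> UNIV"
  by (simp_all add: semi_space_def orbit_space_def space_restrict_space)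

lemma sets_semi_space_iff: "A \<in> sets semi_space \<longleftrightarrow> A \<in> sets borel \<and> A \<subseteq> semi_carrier"
  and sets_orbit_space_iff: "B \<in> sets orbit_space \<longleftrightarrow> B \<in> sets borel \<and> B \<subseteq> psd_cone \<times> UNIV"
  by (auto simp: semi_space_def orbit_space_def sets_restrict_space_iff)

lemma orbit_proj_in_cone: "orbit_proj g \<in> psd_cone \<times> UNIV"
  by (simp add: orbit_proj_def psd_cone_def pos_semidef_mat_abs)

lemma semi_carrier_mem: "g \<in> semi_carrier \<longleftrightarrow> fst g \<in> unitary_matrices"
  by (cases g) (simp add: semi_carrier_def)

lemma semi_mult_unitary_left:
  "semi_mult (k, (0, 0)) g = (k ** fst g, (k ** fst (snd g), snd (snd g)))"
  by (simp add: semi_mult_def heis_mult_def heis_act_def trace_def)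

lemma semi_mult_unitary_right:
  "semi_mult g (k, (0, 0)) = (fst g ** k, snd g)"
  by (simp add: semi_mult_def heis_mult_def heis_act_def trace_def)

text \<open>The normalised measure on the double coset of \<open>(1, x, a)\<close>: multiplying this element on both
  sides by independent Haar distributed unitary matrices gives \<open>(k, u x, a)\<close>, where \<open>k\<close> and \<open>u\<close> are
  again independent and Haar distributed.\<close>

definition lift_law :: "complex^'q^'p \<Rightarrow> real \<Rightarrow> ('p, 'q) semi measure" where
  "lift_law x a = restrict_space
     (distr (haar \<Otimes>\<^sub>M haar) borel (\<lambda>z. (snd z, (fst z ** x, a)))) semi_carrier"

lemma sets_lift_law [simp]: "sets (lift_law x a) = sets semi_space"
  unfolding lift_law_def semi_space_def by (rule sets_restrict_space_cong) simp

lemma space_lift_law [simp]: "space (lift_law x a) = semi_carrier"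
  using sets_eq_imp_space_eq[OF sets_lift_law] by simp

lemma nn_integral_lift_law:
  fixes x :: "complex^'q^'p"
  assumes [measurable]: "F \<in> borel_measurable borel"
  shows "(\<integral>\<^sup>+g. F g \<partial>lift_law x a) = (\<integral>\<^sup>+u. (\<integral>\<^sup>+k. F (k, (u ** x, a)) \<partial>haar) \<partial>haar)"
proof -
  interpret haar: sigma_finite_measure "haar :: (complex^'p^'p) measure"
    by (rule sigma_finite_measure_haar)
  have [measurable]: "(\<lambda>z. (snd z, (fst z ** x, a))) \<in> borel_measurable (haar \<Otimes>\<^sub>M haar)"
    by measurable
  have "(\<integral>\<^sup>+g. F g \<partial>lift_law x a) =
      (\<integral>\<^sup>+z. F (snd z, (fst z ** x, a)) * indicator semi_carrier (snd z, (fst z ** x, a)) \<partial>(haar \<Otimes>\<^sub>M haar))"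
    unfolding lift_law_def
    by (subst nn_integral_restrict_space, simp, subst nn_integral_distr) simp_all
  also have "\<dots> = (\<integral>\<^sup>+u. (\<integral>\<^sup>+k. F (k, (u ** x, a)) * indicator semi_carrier (k, (u ** x, a)) \<partial>haar) \<partial>haar)"
    by (subst haar.nn_integral_fst[symmetric]) simp_all
  also have "\<dots> = (\<integral>\<^sup>+u. (\<integral>\<^sup>+k. F (k, (u ** x, a)) \<partial>haar) \<partial>haar)"
    by (rule nn_integral_cong, rule nn_integral_cong_AE, use AE_haar_unitary in eventually_elim)
       (simp add: indicator_def semi_carrier_mem)
  finally show ?thesis .
qed

lemma emeasure_lift_law:
  assumes "A \<in> sets semi_space"
  shows "emeasure (lift_law x a) A = (\<integral>\<^sup>+u. (\<integral>\<^sup>+k. indicator A (k, (u ** x, a)) \<partial>haar) \<partial>haar)"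
  using nn_integral_lift_law[of "indicator A" x a] nn_integral_indicator[of A "lift_law x a"] assms
  by (simp add: sets_semi_space_iff borel_measurable_indicator)

lemma finite_lift_law: "finite_measure (lift_law x a)"
proof (rule finite_measureI)
  have "emeasure (lift_law x a) (space (lift_law x a)) = (\<integral>\<^sup>+g. 1 \<partial>lift_law x a)"
    by simp
  also have "\<dots> = 1" by (subst nn_integral_lift_law) simp_all
  finally show "emeasure (lift_law x a) (space (lift_law x a)) \<noteq> \<infinity>" by simp
qed

text \<open>Translations by unitary elements permute the measurable subsets of the group.\<close>

lemma unitary_translate_image:
  fixes A :: "('p::finite, 'q::finite) semi set"
  assumes k: "k \<in> unitary_matrices" and A: "A \<subseteq> semi_carrier"
  shows "(\<lambda>g. semi_mult (k, (0, 0)) g) ` A = {g \<in> semi_carrier. semi_mult (k\<^sup>\<dagger>, (0, 0)) g \<in> A}"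
    and "(\<lambda>g. semi_mult g (k, (0, 0))) ` A = {g \<in> semi_carrier. semi_mult g (k\<^sup>\<dagger>, (0, 0)) \<in> A}"
proof -
  have cancel: "semi_mult (k\<^sup>\<dagger>, (0, 0)) (semi_mult (k, (0, 0)) g) = g" "semi_mult (k, (0, 0)) (semi_mult (k\<^sup>\<dagger>, (0, 0)) g) = g"
    "semi_mult (semi_mult g (k, (0, 0))) (k\<^sup>\<dagger>, (0, 0)) = g" "semi_mult (semi_mult g (k\<^sup>\<dagger>, (0, 0))) (k, (0, 0)) = g"
    for g :: "('p, 'q) semi"
    by (simp_all add: semi_mult_unitary_left semi_mult_unitary_right unitary_cancel[OF k])
  have carrier: "semi_mult (k, (0, 0)) g \<in> semi_carrier" "semi_mult g (k, (0, 0)) \<in> semi_carrier"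
    if "g \<in> A" for g
    using that A k by (auto simp: semi_mult_unitary_left semi_mult_unitary_right semi_carrier_mem unitary_mult)
  show "(\<lambda>g. semi_mult (k, (0, 0)) g) ` A = {g \<in> semi_carrier. semi_mult (k\<^sup>\<dagger>, (0, 0)) g \<in> A}"
    using carrier(1) by (auto simp: cancel image_iff intro!: bexI[of _ "semi_mult (k\<^sup>\<dagger>, (0, 0)) _"])
  show "(\<lambda>g. semi_mult g (k, (0, 0))) ` A = {g \<in> semi_carrier. semi_mult g (k\<^sup>\<dagger>, (0, 0)) \<in> A}"
    using carrier(2) by (auto simp: cancel image_iff intro!: bexI[of _ "semi_mult _ (k\<^sup>\<dagger>, (0, 0))"])
qed

lemma unitary_translate_sets:
  fixes A :: "('p::finite, 'q::finite) semi set"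
  assumes k: "k \<in> unitary_matrices" and A: "A \<in> sets semi_space"
  shows "(\<lambda>g. semi_mult (k, (0, 0)) g) ` A \<in> sets semi_space"
    and "(\<lambda>g. semi_mult g (k, (0, 0))) ` A \<in> sets semi_space"
proof -
  have [measurable]: "A \<in> sets borel" and sub: "A \<subseteq> semi_carrier"
    using A by (auto simp: sets_semi_space_iff)
  show "(\<lambda>g. semi_mult (k, (0, 0)) g) ` A \<in> sets semi_space" "(\<lambda>g. semi_mult g (k, (0, 0))) ` A \<in> sets semi_space"
    unfolding unitary_translate_image[OF k sub] sets_semi_space_iff by auto
qed

lemma lift_law_biinvariant:
  fixes x :: "complex^'q^'p"
  shows "of_measure (lift_law x a) \<in> biinvariant_measures"
  unfolding biinvariant_measures_def
proof (intro CollectI conjI ballI)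
  show "of_measure (lift_law x a) \<in> bounded_measures semi_space"
    by (intro of_measure_bounded finite_lift_law sets_lift_law)
  fix A :: "('p, 'q) semi set"
  fix k' :: "('p, 'q) semi"
  assume "k' \<in> unitary_subgroup" and A: "A \<in> sets semi_space"
  then obtain k where k': "k' = (k, (0, 0))" and k: "k \<in> unitary_matrices"
    by (auto simp: unitary_subgroup_def)
  have [measurable]: "A \<in> sets borel" and sub: "A \<subseteq> semi_carrier"
    using A by (auto simp: sets_semi_space_iff)
  note k'' = unitary_ctranspose[OF k]
  have mem: "(\<lambda>g. semi_mult k' g) ` A \<in> sets semi_space" "(\<lambda>g. semi_mult g k') ` A \<in> sets semi_space"
    unfolding k' by (rule unitary_translate_sets[OF k A])+
  interpret haar: sigma_finite_measure "haar :: (complex^'p^'p) measure"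
    by (rule sigma_finite_measure_haar)
  have "emeasure (lift_law x a) ((\<lambda>g. semi_mult k' g) ` A) =
      (\<integral>\<^sup>+u. (\<integral>\<^sup>+l. indicator A (k\<^sup>\<dagger> ** l, (k\<^sup>\<dagger> ** u ** x, a)) \<partial>haar) \<partial>haar)"
    unfolding emeasure_lift_law[OF mem(1)] unfolding k' unitary_translate_image[OF k sub]
    by (rule nn_integral_cong, rule nn_integral_cong_AE, use AE_haar_unitary in eventually_elim)
       (simp add: indicator_def semi_carrier_mem semi_mult_unitary_left matrix_mul_assoc)
  also have "\<dots> = (\<integral>\<^sup>+u. (\<integral>\<^sup>+l. indicator A (l, (k\<^sup>\<dagger> ** u ** x, a)) \<partial>haar) \<partial>haar)"
    by (intro nn_integral_cong haar_left_invariant[OF _ k'']) measurable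
  also have "\<dots> = (\<integral>\<^sup>+u. (\<integral>\<^sup>+l. indicator A (l, (u ** x, a)) \<partial>haar) \<partial>haar)"
    by (rule haar_left_invariant[OF _ k'', of "\<lambda>u. \<integral>\<^sup>+l. indicator A (l, (u ** x, a)) \<partial>haar"]) measurable
  finally have 1: "emeasure (lift_law x a) ((\<lambda>g. semi_mult k' g) ` A) = emeasure (lift_law x a) A"
    by (simp add: emeasure_lift_law[OF A])
  have "emeasure (lift_law x a) ((\<lambda>g. semi_mult g k') ` A) =
      (\<integral>\<^sup>+u. (\<integral>\<^sup>+l. indicator A (l ** k\<^sup>\<dagger>, (u ** x, a)) \<partial>haar) \<partial>haar)"
    unfolding emeasure_lift_law[OF mem(2)] unfolding k' unitary_translate_image[OF k sub]
    by (rule nn_integral_cong, rule nn_integral_cong_AE, use AE_haar_unitary in eventually_elim)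
       (simp add: indicator_def semi_carrier_mem semi_mult_unitary_right)
  also have "\<dots> = (\<integral>\<^sup>+u. (\<integral>\<^sup>+l. indicator A (l, (u ** x, a)) \<partial>haar) \<partial>haar)"
    by (intro nn_integral_cong haar_right_invariant[OF _ k'']) measurable
  finally have 2: "emeasure (lift_law x a) ((\<lambda>g. semi_mult g k') ` A) = emeasure (lift_law x a) A"
    by (simp add: emeasure_lift_law[OF A])
  show "of_measure (lift_law x a) ((\<lambda>g. semi_mult k' g) ` A) = of_measure (lift_law x a) A"
    "of_measure (lift_law x a) ((\<lambda>g. semi_mult g k') ` A) = of_measure (lift_law x a) A"
    using 1 2 by (simp_all add: of_measure_def measure_def)
qed

lemma orbit_proj_measurable_semi: "orbit_proj \<in> semi_space \<rightarrow>\<^sub>M orbit_space"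
  unfolding semi_space_def orbit_space_def
  by (intro measurable_restrict_space1 measurable_restrict_space2) (auto simp: orbit_proj_in_cone)

lemma proj_measure_of_measure:
  assumes N: "finite_measure N" "sets N = sets semi_space"
  shows "proj_measure (of_measure N) = of_measure (distr N orbit_space orbit_proj)"
proof
  fix B
  have [measurable]: "orbit_proj \<in> N \<rightarrow>\<^sub>M orbit_space"
    using orbit_proj_measurable_semi measurable_cong_sets[OF N(2) refl] by blast
  show "proj_measure (of_measure N) B = of_measure (distr N orbit_space orbit_proj) B"
    using sets_eq_imp_space_eq[OF N(2)]
    by (auto simp: proj_measure_def image_measure_def of_measure_def measure_distr measure_notin_sets)
qed

lemma proj_measure_lift_law:
  fixes E :: "complex^'q^'p"
  assumes E: "E\<^sup>\<dagger> ** E = mat 1" and r: "r \<in> psd_cone"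
  shows "proj_measure (of_measure (lift_law (E ** r) a)) = point_measure_at orbit_space (r, a)"
proof
  fix B
  have [measurable]: "orbit_proj \<in> lift_law (E ** r) a \<rightarrow>\<^sub>M orbit_space"
    using orbit_proj_measurable_semi measurable_cong_sets[OF sets_lift_law refl] by blast
  have "emeasure (distr (lift_law (E ** r) a) orbit_space orbit_proj) B = indicator B (r, a)"
    if B: "B \<in> sets orbit_space"
  proof -
    have [measurable]: "B \<in> sets borel" using B by (simp add: sets_orbit_space_iff)
    have "emeasure (distr (lift_law (E ** r) a) orbit_space orbit_proj) B =
        (\<integral>\<^sup>+g. indicator B (orbit_proj g) \<partial>lift_law (E ** r) a)"
      using B by (subst nn_integral_indicator[symmetric], simp, subst nn_integral_distr) simp_all
    also have "\<dots> = (\<integral>\<^sup>+u. (\<integral>\<^sup>+k. indicator B (mat_abs (u ** (E ** r)), a) \<partial>(haar :: (complex^'p^'p) measure)) \<partial>(haar :: (complex^'p^'p) measure))"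
      by (subst nn_integral_lift_law, measurable) (simp add: orbit_proj_def)
    also have "\<dots> = (\<integral>\<^sup>+u. indicator B (r, a) \<partial>(haar :: (complex^'p^'p) measure))"
      by (rule nn_integral_cong_AE, use AE_haar_unitary in eventually_elim)
         (use r in \<open>simp add: mat_abs_unitary mat_abs_embed[OF E] psd_cone_def\<close>)
    finally show ?thesis by simp
  qed
  then show "proj_measure (of_measure (lift_law (E ** r) a)) B = point_measure_at orbit_space (r, a) B"
    unfolding proj_measure_of_measure[OF finite_lift_law sets_lift_law]
    by (cases "B \<in> sets orbit_space")
       (auto simp: of_measure_def point_measure_at_def measure_def emeasure_notin_sets indicator_def)
qed

subsection \<open>A biinvariant measure is determined by its image\<close>

text \<open>Averaging an integral over the translations by the compact group on both sides, with respect to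
  Haar measure, replaces the integrand by a function of the orbit.\<close>

lemma biinvariant_integral:
  fixes p :: "('p::finite, 'q::finite) semi measure" and E :: "complex^'q^'p"
  assumes E: "E\<^sup>\<dagger> ** E = mat 1"
    and p: "finite_measure p" and sets_p [simp, measurable_cong]: "sets p = sets borel"
    and carrier: "AE g in p. g \<in> semi_carrier"
    and left: "\<And>F k. F \<in> borel_measurable borel \<Longrightarrow> k \<in> unitary_matrices \<Longrightarrow>
      (\<integral>\<^sup>+g. F (semi_mult (k, (0, 0)) g) \<partial>p) = (\<integral>\<^sup>+g. F g \<partial>p)"
    and right: "\<And>F k. F \<in> borel_measurable borel \<Longrightarrow> k \<in> unitary_matrices \<Longrightarrow>
      (\<integral>\<^sup>+g. F (semi_mult g (k, (0, 0))) \<partial>p) = (\<integral>\<^sup>+g. F g \<partial>p)"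
    and F [measurable]: "F \<in> borel_measurable borel"
  shows "(\<integral>\<^sup>+g. F g \<partial>p) = (\<integral>\<^sup>+g. (\<integral>\<^sup>+h. F h \<partial>lift_law (E ** fst (orbit_proj g)) (snd (orbit_proj g))) \<partial>p)"
proof -
  interpret p: sigma_finite_measure p
    using p by (rule finite_measure.axioms(1))
  interpret haar: sigma_finite_measure "haar :: (complex^'p^'p) measure"
    by (rule sigma_finite_measure_haar)
  interpret hp: pair_sigma_finite "haar :: (complex^'p^'p) measure" p ..
  let ?act = "\<lambda>k l g. (k ** fst g ** l, (k ** fst (snd g), snd (snd g)))"
  \<comment> \<open>the action of \<open>(k, l)\<close> is left multiplication by \<open>k\<close> and right multiplication by \<open>l\<close>\<close>
  have act: "(\<integral>\<^sup>+g. F (?act k l g) \<partial>p) = (\<integral>\<^sup>+g. F g \<partial>p)"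
    if k: "k \<in> unitary_matrices" and l: "l \<in> unitary_matrices" for k l
    using left[of "\<lambda>g. F (semi_mult g (l, (0, 0)))", OF _ k] right[OF F l]
    by (simp add: semi_mult_unitary_left semi_mult_unitary_right)
  have "(\<integral>\<^sup>+g. F g \<partial>p) = (\<integral>\<^sup>+k. (\<integral>\<^sup>+l. (\<integral>\<^sup>+g. F g \<partial>p) \<partial>(haar :: (complex^'p^'p) measure)) \<partial>(haar :: (complex^'p^'p) measure))"
    by simp
  also have "\<dots> = (\<integral>\<^sup>+k. (\<integral>\<^sup>+l. (\<integral>\<^sup>+g. F (?act k l g) \<partial>p) \<partial>haar) \<partial>haar)"
    by (intro nn_integral_cong_AE, use AE_haar_unitary in eventually_elim,
        intro nn_integral_cong_AE, use AE_haar_unitary in eventually_elim) (simp add: act)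
  also have "\<dots> = (\<integral>\<^sup>+k. (\<integral>\<^sup>+g. (\<integral>\<^sup>+l. F (?act k l g) \<partial>haar) \<partial>p) \<partial>haar)"
    by (intro nn_integral_cong hp.Fubini'[symmetric]) measurable
  also have "\<dots> = (\<integral>\<^sup>+g. (\<integral>\<^sup>+k. (\<integral>\<^sup>+l. F (?act k l g) \<partial>haar) \<partial>haar) \<partial>p)"
    by (rule hp.Fubini'[symmetric]) measurable
  also have "\<dots> = (\<integral>\<^sup>+g. (\<integral>\<^sup>+h. F h \<partial>lift_law (E ** fst (orbit_proj g)) (snd (orbit_proj g))) \<partial>p)"
  proof (rule nn_integral_cong_AE, use carrier in eventually_elim)
    fix g :: "('p, 'q) semi" assume "g \<in> semi_carrier"
    then have w: "fst g \<in> unitary_matrices" by (simp add: semi_carrier_mem)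
    obtain v where v: "v \<in> unitary_matrices" "v ** fst (snd g) = E ** mat_abs (fst (snd g))"
      using unitary_orbit_representative[OF E] .
    have y: "fst (snd g) = v\<^sup>\<dagger> ** (E ** mat_abs (fst (snd g)))"
      using unitary_cancel(1)[OF v(1), of "fst (snd g)"] by (simp add: v(2))
    have "(\<integral>\<^sup>+k. (\<integral>\<^sup>+l. F (?act k l g) \<partial>haar) \<partial>haar) = (\<integral>\<^sup>+k. (\<integral>\<^sup>+l. F (l, (k ** fst (snd g), snd (snd g))) \<partial>haar) \<partial>haar)"
    proof (rule nn_integral_cong_AE, use AE_haar_unitary in eventually_elim)
      fix k :: "complex^'p^'p" assume "k \<in> unitary_matrices"
      then show "(\<integral>\<^sup>+l. F (?act k l g) \<partial>haar) = (\<integral>\<^sup>+l. F (l, (k ** fst (snd g), snd (snd g))) \<partial>haar)"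
        by (intro haar_left_invariant[of "\<lambda>l. F (l, (k ** fst (snd g), snd (snd g)))"] unitary_mult w) measurable
    qed
    also have "\<dots> = (\<integral>\<^sup>+k. (\<integral>\<^sup>+l. F (l, ((k ** v\<^sup>\<dagger>) ** (E ** mat_abs (fst (snd g))), snd (snd g))) \<partial>haar) \<partial>haar)"
      by (subst (1) y) (simp add: matrix_mul_assoc)
    also have "\<dots> = (\<integral>\<^sup>+k. (\<integral>\<^sup>+l. F (l, (k ** (E ** mat_abs (fst (snd g))), snd (snd g))) \<partial>haar) \<partial>haar)"
      by (rule haar_right_invariant[of "\<lambda>k. \<integral>\<^sup>+l. F (l, (k ** (E ** mat_abs (fst (snd g))), snd (snd g))) \<partial>haar"])
         (measurable, rule unitary_ctranspose[OF v(1)])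
    also have "\<dots> = (\<integral>\<^sup>+h. F h \<partial>lift_law (E ** fst (orbit_proj g)) (snd (orbit_proj g)))"
      by (simp add: nn_integral_lift_law orbit_proj_def)
    finally show "(\<integral>\<^sup>+k. (\<integral>\<^sup>+l. F (?act k l g) \<partial>haar) \<partial>haar) =
        (\<integral>\<^sup>+h. F h \<partial>lift_law (E ** fst (orbit_proj g)) (snd (orbit_proj g)))" .
  qed
  finally show ?thesis .
qed

text \<open>Adding a point mass to a measure adds the value at the point to the integral.  With \<open>P\<close> and \<open>N\<close> the
  images of the positive and the negative part, this expresses that a signed measure has a point mass
  as image.\<close>

lemma nn_integral_add_point:
  assumes sets [simp, measurable_cong]: "sets P = sets borel" "sets N = sets borel"
    and eq: "\<And>B. B \<in> sets borel \<Longrightarrow> emeasure P B = emeasure N B + c * indicator B z"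
    and G: "G \<in> borel_measurable borel"
  shows "(\<integral>\<^sup>+x. G x \<partial>P) = (\<integral>\<^sup>+x. G x \<partial>N) + c * G z"
  using G
proof (induct rule: borel_measurable_induct)
  case (cong f g)
  then have "f = g" by auto
  then show ?case using cong by simp
next
  case (set A)
  then show ?case by (simp add: eq)
next
  case (mult u d)
  then show ?case by (simp add: nn_integral_cmult distrib_left mult_ac)
next
  case (add u v)
  then show ?case by (simp add: nn_integral_add distrib_left add_ac)
next
  case (seq U)
  have meas: "U i \<in> borel_measurable P" "U i \<in> borel_measurable N" for i
    using seq(1) by (simp_all cong: measurable_cong_sets)
  have inc: "incseq (\<lambda>i. \<integral>\<^sup>+x. U i x \<partial>N)" "incseq (\<lambda>i. c * U i z)"
    using seq(4) by (auto simp: incseq_def le_fun_def intro!: nn_integral_mono mult_left_mono)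
  have "(\<integral>\<^sup>+x. (SUP i. U i) x \<partial>P) = (SUP i. \<integral>\<^sup>+x. U i x \<partial>P)"
    unfolding SUP_apply by (rule nn_integral_monotone_convergence_SUP[OF seq(4) meas(1)])
  also have "\<dots> = (SUP i. (\<integral>\<^sup>+x. U i x \<partial>N) + c * U i z)"
    by (simp add: seq(3))
  also have "\<dots> = (SUP i. \<integral>\<^sup>+x. U i x \<partial>N) + (SUP i. c * U i z)"
    by (rule ennreal_SUP_add[OF inc])
  also have "(SUP i. \<integral>\<^sup>+x. U i x \<partial>N) = (\<integral>\<^sup>+x. (SUP i. U i) x \<partial>N)"
    unfolding SUP_apply by (rule nn_integral_monotone_convergence_SUP[OF seq(4) meas(2), symmetric])
  also have "(SUP i. c * U i z) = c * (SUP i. U i) z"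
    by (simp add: SUP_mult_left_ennreal image_comp comp_def)
  finally show ?case .
qed

lemma variation_image:
  assumes sets: "\<And>A. A \<in> sets M \<Longrightarrow> \<phi> ` A \<in> sets M" "\<And>A. A \<in> sets M \<Longrightarrow> \<psi> ` A \<in> sets M"
    and inv: "\<And>x. \<psi> (\<phi> x) = x" "\<And>x. \<phi> (\<psi> x) = x"
    and \<nu>: "\<And>A. A \<in> sets M \<Longrightarrow> \<nu> (\<phi> ` A) = \<nu> A"
  shows "variation M \<nu> (\<phi> ` E) = variation M \<nu> E"
proof (rule antisym; rule variation_least)
  fix A assume A: "A \<in> sets M" "A \<subseteq> E"
  then show "ennreal (\<nu> A) \<le> variation M \<nu> (\<phi> ` E)"
    using variation_upper[of "\<phi> ` A" M "\<phi> ` E" \<nu>] sets \<nu> by auto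
next
  fix B assume B: "B \<in> sets M" "B \<subseteq> \<phi> ` E"
  have "\<phi> ` \<psi> ` B = B" by (simp add: image_image inv)
  moreover have "\<psi> ` B \<subseteq> E" using B(2) inv by auto
  ultimately show "ennreal (\<nu> B) \<le> variation M \<nu> E"
    using variation_upper[of "\<psi> ` B" M E \<nu>] sets(2)[OF B(1)] \<nu>[OF sets(2)[OF B(1)]] by simp
qed

text \<open>The positive part inherits biinvariance, so averaging applies to it.\<close>

lemma pos_variation_average:
  fixes E :: "complex^'q^'p" and \<nu> :: "('p::finite, 'q::finite) semi set \<Rightarrow> real"
  assumes E: "E\<^sup>\<dagger> ** E = mat 1" and \<nu>: "signed_measure semi_space \<nu>"
    and inv: "\<And>k A. k \<in> unitary_matrices \<Longrightarrow> A \<in> sets semi_space \<Longrightarrow>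
      \<nu> ((\<lambda>g. semi_mult (k, (0, 0)) g) ` A) = \<nu> A \<and> \<nu> ((\<lambda>g. semi_mult g (k, (0, 0))) ` A) = \<nu> A"
    and A: "A \<in> sets semi_space"
  shows "emeasure (pos_variation semi_space \<nu>) A =
    (\<integral>\<^sup>+z. (\<integral>\<^sup>+h. indicator A h \<partial>lift_law (E ** fst z) (snd z)) \<partial>distr (pos_variation semi_space \<nu>) borel orbit_proj)"
proof -
  let ?p = "pos_variation semi_space \<nu>"
  have sets_p [measurable_cong]: "sets ?p = sets (restrict_space borel semi_carrier)"
    by (simp add: semi_space_def)
  have id [measurable]: "(\<lambda>g. g) \<in> ?p \<rightarrow>\<^sub>M borel"
    unfolding measurable_cong_sets[OF sets_p refl] by (rule measurable_restrict_space1) simp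
  define p where "p = distr ?p borel (\<lambda>g. g)"
  have p_emeasure: "emeasure p B = emeasure ?p (B \<inter> semi_carrier)" if "B \<in> sets borel" for B
    unfolding p_def using that by (subst emeasure_distr) auto
  interpret finite_measure ?p
    by (rule finite_measure_pos_variation[OF \<nu>])
  have invariant: "(\<integral>\<^sup>+g. F (\<phi> g) \<partial>p) = (\<integral>\<^sup>+g. F g \<partial>p)"
    if F: "F \<in> borel_measurable borel" and \<phi>: "\<phi> \<in> borel_measurable borel"
      and img: "\<And>B. B \<subseteq> semi_carrier \<Longrightarrow> \<psi> ` B = {g \<in> semi_carrier. \<phi> g \<in> B}"
      and carrier: "\<And>g. g \<in> semi_carrier \<Longrightarrow> \<phi> g \<in> semi_carrier"
      and emeas: "\<And>B. B \<in> sets semi_space \<Longrightarrow> emeasure ?p (\<psi> ` B) = emeasure ?p B"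
    for F and \<phi> \<psi> :: "('p, 'q) semi \<Rightarrow> ('p, 'q) semi"
  proof -
    have "distr p borel \<phi> = p"
    proof (rule measure_eqI)
      fix B assume "B \<in> sets (distr p borel \<phi>)"
      then have B [measurable]: "B \<in> sets borel" by simp
      have pre: "\<phi> -` B \<in> sets borel" using measurable_sets[OF \<phi> B] by simp
      have "emeasure (distr p borel \<phi>) B = emeasure p (\<phi> -` B)"
        using \<phi> by (subst emeasure_distr) (auto simp: p_def)
      also have "\<dots> = emeasure ?p (\<phi> -` B \<inter> semi_carrier)"
        by (rule p_emeasure[OF pre])
      also have "\<phi> -` B \<inter> semi_carrier = \<psi> ` (B \<inter> semi_carrier)"
        using carrier by (subst img) auto
      also have "emeasure ?p \<dots> = emeasure ?p (B \<inter> semi_carrier)"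
        by (rule emeas) (auto simp: sets_semi_space_iff)
      finally show "emeasure (distr p borel \<phi>) B = emeasure p B"
        by (simp add: p_emeasure)
    qed (simp add: p_def)
    then show ?thesis
      using nn_integral_distr[of \<phi> p borel F] F \<phi> by (simp add: p_def)
  qed
  have translate: "emeasure ?p (\<phi> ` B) = emeasure ?p B"
    if "\<And>A. A \<in> sets semi_space \<Longrightarrow> \<phi> ` A \<in> sets semi_space"
      "\<And>A. A \<in> sets semi_space \<Longrightarrow> \<psi> ` A \<in> sets semi_space"
      "\<And>x. \<psi> (\<phi> x) = x" "\<And>x. \<phi> (\<psi> x) = x"
      "\<And>A. A \<in> sets semi_space \<Longrightarrow> \<nu> (\<phi> ` A) = \<nu> A" and B: "B \<in> sets semi_space"
    for \<phi> \<psi> :: "('p, 'q) semi \<Rightarrow> ('p, 'q) semi" and B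
    using variation_image[of semi_space \<phi> \<psi> \<nu> B] that
    by (simp add: emeasure_pos_variation[OF \<nu>])
  have avg: "(\<integral>\<^sup>+g. F g \<partial>p) = (\<integral>\<^sup>+g. (\<integral>\<^sup>+h. F h \<partial>lift_law (E ** fst (orbit_proj g)) (snd (orbit_proj g))) \<partial>p)"
    if F [measurable]: "F \<in> borel_measurable borel" for F
  proof (rule biinvariant_integral[OF E _ _ _ _ _ F])
    show "finite_measure p"
      unfolding p_def by (rule finite_measure_distr[OF id])
    show "sets p = sets borel" by (simp add: p_def)
    show "AE g in p. g \<in> semi_carrier"
      unfolding p_def by (subst AE_distr_iff) auto
    fix F :: "('p, 'q) semi \<Rightarrow> ennreal" and k :: "complex^'p^'p"
    assume F: "F \<in> borel_measurable borel" and k: "k \<in> unitary_matrices"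
    note k' = unitary_ctranspose[OF k]
    show "(\<integral>\<^sup>+g. F (semi_mult (k, (0, 0)) g) \<partial>p) = (\<integral>\<^sup>+g. F g \<partial>p)"
    proof (rule invariant[OF F, where \<psi> = "\<lambda>g. semi_mult (k\<^sup>\<dagger>, (0, 0)) g"])
      show "emeasure ?p ((\<lambda>g. semi_mult (k\<^sup>\<dagger>, (0, 0)) g) ` B) = emeasure ?p B" if "B \<in> sets semi_space" for B
        by (rule translate[where \<psi> = "\<lambda>g. semi_mult (k, (0, 0)) g"])
           (use that k k' inv in \<open>simp_all add: unitary_translate_sets, simp_all add: semi_mult_unitary_left unitary_cancel\<close>)
    qed (use unitary_translate_image(1)[OF k'] k in
        \<open>auto simp: semi_mult_unitary_left semi_carrier_mem unitary_mult\<close>)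
    show "(\<integral>\<^sup>+g. F (semi_mult g (k, (0, 0))) \<partial>p) = (\<integral>\<^sup>+g. F g \<partial>p)"
    proof (rule invariant[OF F, where \<psi> = "\<lambda>g. semi_mult g (k\<^sup>\<dagger>, (0, 0))"])
      show "emeasure ?p ((\<lambda>g. semi_mult g (k\<^sup>\<dagger>, (0, 0))) ` B) = emeasure ?p B" if "B \<in> sets semi_space" for B
        by (rule translate[where \<psi> = "\<lambda>g. semi_mult g (k, (0, 0))"])
           (use that k k' inv in \<open>simp_all add: unitary_translate_sets, simp_all add: semi_mult_unitary_right unitary_cancel\<close>)
    qed (use unitary_translate_image(2)[OF k'] k in
        \<open>auto simp: semi_mult_unitary_right semi_carrier_mem unitary_mult\<close>)
  qed
  have A' [measurable]: "A \<in> sets borel" and sub: "A \<subseteq> semi_carrier"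
    using A by (auto simp: sets_semi_space_iff)
  interpret haar: sigma_finite_measure "haar :: (complex^'p^'p) measure"
    by (rule sigma_finite_measure_haar)
  have G: "(\<lambda>z. \<integral>\<^sup>+h. indicator A h \<partial>lift_law (E ** fst z) (snd z)) \<in> borel_measurable borel"
    by (subst nn_integral_lift_law) measurable
  have P: "orbit_proj \<in> borel_measurable (borel :: ('p, 'q) semi measure)"
    using orbit_proj_measurable[of "\<lambda>g. g" borel] by simp
  have "emeasure ?p A = (\<integral>\<^sup>+g. indicator A g \<partial>p)"
    using p_emeasure[OF A'] sub by (simp add: p_def Int_absorb2)
  also have "\<dots> = (\<integral>\<^sup>+g. (\<integral>\<^sup>+h. indicator A h \<partial>lift_law (E ** fst (orbit_proj g)) (snd (orbit_proj g))) \<partial>p)"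
    by (rule avg) measurable
  also have "\<dots> = (\<integral>\<^sup>+g. (\<integral>\<^sup>+h. indicator A h \<partial>lift_law (E ** fst (orbit_proj g)) (snd (orbit_proj g))) \<partial>?p)"
    unfolding p_def using measurable_compose[OF P G] by (intro nn_integral_distr[OF id]) simp
  also have "\<dots> = (\<integral>\<^sup>+z. (\<integral>\<^sup>+h. indicator A h \<partial>lift_law (E ** fst z) (snd z)) \<partial>distr ?p borel orbit_proj)"
    using measurable_compose[OF id P] G by (intro nn_integral_distr[symmetric]) auto
  finally show ?thesis .
qed

text \<open>By averaging, both parts of the Jordan decomposition are integrals over their images, and these
  images differ by the point mass.\<close>

lemma biinvariant_signed_determined:
  fixes E :: "complex^'q^'p" and \<nu> :: "('p::finite, 'q::finite) semi set \<Rightarrow> real"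
  assumes E: "E\<^sup>\<dagger> ** E = mat 1" and \<nu>: "signed_measure semi_space \<nu>"
    and inv: "\<And>k A. k \<in> unitary_matrices \<Longrightarrow> A \<in> sets semi_space \<Longrightarrow>
      \<nu> ((\<lambda>g. semi_mult (k, (0, 0)) g) ` A) = \<nu> A \<and> \<nu> ((\<lambda>g. semi_mult g (k, (0, 0))) ` A) = \<nu> A"
    and c: "c \<ge> 0"
    and proj: "\<And>B. B \<in> sets borel \<Longrightarrow> \<nu> (orbit_proj -` B \<inter> semi_carrier) = c * indicator B z"
    and A: "A \<in> sets semi_space"
  shows "\<nu> A = c * measure (lift_law (E ** fst z) (snd z)) A"
proof -
  let ?p = "pos_variation semi_space \<nu>" and ?n = "pos_variation semi_space (\<lambda>A. - \<nu> A)"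
  let ?G = "\<lambda>z. \<integral>\<^sup>+h. indicator A h \<partial>lift_law (E ** fst z) (snd z)"
  note \<nu>' = signed_measure_uminus[OF \<nu>]
  interpret p: finite_measure ?p by (rule finite_measure_pos_variation[OF \<nu>])
  interpret n: finite_measure ?n by (rule finite_measure_pos_variation[OF \<nu>'])
  interpret l: finite_measure "lift_law (E ** fst z) (snd z)" by (rule finite_lift_law)
  interpret haar: sigma_finite_measure "haar :: (complex^'p^'p) measure"
    by (rule sigma_finite_measure_haar)
  have [measurable]: "A \<in> sets borel"
    using A by (simp add: sets_semi_space_iff)
  have G [measurable]: "?G \<in> borel_measurable borel"
    by (subst nn_integral_lift_law) measurable
  have proj_meas: "orbit_proj \<in> borel_measurable (pos_variation semi_space \<nu>)" for \<nu> :: "('p, 'q) semi set \<Rightarrow> real"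
  proof -
    have sets: "sets (pos_variation semi_space \<nu>) = sets (restrict_space borel semi_carrier)"
      by (simp add: semi_space_def)
    show ?thesis
      unfolding measurable_cong_sets[OF sets refl]
      by (rule measurable_restrict_space1) measurable
  qed
  have pre: "(orbit_proj -` B \<inter> semi_carrier :: ('p, 'q) semi set) \<in> sets semi_space" if "B \<in> sets borel" for B
    using measurable_sets[OF proj_meas[of \<nu>] that] by simp
  have image: "emeasure (distr ?p borel orbit_proj) B = emeasure (distr ?n borel orbit_proj) B + ennreal c * indicator B z"
    if B: "B \<in> sets borel" for B
  proof -
    have "measure ?p (orbit_proj -` B \<inter> semi_carrier) = measure ?n (orbit_proj -` B \<inter> semi_carrier) + c * indicator B z"
      using jordan_decomposition[OF \<nu> pre[OF B]] proj[OF B] by simp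
    then show ?thesis
      using B c by (simp add: emeasure_distr proj_meas p.emeasure_eq_measure n.emeasure_eq_measure
          ennreal_plus indicator_def)
  qed
  have "emeasure ?p A = (\<integral>\<^sup>+z. ?G z \<partial>distr ?p borel orbit_proj)"
    by (rule pos_variation_average[OF E \<nu> inv A])
  also have "\<dots> = (\<integral>\<^sup>+z. ?G z \<partial>distr ?n borel orbit_proj) + ennreal c * ?G z"
    by (rule nn_integral_add_point) (simp_all add: image G)
  also have "(\<integral>\<^sup>+z. ?G z \<partial>distr ?n borel orbit_proj) = emeasure ?n A"
    by (rule pos_variation_average[OF E \<nu>' _ A, symmetric]) (simp add: inv)
  also have "?G z = emeasure (lift_law (E ** fst z) (snd z)) A"
    using A by simp
  finally have "measure ?p A = measure ?n A + c * measure (lift_law (E ** fst z) (snd z)) A"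
    using c by (simp add: p.emeasure_eq_measure n.emeasure_eq_measure l.emeasure_eq_measure
        ennreal_mult[symmetric] ennreal_plus[symmetric] del: ennreal_plus)
  then show ?thesis
    using jordan_decomposition[OF \<nu> A] by simp
qed

text \<open>The real part of a preimage of the point mass has the point mass as image, and the imaginary part
  has image 0.\<close>

lemma lift_measure_point:
  fixes E :: "complex^'q^'p"
  assumes E: "E\<^sup>\<dagger> ** E = mat 1" and r: "r \<in> psd_cone"
  shows "lift_measure (point_measure_at orbit_space (r, a)) = of_measure (lift_law (E ** r) a)"
  unfolding lift_measure_def the_inv_into_def
proof (rule the_equality)
  show "of_measure (lift_law (E ** r) a) \<in> biinvariant_measures \<and>
    proj_measure (of_measure (lift_law (E ** r) a)) = point_measure_at orbit_space (r, a)"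
    by (simp add: lift_law_biinvariant proj_measure_lift_law[OF E r])
  fix \<mu> :: "('p, 'q) semi set \<Rightarrow> complex"
  assume "\<mu> \<in> biinvariant_measures \<and> proj_measure \<mu> = point_measure_at orbit_space (r, a)"
  then have bi: "\<mu> \<in> biinvariant_measures" and im: "proj_measure \<mu> = point_measure_at orbit_space (r, a)"
    by auto
  have bounded: "\<mu> \<in> bounded_measures semi_space"
    using bi by (simp add: biinvariant_measures_def)
  have inv: "\<mu> ((\<lambda>g. semi_mult (k, (0, 0)) g) ` A) = \<mu> A \<and> \<mu> ((\<lambda>g. semi_mult g (k, (0, 0))) ` A) = \<mu> A"
    if "k \<in> unitary_matrices" "A \<in> sets semi_space" for k A
    using bi that by (auto simp: biinvariant_measures_def unitary_subgroup_def)
  have proj: "\<mu> (orbit_proj -` B \<inter> semi_carrier) = of_real (indicator B (r, a))" if B: "B \<in> sets borel" for B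
  proof -
    have B': "B \<inter> psd_cone \<times> UNIV \<in> sets orbit_space"
      using B by (auto simp: sets_orbit_space_iff)
    have pre: "orbit_proj -` B \<inter> semi_carrier = orbit_proj -` (B \<inter> psd_cone \<times> UNIV) \<inter> semi_carrier"
      using orbit_proj_in_cone by auto
    have "\<mu> (orbit_proj -` B \<inter> semi_carrier) = proj_measure \<mu> (B \<inter> psd_cone \<times> UNIV)"
      unfolding pre using B' by (simp add: proj_measure_def image_measure_def)
    also have "\<dots> = of_real (indicator B (r, a))"
      using B' r by (simp add: im point_measure_at_def indicator_def)
    finally show ?thesis .
  qed
  show "\<mu> = of_measure (lift_law (E ** r) a)"
  proof
    fix A
    show "\<mu> A = of_measure (lift_law (E ** r) a) A"
    proof (cases "A \<in> sets semi_space")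
      case True
      have "Re (\<mu> A) = 1 * measure (lift_law (E ** fst (r, a)) (snd (r, a))) A"
        by (rule biinvariant_signed_determined[OF E bounded_measures_signed(1)[OF bounded] _ _ _ True])
           (simp_all add: inv proj)
      moreover have "Im (\<mu> A) = 0 * measure (lift_law (E ** fst (r, a)) (snd (r, a))) A"
        by (rule biinvariant_signed_determined[OF E bounded_measures_signed(2)[OF bounded] _ _ _ True])
           (simp_all add: inv proj)
      ultimately show ?thesis by (simp add: of_measure_def complex_eq_iff)
    next
      case False
      then show ?thesis
        using bounded by (simp add: bounded_measures_def of_measure_def measure_notin_sets)
    qed
  qed
qed

section \<open>The orbit convolution\<close>

lemma semi_mult_carrier: "g \<in> semi_carrier \<Longrightarrow> h \<in> semi_carrier \<Longrightarrow> semi_mult g h \<in> semi_carrier"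
  by (simp add: semi_carrier_mem semi_mult_def unitary_mult)

lemma semi_mult_measurable_semi:
  "(\<lambda>z. semi_mult (fst z) (snd z)) \<in>
    (semi_space :: ('p::finite, 'q::finite) semi measure) \<Otimes>\<^sub>M semi_space \<rightarrow>\<^sub>M semi_space"
proof -
  let ?S = "semi_space :: ('p, 'q) semi measure"
  have id: "(\<lambda>g. g) \<in> borel_measurable ?S"
    unfolding semi_space_def by (rule measurable_restrict_space1) simp
  have "(\<lambda>z. semi_mult (fst z) (snd z)) \<in> borel_measurable (?S \<Otimes>\<^sub>M ?S)"
    by (rule semi_mult_measurable[OF measurable_compose[OF measurable_fst id] measurable_compose[OF measurable_snd id]])
  moreover have "(\<lambda>z. semi_mult (fst z) (snd z)) \<in> space (?S \<Otimes>\<^sub>M ?S) \<rightarrow> semi_carrier"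
    by (auto simp: space_pair_measure semi_mult_carrier)
  ultimately show ?thesis
    by (subst (3) semi_space_def) (rule measurable_restrict_space2)
qed

definition product_law :: "('p::finite, 'q::finite) semi measure \<Rightarrow> ('p, 'q) semi measure \<Rightarrow> ('p, 'q) semi measure" where
  "product_law N1 N2 = distr (N1 \<Otimes>\<^sub>M N2) semi_space (\<lambda>z. semi_mult (fst z) (snd z))"

lemma semi_mult_measurable_pair:
  assumes "sets N1 = sets semi_space" "sets N2 = sets semi_space"
  shows "(\<lambda>z. semi_mult (fst z) (snd z)) \<in> N1 \<Otimes>\<^sub>M N2 \<rightarrow>\<^sub>M semi_space"
  using semi_mult_measurable_semi measurable_cong_sets[OF sets_pair_measure_cong[OF assms] refl] by blast

lemma finite_product_law:
  assumes "finite_measure N1" "finite_measure N2" "sets N1 = sets semi_space" "sets N2 = sets semi_space"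
  shows "finite_measure (product_law N1 N2)"
  unfolding product_law_def
  by (intro finite_measure.finite_measure_distr finite_measure_pair_measure semi_mult_measurable_pair assms)

lemma semi_conv_of_measure:
  assumes N1: "finite_measure N1" "sets N1 = sets semi_space"
    and N2: "finite_measure N2" "sets N2 = sets semi_space"
  shows "semi_conv (of_measure N1) (of_measure N2) = of_measure (product_law N1 N2)"
proof
  fix A
  interpret N1: finite_measure N1 by fact
  interpret N2: finite_measure N2 by fact
  interpret pair_sigma_finite N1 N2 ..
  interpret pair: finite_measure "N1 \<Otimes>\<^sub>M N2"
    by (rule finite_measure_pair_measure[OF N2(1) N1(1)])
  note mult [measurable] = semi_mult_measurable_pair[OF N1(2) N2(2)]
  show "semi_conv (of_measure N1) (of_measure N2) A = of_measure (product_law N1 N2) A"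
  proof (cases "A \<in> sets semi_space")
    case True
    let ?f = "\<lambda>z. indicator A (semi_mult (fst z) (snd z)) :: complex"
    have [measurable]: "A \<in> sets semi_space" by fact
    have "?f \<in> borel_measurable (N1 \<Otimes>\<^sub>M N2)" by measurable
    then have int: "integrable (N1 \<Otimes>\<^sub>M N2) ?f"
      by (intro pair.integrable_const_bound[where B = 1]) (auto simp: indicator_def)
    have "semi_conv (of_measure N1) (of_measure N2) A = (LINT g|N1. (LINT h|N2. indicator A (semi_mult g h)))"
      using True by (simp add: semi_conv_def cintegral_of_measure N1 N2)
    also have "\<dots> = (LINT z|(N1 \<Otimes>\<^sub>M N2). ?f z)"
      using integral_fst'[OF int] by simp
    also have "\<dots> = (LINT g|product_law N1 N2. indicator A g)"
      unfolding product_law_def by (rule integral_distr[OF mult, symmetric]) measurable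
    also have "\<dots> = (LINT g|product_law N1 N2. of_real (indicator A g))"
      by (rule Bochner_Integration.integral_cong) (simp_all add: indicator_def)
    also have "\<dots> = of_real (measure (product_law N1 N2) A)"
      using sets.sets_into_space[OF True] by (simp add: product_law_def Int_absorb2)
    finally show ?thesis by (simp add: of_measure_def)
  next
    case False
    then show ?thesis
      by (simp add: semi_conv_def of_measure_def product_law_def measure_notin_sets)
  qed
qed

text \<open>The product of two independent elements of double cosets is again a random element; all unitary
  factors but one are absorbed by the invariance of the absolute value, of the trace and of Haar
  measure.\<close>

lemma orbit_conv_law:
  fixes E :: "complex^'q^'p" and r s :: "complex^'q^'q" and a b :: real
  assumes E: "E\<^sup>\<dagger> ** E = mat 1"
  defines "Q \<equiv> \<lambda>u. (mat_abs (E ** r + u ** (E ** s)), a + b - Im (trace ((E ** r)\<^sup>\<dagger> ** (u ** (E ** s)))))"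
  shows "distr (product_law (lift_law (E ** r) a) (lift_law (E ** s) b)) orbit_space orbit_proj = distr haar orbit_space Q"
proof (rule measure_eqI)
  let ?N1 = "lift_law (E ** r) a" and ?N2 = "lift_law (E ** s) b"
  interpret haar: sigma_finite_measure "haar :: (complex^'p^'p) measure"
    by (rule sigma_finite_measure_haar)
  interpret N2: finite_measure ?N2 by (rule finite_lift_law)
  have Q_borel [measurable]: "Q \<in> borel_measurable borel"
    unfolding Q_def by measurable
  have "Q \<in> borel \<rightarrow>\<^sub>M orbit_space"
    unfolding orbit_space_def
    by (rule measurable_restrict_space2[OF _ Q_borel]) (auto simp: Q_def psd_cone_def pos_semidef_mat_abs)
  then have Q: "Q \<in> haar \<rightarrow>\<^sub>M orbit_space"
    by (simp cong: measurable_cong_sets)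
  have mult: "(\<lambda>z. semi_mult (fst z) (snd z)) \<in> ?N1 \<Otimes>\<^sub>M ?N2 \<rightarrow>\<^sub>M semi_space"
    by (rule semi_mult_measurable_pair) simp_all
  fix B assume "B \<in> sets (distr (product_law ?N1 ?N2) orbit_space orbit_proj)"
  then have B: "B \<in> sets orbit_space" by simp
  then have [measurable]: "B \<in> sets borel" by (simp add: sets_orbit_space_iff)
  let ?f = "\<lambda>z. indicator B (orbit_proj (semi_mult (fst z) (snd z))) :: ennreal"
  have f: "?f \<in> borel_measurable (?N1 \<Otimes>\<^sub>M ?N2)"
    using B by (intro measurable_compose[OF mult] measurable_compose[OF orbit_proj_measurable_semi]) simp
  have step: "orbit_proj (semi_mult (k, (u ** (E ** r), a)) (l, (v ** (E ** s), b))) = Q (u\<^sup>\<dagger> ** k ** v)"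
    if u: "u \<in> unitary_matrices" for k l u v :: "complex^'p^'p"
  proof -
    have "u ** (E ** r) + k ** (v ** (E ** s)) = u ** (E ** r + (u\<^sup>\<dagger> ** k ** v) ** (E ** s))"
      using u by (simp add: matrix_mult_add_right matrix_mul_assoc unitaryD)
    then have "mat_abs (u ** (E ** r) + k ** (v ** (E ** s))) = mat_abs (E ** r + (u\<^sup>\<dagger> ** k ** v) ** (E ** s))"
      by (simp add: mat_abs_unitary u)
    then show ?thesis
      by (simp add: orbit_proj_def semi_mult_def heis_mult_def heis_act_def Q_def ctranspose_mult matrix_mul_assoc)
  qed
  have "emeasure (distr (product_law ?N1 ?N2) orbit_space orbit_proj) B =
      (\<integral>\<^sup>+g. indicator B (orbit_proj g) \<partial>product_law ?N1 ?N2)"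
    using B orbit_proj_measurable_semi
    by (subst nn_integral_indicator[symmetric], simp, subst nn_integral_distr) (auto simp: product_law_def)
  also have "\<dots> = (\<integral>\<^sup>+z. ?f z \<partial>(?N1 \<Otimes>\<^sub>M ?N2))"
    unfolding product_law_def
    using B by (intro nn_integral_distr[OF mult]) (simp add: measurable_compose[OF orbit_proj_measurable_semi])
  also have "\<dots> = (\<integral>\<^sup>+g. (\<integral>\<^sup>+h. indicator B (orbit_proj (semi_mult g h)) \<partial>?N2) \<partial>?N1)"
    by (subst N2.nn_integral_fst[OF f, symmetric]) simp
  also have "\<dots> = (\<integral>\<^sup>+g. (\<integral>\<^sup>+v. (\<integral>\<^sup>+l. indicator B (orbit_proj (semi_mult g (l, (v ** (E ** s), b)))) \<partial>haar) \<partial>haar) \<partial>?N1)"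
    by (intro nn_integral_cong nn_integral_lift_law) measurable
  also have "\<dots> = (\<integral>\<^sup>+u. (\<integral>\<^sup>+k. (\<integral>\<^sup>+v. (\<integral>\<^sup>+l. indicator B (orbit_proj (semi_mult (k, (u ** (E ** r), a)) (l, (v ** (E ** s), b)))) \<partial>haar) \<partial>haar) \<partial>haar) \<partial>haar)"
    by (rule nn_integral_lift_law) measurable
  also have "\<dots> = (\<integral>\<^sup>+u. (\<integral>\<^sup>+k. (\<integral>\<^sup>+v. (\<integral>\<^sup>+l. indicator B (Q v) \<partial>(haar :: (complex^'p^'p) measure)) \<partial>haar) \<partial>(haar :: (complex^'p^'p) measure)) \<partial>(haar :: (complex^'p^'p) measure))"
  proof (rule nn_integral_cong_AE, use AE_haar_unitary in eventually_elim,
      rule nn_integral_cong_AE, use AE_haar_unitary in eventually_elim)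
    fix u k :: "complex^'p^'p" assume u: "u \<in> unitary_matrices" and k: "k \<in> unitary_matrices"
    have "(\<integral>\<^sup>+v. (\<integral>\<^sup>+l. indicator B (orbit_proj (semi_mult (k, (u ** (E ** r), a)) (l, (v ** (E ** s), b)))) \<partial>haar) \<partial>haar) =
        (\<integral>\<^sup>+v. indicator B (Q ((u\<^sup>\<dagger> ** k) ** v)) \<partial>haar)"
      by (simp add: step[OF u])
    also have "\<dots> = (\<integral>\<^sup>+v. indicator B (Q v) \<partial>haar)"
      by (intro haar_left_invariant[of "\<lambda>v. indicator B (Q v)"] unitary_mult unitary_ctranspose u k) measurable
    finally show "(\<integral>\<^sup>+v. (\<integral>\<^sup>+l. indicator B (orbit_proj (semi_mult (k, (u ** (E ** r), a)) (l, (v ** (E ** s), b)))) \<partial>haar) \<partial>haar) =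
        (\<integral>\<^sup>+v. (\<integral>\<^sup>+l. indicator B (Q v) \<partial>(haar :: (complex^'p^'p) measure)) \<partial>haar)"
      by simp
  qed
  also have "\<dots> = (\<integral>\<^sup>+v. indicator B (Q v) \<partial>haar)"
    by simp
  also have "\<dots> = emeasure (distr haar orbit_space Q) B"
    using B by (subst nn_integral_indicator[symmetric], simp, subst nn_integral_distr[OF Q]) auto
  finally show "emeasure (distr (product_law ?N1 ?N2) orbit_space orbit_proj) B = emeasure (distr haar orbit_space Q) B" .
qed simp

lemma orthogonal_isometries_exist:
  assumes "2 * CARD('q) \<le> CARD('p)"
  obtains E E' :: "complex^'q^'p" where "E\<^sup>\<dagger> ** E = mat 1" "E'\<^sup>\<dagger> ** E' = mat 1" "E\<^sup>\<dagger> ** E' = 0"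
proof -
  have "card (UNIV :: ('q + 'q) set) \<le> card (UNIV :: 'p set)"
    using assms by (simp add: card_UNIV_sum)
  then obtain e :: "'q + 'q \<Rightarrow> 'p" where e: "inj e"
    using card_le_inj[of "UNIV :: ('q + 'q) set" "UNIV :: 'p set"] by auto
  define iso :: "('q \<Rightarrow> 'p) \<Rightarrow> complex^'q^'p" where "iso f = (\<chi> i j. if i = f j then 1 else 0)" for f
  have iso: "(iso f)\<^sup>\<dagger> ** iso g = (\<chi> j k. if f j = g k then 1 else 0)" for f g
    by (simp add: vec_eq_iff iso_def matrix_matrix_mult_def if_distrib[of cnj] if_distrib[of "\<lambda>x. x * _"] cong: if_cong)
  show ?thesis
  proof
    show "(iso (\<lambda>j. e (Inl j)))\<^sup>\<dagger> ** iso (\<lambda>j. e (Inl j)) = mat 1" "(iso (\<lambda>j. e (Inr j)))\<^sup>\<dagger> ** iso (\<lambda>j. e (Inr j)) = mat 1"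
      "(iso (\<lambda>j. e (Inl j)))\<^sup>\<dagger> ** iso (\<lambda>j. e (Inr j)) = 0"
      unfolding iso using e by (auto simp: vec_eq_iff mat_def inj_eq)
  qed
qed

text \<open>The radial argument of the integrand is positive semidefinite on the ball: it differs from the
  Gram matrix of \<open>r + w s\<close> by \<open>s (1 - w\<^sup>\<dagger> w) s\<close>.\<close>

lemma ball_argument_pos_semidef:
  assumes r: "r\<^sup>\<dagger> = r" and s: "s\<^sup>\<dagger> = s" and w: "w \<in> matrix_ball"
  shows "pos_semidef (r ** r + s ** s + r ** w ** s + (r ** w ** s)\<^sup>\<dagger>)"
proof -
  have "pos_semidef (mat 1 - gram w)"
    using w by (simp add: matrix_ball_def pos_def_imp_pos_semidef)
  then have "pos_semidef (gram (r + w ** s) + s\<^sup>\<dagger> ** (mat 1 - gram w) ** s)"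
    by (intro pos_semidef_add pos_semidef_gram pos_semidef_conj)
  also have "gram (r + w ** s) + s\<^sup>\<dagger> ** (mat 1 - gram w) ** s = r ** r + s ** s + r ** w ** s + (r ** w ** s)\<^sup>\<dagger>"
    by (simp add: r s ctranspose_add ctranspose_mult matrix_ring_simps matrix_mul_assoc)
  finally show ?thesis .
qed

theorem proposition2p1:
  fixes f :: "(complex^'q::finite^'q) \<times> real \<Rightarrow> complex"
    and r s :: "complex^'q^'q"
    and a b :: real
  assumes "CARD('p::finite) \<ge> 2 * CARD('q)"
    and "continuous_on (psd_cone \<times> UNIV) f"
    and "bounded (f ` (psd_cone \<times> UNIV))"
    and "r \<in> psd_cone" and "s \<in> psd_cone"
  shows "cintegral orbit_space
           (orbit_conv TYPE('p) (point_measure_at orbit_space (r, a))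
                                (point_measure_at orbit_space (s, b))) f =
         kappa TYPE('p) TYPE('q) *
         (LINT w:matrix_ball|lborel.
            f (psd_sqrt (r ** r + s ** s + r ** w ** s + ctranspose (r ** w ** s)),
               a + b - Im (trace (r ** w ** s))) *
            det (mat 1 - ctranspose w ** w) ^ (CARD('p) - 2 * CARD('q)))"
proof -
  obtain E E' :: "complex^'q^'p" where E: "E\<^sup>\<dagger> ** E = mat 1" "E'\<^sup>\<dagger> ** E' = mat 1" "E\<^sup>\<dagger> ** E' = 0"
    using orthogonal_isometries_exist[OF assms(1)] .
  have r: "r\<^sup>\<dagger> = r" and s: "s\<^sup>\<dagger> = s"
    using assms(4,5) by (auto simp: psd_cone_def pos_semidef_hermitian)
  define N where "N = product_law (lift_law (E ** r) a) (lift_law (E ** s) b)"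
  have N: "finite_measure N" "sets N = sets semi_space"
    unfolding N_def by (simp_all add: finite_product_law finite_lift_law) (simp add: product_law_def)
  define Q where "Q u = (mat_abs (E ** r + u ** (E ** s)), a + b - Im (trace ((E ** r)\<^sup>\<dagger> ** (u ** (E ** s)))))" for u
  define T where "T w = r ** r + s ** s + r ** w ** s + (r ** w ** s)\<^sup>\<dagger>" for w
  \<comment> \<open>extension by 0 beyond the cone, to have a function that is measurable on the whole space\<close>
  define f0 where "f0 z = (if z \<in> psd_cone \<times> UNIV then f z else 0)" for z
  define g where "g w = f0 (psd_sqrt (T w), a + b - Im (trace (r ** w ** s)))" for w
  have f_meas: "f \<in> borel_measurable orbit_space"
    unfolding orbit_space_def by (rule borel_measurable_continuous_on_restrict[OF assms(2)])
  have [measurable]: "f0 \<in> borel_measurable borel"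
    unfolding f0_def[abs_def]
    by (rule measurable_If_restrict_space_iff[THEN iffD2])
       (use f_meas in \<open>simp_all add: orbit_space_def\<close>)
  have [measurable]: "g \<in> borel_measurable borel"
    unfolding g_def T_def by measurable
  have Q_meas: "Q \<in> haar \<rightarrow>\<^sub>M orbit_space"
  proof -
    have "Q \<in> borel_measurable haar"
      unfolding Q_def by measurable
    then show ?thesis
      unfolding orbit_space_def
      by (intro measurable_restrict_space2) (auto simp: Q_def psd_cone_def pos_semidef_mat_abs)
  qed
  have conv: "orbit_conv TYPE('p) (point_measure_at orbit_space (r, a)) (point_measure_at orbit_space (s, b)) =
      of_measure (distr haar orbit_space Q)"
    unfolding orbit_conv_def lift_measure_point[OF E(1) assms(4)] lift_measure_point[OF E(1) assms(5)]
      semi_conv_of_measure[OF finite_lift_law sets_lift_law finite_lift_law sets_lift_law]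
      N_def[symmetric] proj_measure_of_measure[OF N]
    unfolding N_def orbit_conv_law[OF E(1)] Q_def[abs_def] ..
  have fQ: "f (Q u) = g (E\<^sup>\<dagger> ** (u ** E))" if u: "u \<in> unitary_matrices" for u
  proof -
    define w where "w = E\<^sup>\<dagger> ** (u ** E)"
    have "gram (E ** r + u ** (E ** s)) =
        r ** (E\<^sup>\<dagger> ** E) ** r + s ** (E\<^sup>\<dagger> ** (u\<^sup>\<dagger> ** u) ** E) ** s + r ** w ** s + (r ** w ** s)\<^sup>\<dagger>"
      by (simp add: w_def r s ctranspose_add ctranspose_mult matrix_mult_add_left matrix_mult_add_right matrix_mul_assoc)
    also have "\<dots> = T w"
      by (simp add: T_def E unitaryD(1)[OF u])
    finally have gram: "gram (E ** r + u ** (E ** s)) = T w" .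
    have "pos_semidef (T w)"
      using pos_semidef_gram[of "E ** r + u ** (E ** s)"] by (simp add: gram)
    moreover have "trace ((E ** r)\<^sup>\<dagger> ** (u ** (E ** s))) = trace (r ** w ** s)"
      by (simp add: w_def ctranspose_mult r matrix_mul_assoc)
    ultimately show ?thesis
      by (simp add: Q_def g_def f0_def mat_abs_def gram psd_cone_def psd_sqrt_pos w_def[symmetric])
  qed
  have "cintegral orbit_space (of_measure (distr haar orbit_space Q)) f = (LINT z|distr haar orbit_space Q. f z)"
    by (rule cintegral_of_measure) (simp_all add: finite_measure.finite_measure_distr[OF finite_measure_haar Q_meas])
  also have "\<dots> = (LINT u|haar. f (Q u))"
    by (rule integral_distr[OF Q_meas f_meas])
  also have "\<dots> = (LINT u|haar. g (E\<^sup>\<dagger> ** (u ** E)))"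
  proof (rule integral_cong_AE)
    show "AE u in haar. f (Q u) = g (E\<^sup>\<dagger> ** (u ** E))"
      using AE_haar_unitary by eventually_elim (rule fQ)
    show "(\<lambda>u. f (Q u)) \<in> borel_measurable haar"
      by (rule measurable_compose[OF Q_meas f_meas])
  qed measurable
  also have "\<dots> = kappa TYPE('p) TYPE('q) *
      (LINT w:matrix_ball|lborel. g w * det (mat 1 - gram w) ^ (CARD('p) - 2 * CARD('q)))"
    by (rule truncation_law[OF E assms(1)]) measurable
  also have "(LINT w:matrix_ball|lborel. g w * det (mat 1 - gram w) ^ (CARD('p) - 2 * CARD('q))) =
      (LINT w:matrix_ball|lborel. f (psd_sqrt (T w), a + b - Im (trace (r ** w ** s))) *
        det (mat 1 - gram w) ^ (CARD('p) - 2 * CARD('q)))"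
  proof (rule set_lebesgue_integral_cong)
    have ball: "matrix_ball = {w :: complex^'q^'q. pos_def (mat 1 - gram w)}"
      by (simp add: matrix_ball_def)
    show "(matrix_ball :: (complex^'q^'q) set) \<in> sets lborel"
      unfolding ball by measurable
    show "\<forall>w. w \<in> matrix_ball \<longrightarrow> g w * det (mat 1 - gram w) ^ (CARD('p) - 2 * CARD('q)) =
        f (psd_sqrt (T w), a + b - Im (trace (r ** w ** s))) * det (mat 1 - gram w) ^ (CARD('p) - 2 * CARD('q))"
      using ball_argument_pos_semidef[OF r s]
      by (auto simp: g_def f0_def T_def psd_cone_def psd_sqrt_pos)
  qed
  finally show ?thesis
    unfolding conv T_def .
qed

end
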